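(* Let $X=\{X(t)\}$ be the Markov chain on $\mathbb{R}^\ell$ defined by $X(t+1)=a(X(t),N(t+1))$, and suppose that assumptions (A1)--(A4) (listed in the context) hold. Let $v=e^V$ with $V$ the Lyapunov function of (A4), and let $\pi$ be the unique invariant probability measure. Suppose that $c\in L_\infty^{v^\eta}$ with $\eta\in(0,1]$, and let $\bar c=\pi(c)$. Then the function $$h(x)=\sum_{t=0}^\infty \mathsf{E}_x[c(X(t))-\bar c],\qquad x\in\mathbb{R}^\ell,$$ exists as an element of $L_\infty^{v^\eta}$. It is a solution to Poisson's equation $h-Ph=c-\bar c$, and it is the unique solution among all functions in $L_\infty^{v^\eta}$ with $\pi$-mean equal to zero. If $\eta<1$, then in addition: (i) If $c\in L_\infty^{v^\eta,0}$ then $h\in L_\infty^{v^\eta,0}$. (ii) If $c\in L_\infty^{v^\eta,1}$ then $h\in L_\infty^{v^\eta,1}$, with gradient $$\nabla h=\sum_{t=0}^\infty\nabla P^tc ,$$ and also $$\nabla h=\sum_{t=0}^\infty Q^t\nabla c .$$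
   Context: **Model.** The state space is $\mathsf{X}=\mathbb{R}^\ell$ with Borel $\sigma$-field $\mathcal{B}$. The chain is $X(t+1)=a(X(t),N(t+1))$, $t\ge 0$, where $\{N(t)\}$ are i.i.d. $\mathbb{R}^m$-valued random variables and $a:\mathbb{R}^\ell\times\mathbb{R}^m\to\mathbb{R}^\ell$ is continuous. $P^t(x,A)=\Pr\{X(t)\in A\mid X(0)=x\}$, $P=P^1$, $P^tf(x)=\int f(y)P^t(x,dy)=\mathsf{E}_x[f(X(t))]$, and $\mu(f)=\int f\,d\mu$. **Assumptions.** (A1) (i) The process $\{N(t)\}$ does not depend on the initial condition $X(0)$. (ii) $a$ is continuously differentiable in its first variable, with $\sup_{x,n}\|\nabla_x a(x,n)\|<\infty$ (any matrix norm), where $[\nabla_x a(x,n)]_{i,j}=\partial a_j(x,n)/\partial x_i$. (A2) For some $t_0\ge1$ there is a continuously differentiable function $p_{t_0}$ on $\mathsf{X}\times\mathsf{X}$ with $P^{t_0}(x,A)=\int_A p_{t_0}(x,y)\,dy$ for all $x\in\mathsf{X}$, $A\in\mathcal{B}$. (A3) There is a state $x_0\in\mathsf{X}$ such that for any $x\in\mathsf{X}$ and any open set $O$ containing $x_0$, $P^t(x,O)>0$ for all $t\ge0$ sufficiently large. (A4) There are functions $V:\mathsf{X}\to(0,\infty)$ and $W:\mathsf{X}\to[1,\infty)$, both continuously differentiable with compact sublevel sets $\{x: F(x)\le r\}$ ($F=V,W$, $r\ge 0$), a compact set $C\subset\mathsf{X}$ and constants $\delta>0$, $b<\infty$ such that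 (DV3) holds: $\log(Pe^V)-V\le-\delta W+b\,\mathbb{I}_C$ on $\mathsf{X}$. Under (A1)--(A4) the chain is known to have a unique invariant probability measure $\pi$ and to be $v$-uniformly ergodic with $v=e^V$ (i.e. there are $b<\infty$, $\rho<1$ with $|P^tf(x)-\pi(f)|\le b\rho^t\|f\|_v v(x)$ for all $f\in L_\infty^v$, $t\ge0$, $x\in\mathsf X$). **Spaces.** For a continuous $w:\mathsf{X}\to[1,\infty)$ (such as $w=v^\eta=e^{\eta V}$): $\|f\|_w=\sup_x|f(x)|/w(x)$; $L_\infty^w=\{f \text{ measurable}:\|f\|_w<\infty\}$; $L_\infty^{w,0}=\{f\in L_\infty^w: f\text{ continuous}\}$ with norm $\|\cdot\|_w$; $L_\infty^{w,1}$ is the space of $f:\mathsf X\to\mathbb{R}$ such that $f,\partial_1f,\dots,\partial_\ell f$ exist and all belong to $L_\infty^{w,0}$, with norm $\|f\|_{w,1}=\max\{\|f\|_w,\|\partial_1f\|_w,\dots,\|\partial_\ell f\|_w\}$. **Sensitivity process and $Q^t$.** $\mathcal{S}(t)$ is the $\ell\times\ell$ matrix $\mathcal{S}_{i,j}(t)=\partial X_i(t)/\partial X_j(0)$; equivalently $\mathcal{S}(0)=I$, $\mathcal{S}(t+1)=\mathcal{A}(t+1)\mathcal{S}(t)$ with $\mathcal{A}^{T}(t)=\nabla_xa(X(t-1),N(t))$. For $g:\mathsf{X}\to\mathbb{R}^\ell$ measurable, $Q^0g=g$ and $Q^tg(x)=\mathsf{E}_x[\mathcal{S}^{T}(t)g(X(t))]$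 for $t\ge1$. *)

theory Defs
  imports "HOL-Probability.Probability"
begin

section \<open>Differentiability\<close>

definition cont_differentiable ::
    "('a::real_normed_vector \<Rightarrow> 'b::real_normed_vector) \<Rightarrow> bool" where
  "cont_differentiable f \<longleftrightarrow>
     (\<exists>f' :: 'a \<Rightarrow> 'a \<Rightarrow>\<^sub>L 'b.
        (\<forall>x. (f has_derivative blinfun_apply (f' x)) (at x)) \<and> continuous_on UNIV f')"

definition has_partial :: "'l::finite \<Rightarrow> (real^'l \<Rightarrow> real) \<Rightarrow> real^'l \<Rightarrow> bool" where
  "has_partial i f x \<longleftrightarrow> (\<lambda>s::real. f (x + s *\<^sub>R axis i 1)) field_differentiable (at 0)"

definition partial :: "'l::finite \<Rightarrow> (real^'l \<Rightarrow> real) \<Rightarrow> real^'l \<Rightarrow> real" where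
  "partial i f x = deriv (\<lambda>s::real. f (x + s *\<^sub>R axis i 1)) 0"

definition grad :: "(real^'l::finite \<Rightarrow> real) \<Rightarrow> real^'l \<Rightarrow> real^'l" where
  "grad f x = (\<chi> i. partial i f x)"

section \<open>The chain\<close>

definition iid_noise :: "'w measure \<Rightarrow> (nat \<Rightarrow> 'w \<Rightarrow> real^'m::finite) \<Rightarrow> bool" where
  "iid_noise M N \<longleftrightarrow> prob_space M \<and> prob_space.indep_vars M (\<lambda>_. borel) N {1..} \<and>
     (\<forall>t\<ge>1. distr M borel (N t) = distr M borel (N 1))"

text \<open>
  The chain is realised simultaneously from every deterministic initial state, driven by one and
  the same noise. This is the hypothesis that the noise does not depend on the initial condition;
  conditioning on \<open>X(0) = x\<close> then amounts to starting at \<open>x\<close>, and the trajectory can be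
  differentiated with respect to \<open>x\<close> for a fixed noise realisation.
\<close>

primrec chain :: "(real^'l::finite \<Rightarrow> real^'m::finite \<Rightarrow> real^'l) \<Rightarrow> (nat \<Rightarrow> 'w \<Rightarrow> real^'m) \<Rightarrow>
    real^'l \<Rightarrow> nat \<Rightarrow> 'w \<Rightarrow> real^'l" where
  "chain a N x 0 \<omega> = x"
| "chain a N x (Suc t) \<omega> = a (chain a N x t \<omega>) (N (Suc t) \<omega>)"

definition Pker :: "'w measure \<Rightarrow> (nat \<Rightarrow> 'w \<Rightarrow> real^'m::finite) \<Rightarrow>
    (real^'l::finite \<Rightarrow> real^'m \<Rightarrow> real^'l) \<Rightarrow> nat \<Rightarrow> real^'l \<Rightarrow> (real^'l) measure" where
  "Pker M N a t x = distr M borel (chain a N x t)"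

definition Pop :: "'w measure \<Rightarrow> (nat \<Rightarrow> 'w \<Rightarrow> real^'m::finite) \<Rightarrow>
    (real^'l::finite \<Rightarrow> real^'m \<Rightarrow> real^'l) \<Rightarrow> nat \<Rightarrow> (real^'l \<Rightarrow> real) \<Rightarrow> real^'l \<Rightarrow> real" where
  "Pop M N a t f x = (LINT y|Pker M N a t x. f y)"

definition invariant_prob :: "'w measure \<Rightarrow> (nat \<Rightarrow> 'w \<Rightarrow> real^'m::finite) \<Rightarrow>
    (real^'l::finite \<Rightarrow> real^'m \<Rightarrow> real^'l) \<Rightarrow> (real^'l) measure \<Rightarrow> bool" where
  "invariant_prob M N a \<pi> \<longleftrightarrow> prob_space \<pi> \<and> sets \<pi> = sets borel \<and>
     (\<forall>A\<in>sets borel. emeasure \<pi> A = (\<integral>\<^sup>+x. emeasure (Pker M N a 1 x) A \<partial>\<pi>))"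

section \<open>Assumptions\<close>

text \<open>The \<open>(i, j)\<close> entry is the partial derivative of the \<open>j\<close>-th component of \<open>a\<close> in \<open>x\<^sub>i\<close>,
  i.e. this is the transpose of the Jacobian matrix.\<close>

definition grad_x :: "(real^'l::finite \<Rightarrow> real^'m::finite \<Rightarrow> real^'l) \<Rightarrow>
    real^'l \<Rightarrow> real^'m \<Rightarrow> real^'l^'l" where
  "grad_x a x n = (\<chi> i j. partial i (\<lambda>z. a z n $ j) x)"

definition A1 :: "(real^'l::finite \<Rightarrow> real^'m::finite \<Rightarrow> real^'l) \<Rightarrow> bool" where
  "A1 a \<longleftrightarrow> (\<forall>n. cont_differentiable (\<lambda>x. a x n)) \<and> bounded (range (\<lambda>(x, n). grad_x a x n))"

text \<open>The density \<open>p\<close> is automatically integrable over the whole space: otherwise its Bochner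
  integral would be \<open>0\<close> instead of \<open>1\<close>.\<close>

definition A2 :: "'w measure \<Rightarrow> (nat \<Rightarrow> 'w \<Rightarrow> real^'m::finite) \<Rightarrow>
    (real^'l::finite \<Rightarrow> real^'m \<Rightarrow> real^'l) \<Rightarrow> bool" where
  "A2 M N a \<longleftrightarrow> (\<exists>t0\<ge>1. \<exists>p :: (real^'l) \<times> (real^'l) \<Rightarrow> real. cont_differentiable p \<and>
     (\<forall>x. \<forall>A\<in>sets borel. measure (Pker M N a t0 x) A = (LINT y:A|lborel. p (x, y))))"

definition A3 :: "'w measure \<Rightarrow> (nat \<Rightarrow> 'w \<Rightarrow> real^'m::finite) \<Rightarrow>
    (real^'l::finite \<Rightarrow> real^'m \<Rightarrow> real^'l) \<Rightarrow> bool" where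
  "A3 M N a \<longleftrightarrow> (\<exists>x0. \<forall>x. \<forall>U. open U \<and> x0 \<in> U \<longrightarrow>
     (\<forall>\<^sub>F t in sequentially. measure (Pker M N a t x) U > 0))"

text \<open>Integrability says that \<open>P e\<^sup>V\<close> is finite, which the drift inequality tacitly
  includes; the Bochner integral alone would not enforce it.\<close>

definition DV3 :: "'w measure \<Rightarrow> (nat \<Rightarrow> 'w \<Rightarrow> real^'m::finite) \<Rightarrow>
    (real^'l::finite \<Rightarrow> real^'m \<Rightarrow> real^'l) \<Rightarrow> (real^'l \<Rightarrow> real) \<Rightarrow> (real^'l \<Rightarrow> real) \<Rightarrow>
    (real^'l) set \<Rightarrow> real \<Rightarrow> real \<Rightarrow> bool" where
  "DV3 M N a V W C \<delta> b \<longleftrightarrow> (\<forall>x. integrable (Pker M N a 1 x) (\<lambda>y. exp (V y)) \<and>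
     ln (Pop M N a 1 (\<lambda>y. exp (V y)) x) - V x \<le> - \<delta> * W x + b * indicator C x)"

definition A4 :: "'w measure \<Rightarrow> (nat \<Rightarrow> 'w \<Rightarrow> real^'m::finite) \<Rightarrow>
    (real^'l::finite \<Rightarrow> real^'m \<Rightarrow> real^'l) \<Rightarrow> (real^'l \<Rightarrow> real) \<Rightarrow> bool" where
  "A4 M N a V \<longleftrightarrow>
     (\<forall>x. V x > 0) \<and> cont_differentiable V \<and> (\<forall>r\<ge>0. compact {x. V x \<le> r}) \<and>
     (\<exists>W C \<delta> b. (\<forall>x. W x \<ge> 1) \<and> cont_differentiable W \<and> (\<forall>r\<ge>0. compact {x. W x \<le> r}) \<and>
        compact C \<and> \<delta> > 0 \<and> DV3 M N a V W C \<delta> b)"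

section \<open>Weighted function spaces\<close>

definition Linf :: "(real^'l::finite \<Rightarrow> real) \<Rightarrow> (real^'l \<Rightarrow> real) set" where
  "Linf w = {f. f \<in> borel_measurable borel \<and> bdd_above (range (\<lambda>x. \<bar>f x\<bar> / w x))}"

definition Linf0 :: "(real^'l::finite \<Rightarrow> real) \<Rightarrow> (real^'l \<Rightarrow> real) set" where
  "Linf0 w = {f \<in> Linf w. continuous_on UNIV f}"

definition Linf1 :: "(real^'l::finite \<Rightarrow> real) \<Rightarrow> (real^'l \<Rightarrow> real) set" where
  "Linf1 w = {f \<in> Linf0 w. \<forall>i. (\<forall>x. has_partial i f x) \<and> partial i f \<in> Linf0 w}"

section \<open>Sensitivity process\<close>

definition sens :: "(real^'l::finite \<Rightarrow> real^'m::finite \<Rightarrow> real^'l) \<Rightarrow> (nat \<Rightarrow> 'w \<Rightarrow> real^'m) \<Rightarrow>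
    real^'l \<Rightarrow> nat \<Rightarrow> 'w \<Rightarrow> real^'l^'l" where
  "sens a N x t \<omega> = (\<chi> i j. partial j (\<lambda>z. chain a N z t \<omega> $ i) x)"

definition Qop :: "'w measure \<Rightarrow> (nat \<Rightarrow> 'w \<Rightarrow> real^'m::finite) \<Rightarrow>
    (real^'l::finite \<Rightarrow> real^'m \<Rightarrow> real^'l) \<Rightarrow> nat \<Rightarrow> (real^'l \<Rightarrow> real^'l) \<Rightarrow> real^'l \<Rightarrow> real^'l" where
  "Qop M N a t g x = (if t = 0 then g x
     else (LINT \<omega>|M. transpose (sens a N x t \<omega>) *v g (chain a N x t \<omega>)))"

end

theory Submission
  imports Defs
begin

text \<open>
  Harris' theorem in the form of Hairer and Mattingly: A2 and A3 minorize some power of the kernel on every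
  sublevel set of \<open>V\<close>, DV3 passes to the powers \<open>e\<^sup>\<eta>\<^sup>V\<close> by Jensen's inequality, and together these make
  a power of \<open>P\<close> contract a weighted oscillation seminorm. So \<open>P\<^sup>t c - \<pi>(c)\<close> is summable in the weighted norm,
  which gives Poisson's equation and uniqueness. For \<open>\<eta> < 1\<close> the weight \<open>e\<^sup>\<eta>\<^sup>V\<close> is uniformly integrable
  against the kernels locally in \<open>x\<close>, so \<open>\<nabla>P\<^sup>t c = Q\<^sup>t \<nabla>c\<close> and \<open>P\<^sup>t\<close> preserves the weighted \<open>C\<^sup>1\<close>
  space. The sensitivity process may grow exponentially, so summability of the gradients needs a Lasota--Yorke
  inequality: for some \<open>t\<close>, \<open>\<parallel>\<nabla>P\<^sup>t f\<parallel> \<le> \<parallel>\<nabla>f\<parallel> / 2 + B \<parallel>f\<parallel>\<close> in the weighted norms. Applied along the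
  orbit of \<open>c - \<pi>(c)\<close>, it reduces the gradients to the already summable function norms.
\<close>

section \<open>Partial derivatives\<close>

text \<open>Over \<open>t\<close> steps the gradient of an iterate is controlled only up to a factor
  \<open>K ^ t\<close>, with \<open>K\<close> a Lipschitz constant of the dynamics. The time
  \<open>t0\<close> is dictated by the density in A2, so the factor \<open>K ^ t0\<close> is fixed
  and has to be beaten by something arbitrarily small. Two sources provide it. Since
  \<open>W\<close> in DV3 has compact sublevel sets, one step multiplies \<open>wt \<eta>\<close> by
  as small a factor as desired off a suitable compact set; a drift of fixed rate would not suffice
  for this argument. Since \<eta> < 1, on the region \<open>V > R\<close> the replacement of
  \<open>wt \<eta>\<close> by \<open>wt 1\<close> gains a factor
  \<open>exp (- (1 - \<eta>) * R)\<close>, with \<open>R\<close> chosen after the compact set. This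
  is why the weights for \<eta> and for 1 are used side by side. Convergence is recorded as
  domination by a summable sequence, not as a geometric rate. One lemma on delayed recursions then
  serves both the function values and the gradients, where the former enter as
  inhomogeneity.\<close>

lemma partial_DERIV:
  assumes "has_partial i f (x + s *\<^sub>R axis i 1)"
  shows "((\<lambda>s. f (x + s *\<^sub>R axis i 1)) has_real_derivative partial i f (x + s *\<^sub>R axis i 1)) (at s)"
proof -
  have "((\<lambda>r. f ((x + s *\<^sub>R axis i 1) + r *\<^sub>R axis i 1)) has_real_derivative
      partial i f (x + s *\<^sub>R axis i 1)) (at (s + - s))"
    using assms unfolding has_partial_def partial_def by (simp add: DERIV_deriv_iff_field_differentiable)
  from this[THEN DERIV_shift[THEN iffD1]]
  show ?thesis by (simp add: algebra_simps)
qed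

lemma partial_DERIV0:
  assumes "has_partial i f x"
  shows "((\<lambda>s. f (x + s *\<^sub>R axis i 1)) has_real_derivative partial i f x) (at 0)"
  using partial_DERIV[of i f x 0] assms by simp

lemma has_partialI:
  assumes "((\<lambda>s. f (x + s *\<^sub>R axis i 1)) has_real_derivative d) (at 0)"
  shows "has_partial i f x" "partial i f x = d"
  using assms unfolding has_partial_def partial_def
  by (auto simp: field_differentiable_def intro: DERIV_imp_deriv)

lemma has_partial_of_derivative:
  assumes "(f has_derivative f') (at x)"
  shows "has_partial i f x" "partial i f x = f' (axis i 1)"
proof -
  have "((\<lambda>s. f (x + s *\<^sub>R axis i 1)) has_derivative (\<lambda>s. f' (s *\<^sub>R axis i 1))) (at (0::real))"
    by (rule has_derivative_compose[of "\<lambda>s. x + s *\<^sub>R axis i 1" _ _ _ f, simplified])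
       (auto intro!: derivative_eq_intros assms)
  moreover have "f' (s *\<^sub>R axis i 1) = s * f' (axis i 1)" for s
    using linear_scale[OF has_derivative_linear[OF assms]] by simp
  ultimately have "((\<lambda>s. f (x + s *\<^sub>R axis i 1)) has_real_derivative f' (axis i 1)) (at 0)"
    by (simp add: has_field_derivative_def mult_commute_abs)
  then show "has_partial i f x" "partial i f x = f' (axis i 1)" by (rule has_partialI)+
qed

lemma partial_add:
  assumes "has_partial i f x" "has_partial i g x"
  shows "has_partial i (\<lambda>x. f x + g x) x" "partial i (\<lambda>x. f x + g x) x = partial i f x + partial i g x"
  using has_partialI[where f = "\<lambda>x. f x + g x", OF DERIV_add[OF partial_DERIV0 partial_DERIV0]] assms by auto

lemma partial_mult:
  assumes "has_partial i f x" "has_partial i g x"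
  shows "has_partial i (\<lambda>x. f x * g x) x"
    "partial i (\<lambda>x. f x * g x) x = partial i f x * g x + partial i g x * f x"
  using has_partialI[where f = "\<lambda>x. f x * g x", OF DERIV_mult[OF partial_DERIV0 partial_DERIV0]] assms by auto

lemma partial_compose:
  assumes "has_partial i f x" "(g has_real_derivative d) (at (f x))"
  shows "has_partial i (\<lambda>x. g (f x)) x" "partial i (\<lambda>x. g (f x)) x = d * partial i f x"
proof -
  have "((\<lambda>s. g (f (x + s *\<^sub>R axis i 1))) has_real_derivative d * partial i f x) (at 0)"
    by (rule DERIV_chain2[where f = g]) (use assms partial_DERIV0 in auto)
  from has_partialI[where f = "\<lambda>x. g (f x)", OF this]
  show "has_partial i (\<lambda>x. g (f x)) x" "partial i (\<lambda>x. g (f x)) x = d * partial i f x" by auto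
qed

lemma partial_diff_const:
  assumes "has_partial i f x"
  shows "has_partial i (\<lambda>x. f x - k) x" "partial i (\<lambda>x. f x - k) x = partial i f x"
proof -
  have "((\<lambda>u. u - k) has_real_derivative 1) (at (f x))" by (auto intro!: derivative_eq_intros)
  from partial_compose[OF assms this]
  show "has_partial i (\<lambda>x. f x - k) x" "partial i (\<lambda>x. f x - k) x = partial i f x" by auto
qed

text \<open>The space \<open>Linf1\<close> only provides continuous partial derivatives, while the
  chain rule along a path needs a total derivative. The way from \<open>x\<close> to
  \<open>x + v\<close> is walked one coordinate at a time, with the mean value theorem on each leg;
  hence the induction over the set \<open>I\<close> of coordinates already moved.\<close>

lemma has_derivative_of_partials:
  fixes f :: "real^'l::finite \<Rightarrow> real"
  assumes hp: "\<And>i x. has_partial i f x" and cp: "\<And>i. continuous_on UNIV (partial i f)"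
  shows "(f has_derivative (\<lambda>v. grad f x \<bullet> v)) (at x)"
proof -
  \<comment> \<open>\<open>pr I v\<close> keeps the coordinates of \<open>v\<close> in
    \<open>I\<close> and sets the others to zero, so the points \<open>x + pr I v\<close> are the
    corners of the coordinate path.\<close>
  define pr where "pr I v = (\<chi> i. if i \<in> I then v $ i else 0)" for I and v :: "real^'l"
  have "\<forall>e>0. \<exists>d>0. \<forall>v. norm v < d \<longrightarrow>
      \<bar>f (x + pr I v) - f x - (\<Sum>i\<in>I. partial i f x * v $ i)\<bar> \<le> e * norm v" if "finite I" for I
    using that
  proof (induction I rule: finite_induct)
    case empty
    have "pr {} v = 0" for v by (simp add: pr_def vec_eq_iff)
    then show ?case by (auto intro: exI[of _ 1])
  next
    case (insert i I)
    show ?case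
    proof (intro allI impI)
      fix e :: real assume e: "e > 0"
      from insert.IH e obtain d1 where d1: "d1 > 0" and
        b1: "\<And>v. norm v < d1 \<Longrightarrow> \<bar>f (x + pr I v) - f x - (\<Sum>i\<in>I. partial i f x * v $ i)\<bar> \<le> e/2 * norm v"
        by (metis half_gt_zero)
      have "isCont (partial i f) x" using cp by (simp add: continuous_on_eq_continuous_at)
      then obtain d2 where d2: "d2 > 0" and
        b2: "\<And>y. dist y x < d2 \<Longrightarrow> \<bar>partial i f y - partial i f x\<bar> < e/2"
        using e unfolding continuous_at_eps_delta dist_real_def by (metis half_gt_zero)
      have "\<bar>f (x + pr (insert i I) v) - f x - (\<Sum>k\<in>insert i I. partial k f x * v $ k)\<bar> \<le> e * norm v"
        if v: "norm v < min d1 d2" for v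
      proof -
        let ?z = "x + pr I v"
        let ?g = "\<lambda>s. f (?z + (s * v $ i) *\<^sub>R axis i 1)"
        have D: "(?g has_real_derivative partial i f (?z + (s * v $ i) *\<^sub>R axis i 1) * v $ i) (at s)" for s
          by (rule DERIV_chain2[of "\<lambda>s. f (?z + s *\<^sub>R axis i 1)"])
             (auto intro!: partial_DERIV hp derivative_eq_intros)
        obtain s where s: "0 < s" "s < 1" and
          e1: "?g 1 - ?g 0 = (1 - 0) * (partial i f (?z + (s * v $ i) *\<^sub>R axis i 1) * v $ i)"
          using MVT2[of 0 1 ?g, OF _ D] by auto
        \<comment> \<open>The intermediate point differs from \<open>x\<close> in each coordinate by
          at most the corresponding coordinate of \<open>v\<close>, so continuity of the partial
          derivative at \<open>x\<close> applies to it.\<close>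
        have "dist (?z + (s * v $ i) *\<^sub>R axis i 1) x \<le> norm v"
          unfolding dist_norm
        proof (rule norm_le_componentwise_cart)
          fix k
          show "norm ((?z + (s * v $ i) *\<^sub>R axis i 1 - x) $ k) \<le> norm (v $ k)"
            using s insert.hyps by (auto simp: pr_def axis_def abs_mult mult_left_le_one_le)
        qed
        then have "\<bar>partial i f (?z + (s * v $ i) *\<^sub>R axis i 1) - partial i f x\<bar> < e/2"
          using v by (intro b2) auto
        then have "\<bar>partial i f (?z + (s * v $ i) *\<^sub>R axis i 1) * v $ i - partial i f x * v $ i\<bar> \<le> e/2 * norm v"
          unfolding abs_mult left_diff_distrib[symmetric]
          using component_le_norm_cart[of v i] e by (intro mult_mono) auto
        moreover have "?g 1 = f (x + pr (insert i I) v)"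
          using insert.hyps by (intro arg_cong[of _ _ f]) (auto simp: pr_def vec_eq_iff axis_def)
        moreover have "?g 0 = f (x + pr I v)" by simp
        moreover have "\<bar>f (x + pr I v) - f x - (\<Sum>i\<in>I. partial i f x * v $ i)\<bar> \<le> e/2 * norm v"
          using b1 v by simp
        moreover have "(\<Sum>k\<in>insert i I. partial k f x * v $ k) =
            partial i f x * v $ i + (\<Sum>k\<in>I. partial k f x * v $ k)"
          using insert.hyps by simp
        ultimately show ?thesis using e1 unfolding abs_le_iff by auto
      qed
      then show "\<exists>d>0. \<forall>v. norm v < d \<longrightarrow>
          \<bar>f (x + pr (insert i I) v) - f x - (\<Sum>k\<in>insert i I. partial k f x * v $ k)\<bar> \<le> e * norm v"
        using d1 d2 by (intro exI[of _ "min d1 d2"]) auto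
    qed
  qed
  from this[of UNIV] have *: "\<forall>e>0. \<exists>d>0. \<forall>v. norm v < d \<longrightarrow>
      \<bar>f (x + v) - f x - grad f x \<bullet> v\<bar> \<le> e * norm v"
    by (simp add: pr_def vec_lambda_eta inner_vec_def grad_def)
  show ?thesis
    unfolding has_derivative_within_alt
  proof (intro conjI allI impI)
    show "bounded_linear ((\<bullet>) (grad f x))" by (rule bounded_linear_inner_right)
    fix e :: real assume "e > 0"
    with * obtain d where d: "d > 0" "\<And>v. norm v < d \<Longrightarrow> \<bar>f (x + v) - f x - grad f x \<bullet> v\<bar> \<le> e * norm v" by blast
    show "\<exists>d>0. \<forall>y\<in>UNIV. norm (y - x) < d \<longrightarrow> norm (f y - f x - grad f x \<bullet> (y - x)) \<le> e * norm (y - x)"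
      using d(1) d(2)[of "_ - x"] by (intro exI[of _ d]) auto
  qed
qed

lemma cont_differentiable_compose:
  assumes "cont_differentiable f" "cont_differentiable g"
  shows "cont_differentiable (\<lambda>x. f (g x))"
proof -
  obtain f' g' where
    f: "\<And>x. (f has_derivative blinfun_apply (f' x)) (at x)" "continuous_on UNIV f'" and
    g: "\<And>x. (g has_derivative blinfun_apply (g' x)) (at x)" "continuous_on UNIV g'"
    using assms unfolding cont_differentiable_def by metis
  have "continuous_on UNIV g" using g(1) by (blast intro: continuous_at_imp_continuous_on has_derivative_continuous)
  then have "continuous_on UNIV (\<lambda>x. f' (g x))" 
    by (rule continuous_on_compose2[OF f(2)]) auto
  with g(2) have "continuous_on UNIV (\<lambda>x. f' (g x) o\<^sub>L g' x)"
    by (intro continuous_intros)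
  moreover have "((\<lambda>x. f (g x)) has_derivative blinfun_apply (f' (g x) o\<^sub>L g' x)) (at x)" for x
    using has_derivative_compose[OF g(1) f(1)] by (simp add: o_def blinfun_compose.rep_eq)
  ultimately show ?thesis unfolding cont_differentiable_def by (intro exI[of _ "\<lambda>x. f' (g x) o\<^sub>L g' x"]) auto
qed

lemma cont_differentiable_id: "cont_differentiable (\<lambda>x. x)"
  unfolding cont_differentiable_def
  by (intro exI[of _ "\<lambda>_. id_blinfun"]) (simp add: id_blinfun.rep_eq[abs_def])

lemma cont_differentiable_continuous: "cont_differentiable f \<Longrightarrow> continuous_on UNIV f"
  unfolding cont_differentiable_def by (blast intro: continuous_at_imp_continuous_on has_derivative_continuous)

lemma cont_differentiable_partials:
  fixes f :: "real^'l::finite \<Rightarrow> real"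
  assumes "cont_differentiable f"
  shows "has_partial i f x" "continuous_on UNIV (partial i f)"
proof -
  obtain f' where f: "\<And>x. (f has_derivative blinfun_apply (f' x)) (at x)" "continuous_on UNIV f'"
    using assms unfolding cont_differentiable_def by metis
  show "has_partial i f x" using f(1) by (rule has_partial_of_derivative)
  have "partial i f = (\<lambda>x. f' x (axis i 1))"
    using has_partial_of_derivative(2)[OF f(1)] by blast
  then show "continuous_on UNIV (partial i f)" using f(2) by (auto intro!: continuous_intros)
qed

lemma cont_differentiable_component:
  fixes f :: "'a::real_normed_vector \<Rightarrow> real^'b::finite"
  assumes "cont_differentiable f"
  shows "cont_differentiable (\<lambda>x. f x $ i)"
proof -
  have "cont_differentiable (\<lambda>x::real^'b. x $ i)" unfolding cont_differentiable_def
  proof (intro exI[of _ "\<lambda>_. blinfun_inner_right (axis i 1)"] conjI allI)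
    have "blinfun_apply (blinfun_inner_right (axis i 1)) = (\<lambda>x::real^'b. x $ i)"
      by (auto simp: inner_axis')
    then show "((\<lambda>x::real^'b. x $ i) has_derivative blinfun_apply (blinfun_inner_right (axis i 1))) (at x)" for x
      by (simp add: bounded_linear_imp_has_derivative bounded_linear_vec_nth)
  qed simp
  from cont_differentiable_compose[OF this assms] show ?thesis .
qed

lemma cont_differentiable_bounded_derivative:
  fixes f :: "'a::euclidean_space \<Rightarrow> real"
  assumes "cont_differentiable f" "compact S" "convex S"
  obtains L where "L \<ge> 0" "\<And>x y. x \<in> S \<Longrightarrow> y \<in> S \<Longrightarrow> \<bar>f x - f y\<bar> \<le> L * norm (x - y)"
proof -
  obtain f' where f: "\<And>x. (f has_derivative blinfun_apply (f' x)) (at x)" "continuous_on UNIV f'"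
    using assms unfolding cont_differentiable_def by metis
  have "compact (f' ` S)" using assms f(2) by (meson compact_continuous_image continuous_on_subset subset_UNIV)
  then obtain L where L: "L > 0" "\<And>x. x \<in> S \<Longrightarrow> norm (f' x) \<le> L"
    using compact_imp_bounded bounded_pos by (metis imageI)
  have "norm (f x - f y) \<le> L * norm (x - y)" if "x \<in> S" "y \<in> S" for x y
    by (rule differentiable_bound[OF assms(3), of f "\<lambda>x. blinfun_apply (f' x)"])
       (use that L f in \<open>auto simp: norm_blinfun.rep_eq[symmetric] intro: has_derivative_at_withinI\<close>)
  then show ?thesis using L by (intro that[of L]) auto
qed

text \<open>Passing from entries to a norm bound through the l1 norm costs one factor of the
  dimension for the sum over inputs and one for the sum over outputs.\<close>

lemma linear_norm_le_of_entries:
  fixes D :: "real^'l::finite \<Rightarrow> real^'l"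
  assumes D: "linear D" and K: "\<And>i j. \<bar>D (axis i 1) $ j\<bar> \<le> K" and "K \<ge> 0"
  shows "norm (D v) \<le> real CARD('l) * (real CARD('l) * K) * norm v"
proof -
  have "\<bar>D v $ j\<bar> \<le> real CARD('l) * K * norm v" for j
  proof -
    have "D v = (\<Sum>i\<in>UNIV. (v $ i) *\<^sub>R D (axis i 1))"
    proof -
      have "v = (\<Sum>i\<in>UNIV. (v $ i) *\<^sub>R axis i 1)"
        by (simp add: basis_expansion flip: scalar_mult_eq_scaleR)
      then have "D v = D (\<Sum>i\<in>UNIV. (v $ i) *\<^sub>R axis i 1)" by (rule arg_cong)
      then show ?thesis by (simp add: linear_sum[OF D] linear_scale[OF D])
    qed
    then have "\<bar>D v $ j\<bar> = \<bar>\<Sum>i\<in>UNIV. v $ i * D (axis i 1) $ j\<bar>" by simp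
    also have "\<dots> \<le> (\<Sum>i\<in>UNIV. \<bar>v $ i * D (axis i 1) $ j\<bar>)" by (rule sum_abs)
    also have "\<dots> \<le> (\<Sum>i\<in>(UNIV::'l set). norm v * K)"
      unfolding abs_mult using assms component_le_norm_cart[of v] by (intro sum_mono mult_mono) auto
    finally show ?thesis by (simp add: mult_ac)
  qed
  then have "(\<Sum>j\<in>UNIV. \<bar>D v $ j\<bar>) \<le> (\<Sum>j\<in>(UNIV::'l set). real CARD('l) * K * norm v)" by (intro sum_mono) auto
  with norm_le_l1_cart[of "D v"] show ?thesis by (simp add: mult_ac)
qed

text \<open>A derivative can be estimated from increments alone; the smoothing estimate uses this in
  place of differentiation under the integral sign.\<close>

lemma DERIV_abs_le:
  fixes F :: "real \<Rightarrow> real"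
  assumes "(F has_real_derivative d) (at 0)" and lip: "\<And>s. \<bar>s\<bar> < 1 \<Longrightarrow> \<bar>F s - F 0\<bar> \<le> c * \<bar>s\<bar>"
  shows "\<bar>d\<bar> \<le> c"
proof (rule tendsto_upperbound)
  show "((\<lambda>s. \<bar>(F s - F 0) / s\<bar>) \<longlongrightarrow> \<bar>d\<bar>) (at 0)"
    using assms(1) by (intro tendsto_rabs) (simp add: DERIV_def)
  show "\<forall>\<^sub>F s in at 0. \<bar>(F s - F 0) / s\<bar> \<le> c"
  proof (rule eventually_mono[OF eventually_at_ball'[of 1 0 UNIV]])
    fix s :: real assume "s \<in> ball 0 1 \<and> s \<noteq> 0 \<and> s \<in> UNIV"
    then show "\<bar>(F s - F 0) / s\<bar> \<le> c" using lip[of s] by (simp add: abs_divide divide_le_eq)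
  qed simp
qed simp

text \<open>The square of the positive part is continuously differentiable, so squaring at both
  places gives a piecewise polynomial C1 cutoff from 1 on \<open>u \<le> 0\<close> to 0 on
  \<open>u \<ge> 1\<close>.\<close>

definition bump :: "real \<Rightarrow> real" where
  "bump u = (max 0 (1 - (max 0 u)\<^sup>2))\<^sup>2"

lemma DERIV_max_square: "((\<lambda>u::real. (max 0 u)\<^sup>2) has_real_derivative 2 * max 0 u) (at u)"
proof -
  consider "u < 0" | "u > 0" | "u = 0" by linarith
  then show ?thesis
  proof cases
    case 1
    have "((\<lambda>u::real. 0) has_real_derivative 2 * max 0 u) (at u)" using 1 by (auto intro!: derivative_eq_intros)
    then show ?thesis
      by (rule has_field_derivative_transform_within_open[of _ _ _ "{..<0}"]) (use 1 in auto)
  next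
    case 2
    have "((\<lambda>u::real. u\<^sup>2) has_real_derivative 2 * max 0 u) (at u)" using 2 by (auto intro!: derivative_eq_intros)
    then show ?thesis
      by (rule has_field_derivative_transform_within_open[of _ _ _ "{0<..}"]) (use 2 in auto)
  next
    case 3
    have "((\<lambda>h::real. (max 0 h)\<^sup>2 / h) \<longlongrightarrow> 0) (at 0)"
    proof (rule Lim_null_comparison)
      show "\<forall>\<^sub>F h in at 0. norm ((max 0 h)\<^sup>2 / h) \<le> \<bar>h::real\<bar>"
        by (rule always_eventually) (auto simp: max_def power2_eq_square)
      show "((\<lambda>h. \<bar>h\<bar>) \<longlongrightarrow> (0::real)) (at 0)" by (rule tendsto_eq_intros | simp)+
    qed
    then show ?thesis using 3 by (simp add: DERIV_def)
  qed
qed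

lemma bump_properties:
  "0 \<le> bump u" "bump u \<le> 1" "u \<le> 0 \<Longrightarrow> bump u = 1" "u \<ge> 1 \<Longrightarrow> bump u = 0"
  "\<exists>d. continuous_on UNIV d \<and> (\<forall>u\<ge>1. d u = 0) \<and> (\<forall>u. (bump has_real_derivative d u) (at u))"
proof -
  show "0 \<le> bump u" "u \<le> 0 \<Longrightarrow> bump u = 1" by (auto simp: bump_def)
  have "0 \<le> (max 0 u)\<^sup>2" by simp
  then have "0 \<le> max 0 (1 - (max 0 u)\<^sup>2)" "max 0 (1 - (max 0 u)\<^sup>2) \<le> 1" by linarith+
  then show "bump u \<le> 1" unfolding bump_def by (simp add: abs_square_le_1)
  show "bump u = 0" if "u \<ge> 1"
    using that one_le_power[of u 2] by (simp add: bump_def)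
  define d where "d u = 2 * max 0 (1 - (max 0 u)\<^sup>2) * (- (2 * max 0 u))" for u :: real
  have "(bump has_real_derivative d u) (at u)" for u
    unfolding bump_def[abs_def] d_def
    by (rule DERIV_chain2[where f = "\<lambda>u. (max 0 u)\<^sup>2", OF DERIV_max_square])
       (use DERIV_diff[OF DERIV_const DERIV_max_square, of 1 u] in simp)
  moreover have "continuous_on UNIV d" unfolding d_def by (intro continuous_intros)
  moreover have "d u = 0" if "u \<ge> 1" for u using that one_le_power[of u 2] by (simp add: d_def)
  ultimately show "\<exists>d. continuous_on UNIV d \<and> (\<forall>u\<ge>1. d u = 0) \<and> (\<forall>u. (bump has_real_derivative d u) (at u))"
    by blast
qed

text \<open>Convexity between the arguments 0 and \<open>s\<close>. It is the pointwise form of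
  Jensen's inequality: if \<open>s\<close> is random and normalised so that \<open>exp s\<close> has
  mean one, the right side has mean one as well.\<close>

lemma exp_scale_le:
  fixes s :: real
  assumes "0 \<le> \<eta>" "\<eta> \<le> 1"
  shows "exp (\<eta> * s) \<le> \<eta> * exp s + (1 - \<eta>)"
  using convex_onD[OF exp_convex, of \<eta> 0 s] assms by simp

text \<open>Summing the recursion bounds the partial sums by a start-up term over
  \<open>t < T\<close>, a multiple of themselves, and the total inhomogeneity; since the multiple is
  below 1 it can be absorbed. The uses are the ergodicity constants, with \<open>e = 0\<close>, and
  the gradient norms, with \<open>e\<close> proportional to those constants.\<close>

lemma summable_of_delayed_contraction:
  fixes u e :: "nat \<Rightarrow> real"
  assumes "\<And>t. u t \<ge> 0" "\<And>t. e t \<ge> 0" "summable e" "q < 1"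
    and rec: "\<And>t. u (t + T) \<le> q * u t + e t"
  shows "summable u"
proof -
  define q' where "q' = max q 0"
  have q': "0 \<le> q'" "q' < 1" using assms by (auto simp: q'_def)
  have rec': "u (t + T) \<le> q' * u t + e t" for t
    using rec[of t] mult_right_mono[of q q' "u t"] assms(1)[of t] by (auto simp: q'_def)
  have "(\<Sum>t<n. u t) \<le> ((\<Sum>t<T. u t) + suminf e) / (1 - q')" for n
  proof -
    have "(\<Sum>t<n. u t) \<le> (\<Sum>t<n+T. u t)" by (rule sum_mono2) (auto simp: assms)
    also have "\<dots> = (\<Sum>t<T. u t) + (\<Sum>t<n. u (t + T))"
      by (induction n) (auto simp: add.commute add.left_commute)
    also have "(\<Sum>t<n. u (t + T)) \<le> (\<Sum>t<n. q' * u t + e t)" by (rule sum_mono) (rule rec')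
    also have "\<dots> = q' * (\<Sum>t<n. u t) + (\<Sum>t<n. e t)" by (simp add: sum.distrib sum_distrib_left)
    also have "(\<Sum>t<n. e t) \<le> suminf e" using assms by (intro sum_le_suminf) auto
    finally have "(1 - q') * (\<Sum>t<n. u t) \<le> (\<Sum>t<T. u t) + suminf e" by (simp add: algebra_simps)
    then show ?thesis using q' by (simp add: pos_le_divide_eq mult.commute)
  qed
  then show ?thesis using assms(1) by (intro summableI_nonneg_bounded)
qed

section \<open>Harris contraction\<close>

text \<open>The drift shrinks the weight when \<open>w x + w y\<close> is large; the minorization
  gives the two laws a common part when both points lie in the sublevel set
  \<open>w \<le> R\<close>. Neither works alone. The parameter \<beta> in the seminorm balances the
  drift constant \<kappa> against the gain \<alpha>.\<close>

lemma harris_contraction: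
  fixes K :: "'a \<Rightarrow> 'a measure" and w :: "'a \<Rightarrow> real"
  assumes prob: "\<And>x. prob_space (K x)" and sets_K: "\<And>x. sets (K x) = sets S"
    and w: "w \<in> borel_measurable S" "\<And>x. 0 \<le> w x"
    and drift: "\<And>x. integrable (K x) w" "\<And>x. (LINT y|K x. w y) \<le> \<gamma> * w x + \<kappa>"
    and const: "0 \<le> \<gamma>" "\<gamma> < 1" "0 < \<kappa>" "2 * \<kappa> < R * (1 - \<gamma>)" "0 < \<alpha>"
    and \<nu>: "prob_space \<nu>" "sets \<nu> = sets S"
    and minor: "\<And>x u. w x \<le> R \<Longrightarrow> u \<in> borel_measurable S \<Longrightarrow>
      ennreal \<alpha> * (\<integral>\<^sup>+y. u y \<partial>\<nu>) \<le> (\<integral>\<^sup>+y. u y \<partial>K x)"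
  shows "\<exists>\<beta>>0. \<exists>q>0. q < 1 \<and> (\<forall>f\<in>borel_measurable S. \<forall>L. (\<forall>x y. \<bar>f x - f y\<bar> \<le> L * (2 + \<beta> * w x + \<beta> * w y)) \<longrightarrow>
     (\<forall>x y. \<bar>(LINT z|K x. f z) - (LINT z|K y. f z)\<bar> \<le> q * L * (2 + \<beta> * w x + \<beta> * w y)))"
proof -
  interpret K: prob_space "K x" for x by (rule prob)
  interpret \<nu>: prob_space \<nu> by (rule \<nu>)
  \<comment> \<open>With this choice the loss \<open>2 * \<beta> * \<kappa>\<close> caused by the
    drift constant equals \<alpha>, half of the gain \<open>2 * \<alpha>\<close> from the
    minorization.\<close>
  define \<beta> where "\<beta> = \<alpha> / (2 * \<kappa>)"
  \<comment> \<open>The ratio of the bound obtained from drift alone to the seminorm weight, taken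
    at \<open>w x + w y = R\<close>. It is below 1 because
    \<open>2 * \<kappa> < R * (1 - \<gamma>)\<close>.\<close>
  define q0 where "q0 = (2 + \<alpha> + \<beta> * \<gamma> * R) / (2 + \<beta> * R)"
  \<comment> \<open>\<open>1 - \<alpha> / 2\<close> controls the constant term when the weights are
    small, \<gamma> the terms in \<open>w\<close>, and \<open>q0\<close> the case of large weights;
    \<open>1/2\<close> secures positivity.\<close>
  define q where "q = max (max (1 - \<alpha> / 2) \<gamma>) (max q0 (1/2))"
  have \<beta>: "\<beta> > 0" "\<beta> * \<kappa> = \<alpha> / 2" using const by (auto simp: \<beta>_def)
  have R: "R > 0" using const by (smt (verit) mult_nonpos_nonneg)
  have "\<alpha> < \<beta> * R * (1 - \<gamma>)"
    using const mult_strict_left_mono[OF const(4) \<beta>(1)] \<beta>(2) by (simp add: algebra_simps)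
  then have "q0 < 1" using \<beta> R unfolding q0_def by (subst pos_divide_less_eq) (auto simp: algebra_simps intro: add_pos_pos)
  then have q: "q > 0" "q < 1" "q \<ge> 1 - \<alpha>/2" "q \<ge> \<gamma>" "q \<ge> q0" using const by (auto simp: q_def)
  have q0: "q0 * (2 + \<beta> * R) = 2 + \<alpha> + \<beta> * \<gamma> * R"
  proof -
    have "2 + \<beta> * R \<noteq> 0" using mult_pos_pos[OF \<beta>(1) R] by linarith
    then show ?thesis unfolding q0_def by simp
  qed
  have meas: "f \<in> borel_measurable (K x)" if "f \<in> borel_measurable S" for f :: "'a \<Rightarrow> real" and x
    using that by (simp cong: measurable_cong_sets[OF sets_K refl])
  have "\<bar>(LINT z|K x. f z) - (LINT z|K y. f z)\<bar> \<le> q * L * (2 + \<beta> * w x + \<beta> * w y)"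
    if f: "f \<in> borel_measurable S" and L: "\<And>x y. \<bar>f x - f y\<bar> \<le> L * (2 + \<beta> * w x + \<beta> * w y)" for f L x y
  proof -
    have pos: "2 + \<beta> * w x + \<beta> * w y > 0" for x y using \<beta> w(2)[of x] w(2)[of y] by (simp add: add_pos_nonneg)
    have L0: "L \<ge> 0" using L[of x x] pos[of x x] by (simp add: zero_le_mult_iff)
    \<comment> \<open>Subtracting this constant, which cancels in the difference of the two
      integrals, turns the oscillation bound into the pointwise bound
      \<open>\<bar>\<phi> z\<bar> \<le> L * (1 + \<beta> * w z)\<close>.\<close>
    define m where "m = (INF z. L * (1 + \<beta> * w z) + f z)"
    have bdd: "bdd_below (range (\<lambda>z. L * (1 + \<beta> * w z) + f z))"
    proof (rule bdd_belowI2)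
      fix z show "f x - L * (1 + \<beta> * w x) \<le> L * (1 + \<beta> * w z) + f z"
        using L[of x z] by (simp add: algebra_simps)
    qed
    define \<phi> where "\<phi> z = f z - m" for z
    have ub: "\<phi> z \<le> L * (1 + \<beta> * w z)" for z
    proof -
      have "f z - L * (1 + \<beta> * w z) \<le> m" unfolding m_def
      proof (rule cINF_greatest)
        fix y show "f z - L * (1 + \<beta> * w z) \<le> L * (1 + \<beta> * w y) + f y"
          using L[of z y] by (simp add: algebra_simps)
      qed simp
      then show ?thesis by (simp add: \<phi>_def)
    qed
    have lb: "- \<phi> z \<le> L * (1 + \<beta> * w z)" for z
      using cINF_lower[OF bdd, of z] by (simp add: \<phi>_def m_def)
    have \<phi>S: "\<phi> \<in> borel_measurable S" unfolding \<phi>_def using f by measurable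
    have iw: "integrable (K x) (\<lambda>z. L * (1 + \<beta> * w z))" for x using drift(1) by simp
    have i\<phi>: "integrable (K x) \<phi>" for x
      by (rule Bochner_Integration.integrable_bound[OF iw])
         (use ub lb \<phi>S in \<open>auto intro!: AE_I2 simp: abs_le_iff meas intro: order_trans[OF _ abs_ge_self]\<close>)
    have if': "integrable (K x) f" for x
    proof -
      have "integrable (K x) (\<lambda>z. \<phi> z + m)" using i\<phi> by simp
      then show ?thesis by (simp add: \<phi>_def)
    qed
    have diff: "(LINT z|K x. f z) = (LINT z|K x. \<phi> z) + m" for x
      using if'[of x] by (simp add: \<phi>_def K.prob_space)
    have Iw: "(LINT z|K x. L * (1 + \<beta> * w z)) \<le> L * (1 + \<beta> * (\<gamma> * w x + \<kappa>))" for x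
      using drift(2)[of x] drift(1)[of x] L0 \<beta> by (auto simp: K.prob_space intro!: mult_left_mono)
    let ?s = "w x + w y"
    \<comment> \<open>This uses drift alone; the extra \<alpha> is
      \<open>2 * \<beta> * \<kappa>\<close>.\<close>
    have far: "\<bar>(LINT z|K x. \<phi> z) - (LINT z|K y. \<phi> z)\<bar> \<le> L * (2 + \<beta> * \<gamma> * (w x + w y) + \<alpha>)" for x y
    proof -
      have "\<bar>LINT z|K x. \<phi> z\<bar> \<le> L * (1 + \<beta> * (\<gamma> * w x + \<kappa>))" for x
      proof -
        have "\<bar>LINT z|K x. \<phi> z\<bar> \<le> (LINT z|K x. L * (1 + \<beta> * w z))"
          by (rule integral_abs_bound[THEN order_trans], rule integral_mono)
             (use i\<phi> iw ub lb in \<open>auto simp: abs_le_iff\<close>)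
        with Iw show ?thesis by (rule order_trans[rotated])
      qed
      note b = this
      have "\<bar>(LINT z|K x. \<phi> z) - (LINT z|K y. \<phi> z)\<bar> \<le>
          L * (1 + \<beta> * (\<gamma> * w x + \<kappa>)) + L * (1 + \<beta> * (\<gamma> * w y + \<kappa>))"
        using b[of x] b[of y] by linarith
      also have "\<dots> = L * (2 + \<beta> * \<gamma> * (w x + w y) + 2 * (\<beta> * \<kappa>))" by (simp add: algebra_simps)
      finally show ?thesis by (simp add: \<beta>)
    qed
    \<comment> \<open>Both \<open>?u1\<close> and \<open>?u2\<close> are nonnegative and add up to
      at least \<open>2 * L\<close>. Applying the minorization to \<open>?u1\<close> under
      \<open>K x\<close> and to \<open>?u2\<close> under \<open>K y\<close> saves
      \<open>2 * \<alpha> * L\<close>: the common part of the two laws does not contribute to the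
      difference.\<close>
    have near: "(LINT z|K y. \<phi> z) - (LINT z|K x. \<phi> z) \<le> L * (2 + \<beta> * \<gamma> * (w x + w y) - \<alpha>)"
      if wx: "w x \<le> R" "w y \<le> R" for x y
    proof -
      let ?u1 = "\<lambda>z. L * (1 + \<beta> * w z) + \<phi> z" and ?u2 = "\<lambda>z. L * (1 + \<beta> * w z) - \<phi> z"
      have u: "?u1 \<in> borel_measurable S" "?u2 \<in> borel_measurable S"
        using w(1) \<phi>S by measurable
      have u0: "?u1 z \<ge> 0" "?u2 z \<ge> 0" for z using ub[of z] lb[of z] by auto
      have u\<nu>: "?u1 \<in> borel_measurable \<nu>" "?u2 \<in> borel_measurable \<nu>" using u by (simp_all cong: measurable_cong_sets[OF \<nu>(2) refl])
      have iu: "integrable (K x) ?u1" "integrable (K x) ?u2" for x using iw i\<phi> by auto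
      have "ennreal (\<alpha> * (2 * L)) = ennreal \<alpha> * (\<integral>\<^sup>+z. ennreal (2 * L) \<partial>\<nu>)"
        using const L0 by (simp add: ennreal_mult \<nu>.emeasure_space_1)
      also have "\<dots> \<le> ennreal \<alpha> * (\<integral>\<^sup>+z. ennreal (?u1 z) + ennreal (?u2 z) \<partial>\<nu>)"
      proof (intro mult_left_mono nn_integral_mono)
        fix z show "ennreal (2 * L) \<le> ennreal (?u1 z) + ennreal (?u2 z)"
          using u0[of z] L0 \<beta> w(2)[of z] by (simp add: ennreal_plus[symmetric] algebra_simps del: ennreal_plus)
      qed simp
      also have "\<dots> = ennreal \<alpha> * (\<integral>\<^sup>+z. ennreal (?u1 z) \<partial>\<nu>) + ennreal \<alpha> * (\<integral>\<^sup>+z. ennreal (?u2 z) \<partial>\<nu>)"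
        using u\<nu> by (subst nn_integral_add) (auto simp: distrib_left)
      also have "\<dots> \<le> (\<integral>\<^sup>+z. ennreal (?u1 z) \<partial>K x) + (\<integral>\<^sup>+z. ennreal (?u2 z) \<partial>K y)"
        using wx u by (intro add_mono minor) auto
      also have "\<dots> = ennreal ((LINT z|K x. ?u1 z) + (LINT z|K y. ?u2 z))"
        using iu u0 by (simp add: nn_integral_eq_integral ennreal_plus integral_nonneg_AE del: ennreal_plus
            flip: ennreal_plus Bochner_Integration.integral_add Bochner_Integration.integral_diff)
      finally have "\<alpha> * (2 * L) \<le> (LINT z|K x. ?u1 z) + (LINT z|K y. ?u2 z)"
        using u0 by (subst (asm) ennreal_le_iff) (auto intro!: add_nonneg_nonneg integral_nonneg_AE)
      also have "\<dots> = (LINT z|K x. L * (1 + \<beta> * w z)) + (LINT z|K x. \<phi> z) + (LINT z|K y. L * (1 + \<beta> * w z)) - (LINT z|K y. \<phi> z)"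
        using iw i\<phi> by simp
      finally have "(LINT z|K y. \<phi> z) - (LINT z|K x. \<phi> z) \<le>
          L * (1 + \<beta> * (\<gamma> * w x + \<kappa>)) + L * (1 + \<beta> * (\<gamma> * w y + \<kappa>)) - \<alpha> * (2 * L)"
        using Iw[of x] Iw[of y] by linarith
      also have "\<dots> = L * (2 + \<beta> * \<gamma> * (w x + w y) + 2 * (\<beta> * \<kappa>) - 2 * \<alpha>)" by (simp add: algebra_simps)
      finally show ?thesis by (simp add: \<beta>)
    qed
    have "\<bar>(LINT z|K x. \<phi> z) - (LINT z|K y. \<phi> z)\<bar> \<le> L * (q * (2 + \<beta> * ?s))"
    proof (cases "?s \<le> R")
      case True
      then have "w x \<le> R" "w y \<le> R" using w(2)[of x] w(2)[of y] by auto
      then have "\<bar>(LINT z|K x. \<phi> z) - (LINT z|K y. \<phi> z)\<bar> \<le> L * (2 + \<beta> * \<gamma> * ?s - \<alpha>)"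
        using near[of x y] near[of y x] by (simp add: abs_le_iff add.commute)
      also have "2 + \<beta> * \<gamma> * ?s - \<alpha> \<le> q * (2 + \<beta> * ?s)"
      proof -
        have "\<gamma> * (\<beta> * ?s) \<le> q * (\<beta> * ?s)" using q \<beta> w(2)[of x] w(2)[of y] by (intro mult_right_mono) auto
        then show ?thesis using q(3) by (simp add: algebra_simps)
      qed
      finally show ?thesis using L0 by (simp add: mult_left_mono)
    next
      case False
      have "2 + \<beta> * \<gamma> * ?s + \<alpha> \<le> q * (2 + \<beta> * ?s)"
      proof -
        \<comment> \<open>Right side minus left side is affine in \<open>w x + w y\<close> with
          nonnegative slope \<open>\<beta> * (q - \<gamma>)\<close>, so it suffices to compare at
          \<open>R\<close>, where the definition of \<open>q0\<close> gives the inequality.\<close>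
        have "(q - \<gamma>) * (\<beta> * R) \<le> (q - \<gamma>) * (\<beta> * ?s)" using False q \<beta> by (intro mult_left_mono) auto
        moreover have "q0 * (2 + \<beta> * R) \<le> q * (2 + \<beta> * R)" using q \<beta> R by (intro mult_right_mono) auto
        ultimately show ?thesis using q0 by (simp add: algebra_simps)
      qed
      with far[of x y] show ?thesis using L0 by (meson mult_left_mono order_trans)
    qed
    then show ?thesis by (simp add: diff algebra_simps)
  qed
  with \<beta>(1) q show ?thesis by (intro exI[of _ \<beta>] conjI exI[of _ q]) auto
qed

section \<open>Markov property and minorization\<close>

locale noise_chain =
  fixes M :: "'w measure" and N :: "nat \<Rightarrow> 'w \<Rightarrow> real^'m::finite"
    and a :: "real^'l::finite \<Rightarrow> real^'m \<Rightarrow> real^'l"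
  assumes noise: "iid_noise M N" and a_cont: "continuous_on UNIV (\<lambda>(x, n). a x n)"

sublocale noise_chain \<subseteq> prob_space M
  using noise unfolding iid_noise_def by blast

context noise_chain
begin

lemma N_measurable [measurable]: "t \<ge> 1 \<Longrightarrow> N t \<in> borel_measurable M"
  using noise unfolding iid_noise_def prob_space.indep_vars_def[OF prob_space_axioms] by blast

lemma a_measurable: "case_prod a \<in> borel_measurable (borel \<Otimes>\<^sub>M borel)"
  using borel_measurable_continuous_onI[OF a_cont] by (simp add: borel_prod)

lemma a_measurable2 [measurable (raw)]:
  "f \<in> borel_measurable A \<Longrightarrow> g \<in> borel_measurable A \<Longrightarrow> (\<lambda>z. a (f z) (g z)) \<in> borel_measurable A"
  using measurable_compose[OF measurable_Pair a_measurable, of f A g] by simp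

text \<open>The initial state is an arbitrary measurable function, so that the rule also covers
  product spaces and restarted chains.\<close>

lemma chain_measurable_joint [measurable (raw)]:
  assumes [measurable]: "f \<in> borel_measurable A" "g \<in> A \<rightarrow>\<^sub>M M"
  shows "(\<lambda>z. chain a N (f z) t (g z)) \<in> borel_measurable A"
  by (induction t) auto

lemma chain_continuous: "continuous_on UNIV (\<lambda>x. chain a N x t \<omega>)"
proof (induction t)
  case (Suc t)
  show ?case
    using continuous_on_compose2[OF a_cont continuous_on_Pair[OF Suc continuous_on_const]] by simp
qed (simp add: continuous_on_id)

text \<open>The state at time \<open>t\<close> is a function of the first \<open>t\<close> noise
  values, which are independent of the next one. Fubini for the joint law of these two blocks gives
  the Markov property, and identical distribution replaces \<open>N (Suc t)\<close> by
  \<open>N 1\<close>.\<close>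

lemma nn_integral_chain_Suc:
  assumes [measurable]: "f \<in> borel_measurable borel"
  shows "(\<integral>\<^sup>+\<omega>. f (chain a N x (Suc t) \<omega>) \<partial>M) = (\<integral>\<^sup>+\<omega>. (\<integral>\<^sup>+\<omega>'. f (a (chain a N x t \<omega>) (N 1 \<omega>')) \<partial>M) \<partial>M)"
proof -
  \<comment> \<open>\<open>?Y\<close> runs the recursion on the canonical space, with the
    coordinates of \<open>e\<close> as noise; it exhibits the state at time \<open>t\<close> as a
    function of the noise block \<open>{Suc 0..t}\<close>.\<close>
  let ?Y = "chain a (\<lambda>i e. e i) x"
  let ?P = "\<lambda>I. PiM I (\<lambda>_::nat. borel :: (real^'m) measure)"
  have Nm: "N (Suc t) \<in> borel_measurable M" by (rule N_measurable) simp
  have fm: "(\<lambda>n. f (a y n)) \<in> borel_measurable borel" for y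
    by (rule measurable_compose[OF a_measurable2 assms]) simp_all
  have ind: "indep_vars (\<lambda>_. borel) N {1..}" using noise unfolding iid_noise_def by blast
  have Ym: "?Y s \<in> borel_measurable (?P {Suc 0..t})" if "s \<le> t" for s
    using that
  proof (induction s)
    case 0
    have "?Y 0 = (\<lambda>_. x)" by (rule ext) simp
    then show ?case by simp
  next
    case (Suc s)
    have "?Y (Suc s) = (\<lambda>e. a (?Y s e) (e (Suc s)))" by (rule ext) simp
    moreover have "(\<lambda>e. e (Suc s)) \<in> borel_measurable (?P {Suc 0..t})"
      using Suc.prems by (intro measurable_component_singleton) auto
    ultimately show ?case using Suc by (auto intro!: a_measurable2)
  qed
  define Yt where "Yt = ?Y t"
  define P1 P2 where "P1 = ?P {Suc 0..t}" and "P2 = ?P {Suc t}"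
  define R1 where "R1 \<omega> = (\<lambda>i\<in>{Suc 0..t}. N i \<omega>)" for \<omega>
  define R2 where "R2 \<omega> = (\<lambda>i\<in>{Suc t}. N i \<omega>)" for \<omega>
  have Yt [measurable]: "Yt \<in> borel_measurable P1" using Ym[OF order_refl] by (simp add: Yt_def P1_def)
  have "?Y s (R1 \<omega>) = chain a N x s \<omega>" if "s \<le> t" for s \<omega>
    using that unfolding R1_def by (induction s) auto
  then have Y: "Yt (R1 \<omega>) = chain a N x t \<omega>" for \<omega> by (simp add: Yt_def)
  have R2: "R2 \<omega> (Suc t) = N (Suc t) \<omega>" for \<omega> by (simp add: R2_def)
  have R1m [measurable]: "R1 \<in> M \<rightarrow>\<^sub>M P1" and R2m [measurable]: "R2 \<in> M \<rightarrow>\<^sub>M P2"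
    unfolding R1_def R2_def P1_def P2_def by (auto intro!: measurable_restrict N_measurable)
  have pm: "(\<lambda>z. z (Suc t)) \<in> borel_measurable P2"
    unfolding P2_def by (rule measurable_component_singleton) simp
  define F where "F z = f (a (Yt (fst z)) (snd z (Suc t)))" for z
  have Fm: "F \<in> borel_measurable (P1 \<Otimes>\<^sub>M P2)" 
    unfolding F_def
    by (rule measurable_compose[OF a_measurable2[OF measurable_compose[OF measurable_fst Yt]
          measurable_compose[OF measurable_snd pm]] assms])
  interpret \<nu>: prob_space "distr M P2 R2" by (rule prob_space_distr) simp
  \<comment> \<open>Independence of the two noise blocks: their joint law is a product.\<close>
  have eq: "distr M (P1 \<Otimes>\<^sub>M P2) (\<lambda>\<omega>. (R1 \<omega>, R2 \<omega>)) = distr M P1 R1 \<Otimes>\<^sub>M distr M P2 R2"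
    using indep_var_restrict[OF ind, of "{Suc 0..t}" "{Suc t}"]
    unfolding indep_var_distribution_eq R1_def R2_def P1_def P2_def by auto
  have Fm': "F \<in> borel_measurable (distr M P1 R1 \<Otimes>\<^sub>M distr M P2 R2)"
    unfolding eq[symmetric] using Fm by (simp only: measurable_distr_eq1)
  have "(\<integral>\<^sup>+\<omega>. f (chain a N x (Suc t) \<omega>) \<partial>M) = (\<integral>\<^sup>+\<omega>. F (R1 \<omega>, R2 \<omega>) \<partial>M)"
    by (simp only: F_def Y R2 fst_conv snd_conv chain.simps)
  also have "\<dots> = (\<integral>\<^sup>+z. F z \<partial>distr M (P1 \<Otimes>\<^sub>M P2) (\<lambda>\<omega>. (R1 \<omega>, R2 \<omega>)))"
    by (rule nn_integral_distr[OF measurable_Pair[OF R1m R2m], symmetric]) (simp only: measurable_distr_eq1 Fm)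
  also have "\<dots> = (\<integral>\<^sup>+y. (\<integral>\<^sup>+n. F (y, n) \<partial>distr M P2 R2) \<partial>distr M P1 R1)"
    unfolding eq by (rule \<nu>.nn_integral_fst[OF Fm', symmetric])
  also have "\<dots> = (\<integral>\<^sup>+\<omega>. (\<integral>\<^sup>+n. F (R1 \<omega>, n) \<partial>distr M P2 R2) \<partial>M)"
    by (rule nn_integral_distr[OF R1m \<nu>.borel_measurable_nn_integral_fst[OF Fm']])
  also have "\<dots> = (\<integral>\<^sup>+\<omega>. (\<integral>\<^sup>+n. f (a (chain a N x t \<omega>) n) \<partial>distr M borel (N (Suc t))) \<partial>M)"
  proof (rule nn_integral_cong)
    fix \<omega>
    let ?c = "chain a N x t \<omega>"
    have "(\<integral>\<^sup>+n. F (R1 \<omega>, n) \<partial>distr M P2 R2) = (\<integral>\<^sup>+n. f (a ?c (n (Suc t))) \<partial>distr M P2 R2)"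
      by (simp only: F_def Y fst_conv snd_conv)
    also have "\<dots> = (\<integral>\<^sup>+\<omega>'. f (a ?c (R2 \<omega>' (Suc t))) \<partial>M)"
      by (rule nn_integral_distr[OF R2m]) (simp only: measurable_distr_eq1 measurable_compose[OF pm fm])
    also have "\<dots> = (\<integral>\<^sup>+n. f (a ?c n) \<partial>distr M borel (N (Suc t)))"
      unfolding R2 by (rule nn_integral_distr[OF Nm, symmetric]) (simp add: fm)
    finally show "(\<integral>\<^sup>+n. F (R1 \<omega>, n) \<partial>distr M P2 R2) = \<dots>" .
  qed
  also have "distr M borel (N (Suc t)) = distr M borel (N 1)"
    using noise unfolding iid_noise_def by (metis le_add1 plus_1_eq_Suc)
  also have "(\<integral>\<^sup>+\<omega>. (\<integral>\<^sup>+n. f (a (chain a N x t \<omega>) n) \<partial>distr M borel (N 1)) \<partial>M) =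
      (\<integral>\<^sup>+\<omega>. (\<integral>\<^sup>+\<omega>'. f (a (chain a N x t \<omega>) (N 1 \<omega>')) \<partial>M) \<partial>M)"
    by (intro nn_integral_cong nn_integral_distr) (auto simp: fm)
  finally show ?thesis .
qed

text \<open>The induction is over all \<open>f\<close> at once because the last step of the longer
  path is absorbed into the test function.\<close>

lemma nn_integral_chain_add:
  assumes "f \<in> borel_measurable borel"
  shows "(\<integral>\<^sup>+\<omega>. f (chain a N x (t + s) \<omega>) \<partial>M) =
    (\<integral>\<^sup>+\<omega>. (\<integral>\<^sup>+\<omega>'. f (chain a N (chain a N x t \<omega>) s \<omega>') \<partial>M) \<partial>M)"
  using assms
proof (induction s arbitrary: f)
  case 0
  then show ?case by (simp add: emeasure_space_1)
next
  case (Suc s)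
  note [measurable] = Suc.prems
  have m: "(\<lambda>y. \<integral>\<^sup>+\<omega>'. f (a y (N 1 \<omega>')) \<partial>M) \<in> borel_measurable borel" by simp
  show ?case
    unfolding add_Suc_right nn_integral_chain_Suc[OF Suc.prems]
    by (rule Suc.IH[OF m])
qed

text \<open>The formulation by laws carries the Chapman-Kolmogorov relation over to signed
  integrands; on the product space the two time segments are driven by independent copies of the
  noise.\<close>

lemma distr_chain_add:
  "distr M borel (chain a N x (t + s)) =
    distr (M \<Otimes>\<^sub>M M) borel (\<lambda>(\<omega>, \<omega>'). chain a N (chain a N x t \<omega>) s \<omega>')"
proof (rule measure_eqI)
  fix A :: "(real^'l) set" assume "A \<in> sets (distr M borel (chain a N x (t + s)))"
  then have A[measurable]: "A \<in> sets borel" by simp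
  have "emeasure (distr M borel (chain a N x (t + s))) A = (\<integral>\<^sup>+y. indicator A y \<partial>distr M borel (chain a N x (t + s)))"
    by simp
  also have "\<dots> = (\<integral>\<^sup>+\<omega>. indicator A (chain a N x (t + s) \<omega>) \<partial>M)" by (subst nn_integral_distr) auto
  also have "\<dots> = (\<integral>\<^sup>+\<omega>. (\<integral>\<^sup>+\<omega>'. indicator A (chain a N (chain a N x t \<omega>) s \<omega>') \<partial>M) \<partial>M)"
    by (rule nn_integral_chain_add) simp
  also have "\<dots> = (\<integral>\<^sup>+z. indicator A (chain a N (chain a N x t (fst z)) s (snd z)) \<partial>(M \<Otimes>\<^sub>M M))"
    by (subst nn_integral_fst[symmetric]) auto
  also have "\<dots> = (\<integral>\<^sup>+y. indicator A y \<partial>distr (M \<Otimes>\<^sub>M M) borel (\<lambda>(\<omega>, \<omega>'). chain a N (chain a N x t \<omega>) s \<omega>'))"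
    by (subst nn_integral_distr) (auto simp: case_prod_beta')
  also have "\<dots> = emeasure (distr (M \<Otimes>\<^sub>M M) borel (\<lambda>(\<omega>, \<omega>'). chain a N (chain a N x t \<omega>) s \<omega>')) A" by simp
  finally show "emeasure (distr M borel (chain a N x (t + s))) A = \<dots>" .
qed simp

lemma integral_chain_add:
  fixes f :: "real^'l \<Rightarrow> real"
  assumes f [measurable]: "f \<in> borel_measurable borel" and int: "integrable M (\<lambda>\<omega>. f (chain a N x (t + s) \<omega>))"
  shows "(LINT \<omega>|M. f (chain a N x (t + s) \<omega>)) = (LINT \<omega>|M. LINT \<omega>'|M. f (chain a N (chain a N x t \<omega>) s \<omega>'))"
    and "integrable M (\<lambda>\<omega>. LINT \<omega>'|M. f (chain a N (chain a N x t \<omega>) s \<omega>'))"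
proof -
  interpret MM: pair_prob_space M M ..
  have "integrable (distr M borel (chain a N x (t + s))) f" using int by (subst integrable_distr_eq) auto
  then have i: "integrable (M \<Otimes>\<^sub>M M) (\<lambda>z. f (chain a N (chain a N x t (fst z)) s (snd z)))"
    unfolding distr_chain_add by (subst (asm) integrable_distr_eq) (auto simp: case_prod_beta')
  have "(LINT \<omega>|M. f (chain a N x (t + s) \<omega>)) = (LINT y|distr M borel (chain a N x (t + s)). f y)"
    by (subst integral_distr) auto
  also have "\<dots> = (LINT z|(M \<Otimes>\<^sub>M M). f (chain a N (chain a N x t (fst z)) s (snd z)))"
    unfolding distr_chain_add by (subst integral_distr) (auto simp: case_prod_beta')
  also have "\<dots> = (LINT \<omega>|M. LINT \<omega>'|M. f (chain a N (chain a N x t \<omega>) s \<omega>'))"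
    using MM.integral_fst'[OF i] by simp
  finally show "(LINT \<omega>|M. f (chain a N x (t + s) \<omega>)) = \<dots>" .
  show "integrable M (\<lambda>\<omega>. LINT \<omega>'|M. f (chain a N (chain a N x t \<omega>) s \<omega>'))"
    using MM.integrable_fst'[OF i] by simp
qed

section \<open>The operators \<open>Pop\<close>: semigroup and Feller properties, transition
  density\<close>

lemma Pop_eq: "f \<in> borel_measurable borel \<Longrightarrow> Pop M N a t f x = (LINT \<omega>|M. f (chain a N x t \<omega>))"
  unfolding Pop_def Pker_def by (subst integral_distr) auto

lemma integrable_Pker_iff:
  fixes f :: "real^'l \<Rightarrow> real"
  shows "f \<in> borel_measurable borel \<Longrightarrow> integrable (Pker M N a t x) f \<longleftrightarrow> integrable M (\<lambda>\<omega>. f (chain a N x t \<omega>))"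
  unfolding Pker_def by (subst integrable_distr_eq) auto

lemma nn_integral_Pker:
  "f \<in> borel_measurable borel \<Longrightarrow> (\<integral>\<^sup>+y. f y \<partial>Pker M N a t x) = (\<integral>\<^sup>+\<omega>. f (chain a N x t \<omega>) \<partial>M)"
  unfolding Pker_def by (subst nn_integral_distr) auto

lemma prob_space_Pker: "prob_space (Pker M N a t x)"
  unfolding Pker_def by (rule prob_space_distr) simp

lemma sets_Pker [simp, measurable_cong]: "sets (Pker M N a t x) = sets borel"
  by (simp add: Pker_def)

lemma borel_measurable_Pop [measurable]:
  assumes [measurable]: "f \<in> borel_measurable borel"
  shows "Pop M N a t f \<in> borel_measurable borel"
proof -
  have "(\<lambda>x. LINT \<omega>|M. f (chain a N x t \<omega>)) \<in> borel_measurable borel" by measurable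
  moreover have "Pop M N a t f = (\<lambda>x. LINT \<omega>|M. f (chain a N x t \<omega>))"
    by (rule ext, rule Pop_eq, fact)
  ultimately show ?thesis by simp
qed

lemma Pop_add:
  assumes f [measurable]: "f \<in> borel_measurable borel" and int: "integrable (Pker M N a (t + s) x) f"
  shows "Pop M N a (t + s) f x = Pop M N a t (Pop M N a s f) x"
    and "integrable (Pker M N a t x) (Pop M N a s f)"
  using integral_chain_add[OF f, of x t s] int
  by (simp_all add: Pop_eq integrable_Pker_iff)

lemma Pop_diff_const:
  assumes "integrable (Pker M N a t x) f"
  shows "Pop M N a t (\<lambda>y. f y - k) x = Pop M N a t f x - k"
proof -
  interpret P: prob_space "Pker M N a t x" by (rule prob_space_Pker)
  show ?thesis using assms by (simp add: Pop_def P.prob_space)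
qed

lemma Pop_0 [simp]: "f \<in> borel_measurable borel \<Longrightarrow> Pop M N a 0 f x = f x"
  by (simp add: Pop_eq prob_space)

text \<open>Every path depends continuously on its initial state, so dominated convergence along
  sequences gives the Feller property. Unbounded integrands are treated in
  \<open>continuous_expectation_dominated\<close>.\<close>

lemma continuous_expectation_chain:
  fixes f :: "real^'l \<Rightarrow> real"
  assumes "continuous_on UNIV f" and bd: "\<And>y. \<bar>f y\<bar> \<le> B"
  shows "continuous_on UNIV (\<lambda>x. LINT \<omega>|M. f (chain a N x t \<omega>))"
proof -
  have [measurable]: "f \<in> borel_measurable borel" using assms by (simp add: borel_measurable_continuous_onI)
  have "continuous_on UNIV (\<lambda>x. f (chain a N x t \<omega>))" for \<omega>
    using continuous_on_compose2[OF assms(1) chain_continuous] by simp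
  then show ?thesis
    unfolding continuous_on_sequentially
    using bd by (auto intro!: integral_dominated_convergence[where w = "\<lambda>_. B"] simp: comp_def)
qed

text \<open>A2 only asserts identities between integrals, so integrability and sign of
  \<open>p\<close> have to be recovered. Continuity settles the sign: a negative value would spread
  to a nonempty open set, whose probability would then be negative.\<close>

lemma transition_density:
  assumes "A2 M N a"
  obtains t0 p where "t0 \<ge> 1" "cont_differentiable p" "\<And>z. p z \<ge> 0"
    "\<And>x. Pker M N a t0 x = density lborel (\<lambda>y. ennreal (p (x, y)))"
proof -
  from assms obtain t0 and p :: "(real^'l) \<times> (real^'l) \<Rightarrow> real" where t0: "t0 \<ge> 1" and p: "cont_differentiable p" and
    eq: "\<And>x A. A \<in> sets borel \<Longrightarrow> measure (Pker M N a t0 x) A = (LINT y:A|lborel. p (x, y))"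
    unfolding A2_def by blast
  have pc: "continuous_on UNIV p" by (rule cont_differentiable_continuous[OF p])
  have pcx: "continuous_on UNIV (\<lambda>y. p (x, y))" for x
    by (rule continuous_on_compose2[OF pc]) (auto intro!: continuous_intros)
  have [measurable]: "(\<lambda>y. p (x, y)) \<in> borel_measurable borel" for x
    using pcx by (rule borel_measurable_continuous_onI)
  interpret P: prob_space "Pker M N a t0 x" for x by (rule prob_space_Pker)
  have one: "(LINT y|lborel. p (x, y)) = 1" for x
    using eq[of UNIV x] P.prob_space[of x] by (simp add: set_lebesgue_integral_def Pker_def)
  \<comment> \<open>A Bochner integral equal to 1 cannot be the default value 0 of a non-integrable
    function.\<close>
  have int: "integrable lborel (\<lambda>y. p (x, y))" for x
    using one[of x] not_integrable_integral_eq[of lborel "\<lambda>y. p (x, y)"] by fastforce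
  have nonneg: "p (x, y) \<ge> 0" for x y
  proof (rule ccontr)
    assume neg: "\<not> p (x, y) \<ge> 0"
    define U where "U = (\<lambda>y. p (x, y)) -` {..<0}"
    have U: "open U" "y \<in> U" using open_vimage[OF _ pcx] neg by (auto simp: U_def)
    then have [measurable]: "U \<in> sets borel" by simp
    have i: "integrable lborel (\<lambda>y. - (indicator U y * p (x, y)))"
      using integrable_mult_indicator[OF _ int, of U] by simp
    have "(LINT y|lborel. - (indicator U y * p (x, y))) = - measure (Pker M N a t0 x) U"
      by (simp add: eq set_lebesgue_integral_def)
    moreover have "(LINT y|lborel. - (indicator U y * p (x, y))) \<ge> 0"
      by (rule integral_nonneg_AE) (auto simp: U_def indicator_def)
    ultimately have "(LINT y|lborel. - (indicator U y * p (x, y))) = 0"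
      using measure_nonneg[of "Pker M N a t0 x" U] by linarith
    then have "AE y in lborel. - (indicator U y * p (x, y)) = 0"
      by (subst (asm) integral_nonneg_eq_0_iff_AE[OF i]) (auto simp: U_def indicator_def)
    then have "AE y in lborel. y \<notin> U" by eventually_elim (auto simp: U_def)
    then have "U \<in> null_sets lborel" by (subst (asm) AE_iff_null_sets[symmetric]) auto
    then have "negligible U" by (simp add: negligible_iff_null_sets null_sets_completionI)
    then show False using open_not_negligible[OF U(1)] U(2) by auto
  qed
  have "Pker M N a t0 x = density lborel (\<lambda>y. ennreal (p (x, y)))" for x
  proof (rule measure_eqI)
    fix A assume "A \<in> sets (Pker M N a t0 x)"
    then have A [measurable]: "A \<in> sets borel" by simp
    have "emeasure (Pker M N a t0 x) A = ennreal (LINT y|lborel. indicator A y * p (x, y))"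
      unfolding P.emeasure_eq_measure by (simp add: eq set_lebesgue_integral_def)
    also have "\<dots> = (\<integral>\<^sup>+y. ennreal (indicator A y * p (x, y)) \<partial>lborel)"
      using integrable_mult_indicator[OF _ int, of A] nonneg by (subst nn_integral_eq_integral) auto
    also have "\<dots> = emeasure (density lborel (\<lambda>y. ennreal (p (x, y)))) A"
      by (subst emeasure_density) (auto intro!: nn_integral_cong simp: indicator_def)
    finally show "emeasure (Pker M N a t0 x) A = \<dots>" .
  qed simp
  with t0 p nonneg show ?thesis by (intro that[of t0 p]) auto
qed

text \<open>A3 leads from any state into a ball around \<open>x0\<close>, from which A2 gives a minorization by Lebesgue
  measure on a ball \<open>G\<close>. Passing through \<open>G\<close> twice, with a free waiting time \<open>s\<close> in between, makes one
  common time work for all initial states in the compact set.\<close>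

lemma minorization_on_compact:
  assumes A2: "A2 M N a" and A3: "A3 M N a" and D: "compact D"
  shows "\<exists>T\<ge>1. \<exists>\<alpha>>0. \<exists>\<nu>. prob_space \<nu> \<and> sets \<nu> = sets borel \<and>
    (\<forall>x\<in>D. \<forall>u\<in>borel_measurable borel. ennreal \<alpha> * (\<integral>\<^sup>+y. u y \<partial>\<nu>) \<le> (\<integral>\<^sup>+y. u y \<partial>Pker M N a T x))"
proof -
  obtain t0 p where t0: "t0 \<ge> 1" and p: "cont_differentiable p" "\<And>z. p z \<ge> 0"
    and dens: "\<And>x. Pker M N a t0 x = density lborel (\<lambda>y. ennreal (p (x, y)))"
    using transition_density[OF A2] by blast
  obtain x0 where x0: "\<And>x U. open U \<Longrightarrow> x0 \<in> U \<Longrightarrow> \<forall>\<^sub>F t in sequentially. measure (Pker M N a t x) U > 0"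
    using A3 unfolding A3_def by blast
  have pc: "continuous_on UNIV p" by (rule cont_differentiable_continuous[OF p(1)])
  have pcx: "continuous_on UNIV (\<lambda>y. p (x, y))" for x
    by (rule continuous_on_compose2[OF pc]) (auto intro!: continuous_intros)
  have pm [measurable]: "(\<lambda>y. p (x, y)) \<in> borel_measurable borel" for x
    using pcx by (rule borel_measurable_continuous_onI)
  have "\<exists>y0. p (x0, y0) > 0"
  proof (rule ccontr)
    assume "\<not> (\<exists>y0. p (x0, y0) > 0)"
    then have "p (x0, y) = 0" for y using p(2)[of "(x0, y)"] by (simp add: not_less order_antisym)
    then have "emeasure (Pker M N a t0 x0) (space (Pker M N a t0 x0)) = 0"
      by (simp add: dens emeasure_density)
    then show False using prob_space.emeasure_space_1[OF prob_space_Pker] by simp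
  qed
  then obtain y0 where y0: "p (x0, y0) > 0" by blast
  define \<epsilon> where "\<epsilon> = p (x0, y0) / 2"
  have \<epsilon>: "\<epsilon> > 0" using y0 by (simp add: \<epsilon>_def)
  have "open {z. p z > \<epsilon>}" using open_Collect_less[OF continuous_on_const pc] .
  moreover have "(x0, y0) \<in> {z. p z > \<epsilon>}" using y0 by (simp add: \<epsilon>_def)
  ultimately obtain A B where "open A" "open B" "(x0, y0) \<in> A \<times> B" "A \<times> B \<subseteq> {z. p z > \<epsilon>}"
    by (rule open_prod_elim)
  then obtain rA rB where "rA > 0" "rB > 0" "ball x0 rA \<subseteq> A" "ball y0 rB \<subseteq> B"
    by (metis mem_Sigma_iff open_contains_ball)
  with \<open>A \<times> B \<subseteq> {z. p z > \<epsilon>}\<close> obtain r where r: "r > 0"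
    and pr: "\<And>x y. x \<in> ball x0 r \<Longrightarrow> y \<in> ball y0 r \<Longrightarrow> p (x, y) > \<epsilon>"
    by (intro that[of "min rA rB"]) (auto simp: subset_iff)
  define G where "G = ball y0 r"
  \<comment> \<open>A tent function in place of the indicator of the ball: its expectation
    \<open>g t x\<close> is continuous in \<open>x\<close>, as the open cover of \<open>D\<close>
    and the lower bound on \<open>D\<close> require.\<close>
  define \<phi> where "\<phi> z = max 0 (r - dist x0 z)" for z
  have \<phi>: "continuous_on UNIV \<phi>" "\<And>z. 0 \<le> \<phi> z" "\<And>z. \<phi> z \<le> r"
    unfolding \<phi>_def using r by (auto intro!: continuous_intros)
  have [measurable]: "\<phi> \<in> borel_measurable borel" "G \<in> sets borel"
    using \<phi>(1) by (auto simp: borel_measurable_continuous_onI G_def)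
  define m where "m u = (\<integral>\<^sup>+y. u y * indicator G y \<partial>lborel)" for u
  \<comment> \<open>Since \<open>\<phi> \<le> r\<close>, the product
    \<open>\<kappa> * \<phi> z\<close> stays below \<epsilon>, the lower bound of \<open>p\<close>
    on the product of the two balls.\<close>
  define \<kappa> where "\<kappa> = \<epsilon> / r"
  have \<kappa>: "\<kappa> > 0" using \<epsilon> r by (simp add: \<kappa>_def)
  define g where "g t x = (LINT \<omega>|M. \<phi> (chain a N x t \<omega>))" for t x
  have g_cont: "continuous_on UNIV (g t)" for t
    unfolding g_def[abs_def] using \<phi> by (intro continuous_expectation_chain[of _ r]) auto
  then have [measurable]: "g t \<in> borel_measurable borel" for t by (rule borel_measurable_continuous_onI)
  have int\<phi>: "integrable M (\<lambda>\<omega>. \<phi> (chain a N x t \<omega>))" for x t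
    by (rule integrable_const_bound[of _ r]) (use \<phi> in auto)
  have g0: "g t x \<ge> 0" for t x unfolding g_def using \<phi> by (intro integral_nonneg_AE) auto
  have g_nn: "(\<integral>\<^sup>+\<omega>. ennreal (\<phi> (chain a N x t \<omega>)) \<partial>M) = ennreal (g t x)" for x t
    unfolding g_def using int\<phi> \<phi> by (intro nn_integral_eq_integral) auto
  have g_pos: "g t x > 0" if "measure (Pker M N a t x) (ball x0 r) > 0" for t x
  proof (rule ccontr)
    assume "\<not> g t x > 0"
    with g0[of t x] have "g t x = 0" by simp
    then have "AE \<omega> in M. \<phi> (chain a N x t \<omega>) = 0"
      unfolding g_def using int\<phi> \<phi> by (subst (asm) integral_nonneg_eq_0_iff_AE) auto
    then have "AE \<omega> in M. chain a N x t \<omega> \<notin> ball x0 r" by eventually_elim (auto simp: \<phi>_def)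
    then have "AE y in Pker M N a t x. y \<notin> ball x0 r" unfolding Pker_def by (subst AE_distr_iff) auto
    then have "ball x0 r \<in> null_sets (Pker M N a t x)"
      by (subst AE_iff_null_sets) simp
    then have "measure (Pker M N a t x) (ball x0 r) = 0" by (rule measure_eq_0_null_sets)
    with that show False by simp
  qed
  have g_ev: "\<forall>\<^sub>F t in sequentially. g t x > 0" for x
    using x0[of "ball x0 r" x] r by (auto elim!: eventually_mono intro: g_pos)
  have L1: "ennreal (\<kappa> * \<phi> z) * m u \<le> (\<integral>\<^sup>+\<omega>. u (chain a N z t0 \<omega>) \<partial>M)"
    if [measurable]: "u \<in> borel_measurable borel" for u z
  proof (cases "z \<in> ball x0 r")
    case False
    then show ?thesis by (simp add: \<phi>_def)
  next
    case True
    have "ennreal (\<kappa> * \<phi> z) * m u = (\<integral>\<^sup>+y. ennreal (\<kappa> * \<phi> z) * (u y * indicator G y) \<partial>lborel)"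
      unfolding m_def by (subst nn_integral_cmult) auto
    also have "\<dots> \<le> (\<integral>\<^sup>+y. ennreal (p (z, y)) * u y \<partial>lborel)"
    proof (rule nn_integral_mono)
      fix y
      have "\<kappa> * \<phi> z \<le> \<epsilon>" using \<phi>(3)[of z] \<epsilon> r by (simp add: \<kappa>_def field_simps)
      then show "ennreal (\<kappa> * \<phi> z) * (u y * indicator G y) \<le> ennreal (p (z, y)) * u y"
        using pr[OF True, of y] by (cases "y \<in> G") (auto simp: G_def intro!: mult_right_mono ennreal_leI)
    qed
    also have "\<dots> = (\<integral>\<^sup>+y. u y \<partial>Pker M N a t0 z)"
      unfolding dens by (subst nn_integral_density) auto
    finally show ?thesis by (simp add: nn_integral_Pker)
  qed
  have L2: "ennreal (\<kappa> * g s z) * m u \<le> (\<integral>\<^sup>+\<omega>. u (chain a N z (s + t0) \<omega>) \<partial>M)"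
    if u [measurable]: "u \<in> borel_measurable borel" for u z s
  proof -
    have "ennreal (\<kappa> * g s z) * m u = (\<integral>\<^sup>+\<omega>. ennreal (\<kappa> * \<phi> (chain a N z s \<omega>)) * m u \<partial>M)"
      using \<kappa> g0 \<phi> by (simp add: nn_integral_cmult nn_integral_multc ennreal_mult g_nn)
    also have "\<dots> \<le> (\<integral>\<^sup>+\<omega>. u (chain a N z (s + t0) \<omega>) \<partial>M)"
      unfolding nn_integral_chain_add[OF u] by (intro nn_integral_mono L1 u)
    finally show ?thesis .
  qed
  \<comment> \<open>The segments are: \<open>t\<close> steps to approach \<open>x0\<close>,
    \<open>t0\<close> steps to spread over \<open>G\<close>, \<open>s\<close> steps back towards
    \<open>x0\<close>, and \<open>t0\<close> steps to spread over \<open>G\<close> again. Only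
    \<open>t\<close> has to depend on the initial state, and \<open>s\<close> can compensate for
    it.\<close>
  have L3: "ennreal (\<kappa> * g t x) * (ennreal \<kappa> * m (\<lambda>y. ennreal (g s y)) * m u) \<le>
      (\<integral>\<^sup>+y. u y \<partial>Pker M N a (t + t0 + (s + t0)) x)"
    if u [measurable]: "u \<in> borel_measurable borel" for u x s t
  proof -
    let ?h = "\<lambda>y. \<integral>\<^sup>+\<omega>. u (chain a N y (s + t0) \<omega>) \<partial>M"
    have "ennreal \<kappa> * m (\<lambda>y. ennreal (g s y)) * m u = (\<integral>\<^sup>+y. ennreal (\<kappa> * g s y) * m u * indicator G y \<partial>lborel)"
    proof -
      have "ennreal \<kappa> * m (\<lambda>y. ennreal (g s y)) * m u =
          (\<integral>\<^sup>+y. (ennreal \<kappa> * m u) * (ennreal (g s y) * indicator G y) \<partial>lborel)"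
        by (subst nn_integral_cmult) (auto simp: m_def[of "\<lambda>y. ennreal (g s y)"] mult.assoc mult.commute mult.left_commute)
      also have "\<dots> = (\<integral>\<^sup>+y. ennreal (\<kappa> * g s y) * m u * indicator G y \<partial>lborel)"
        using \<kappa> g0 by (intro nn_integral_cong) (simp add: ennreal_mult mult.assoc mult.commute mult.left_commute)
      finally show ?thesis .
    qed
    also have "\<dots> \<le> m ?h" unfolding m_def[of ?h] by (intro nn_integral_mono mult_right_mono L2 u) simp
    finally have "ennreal (\<kappa> * g t x) * (ennreal \<kappa> * m (\<lambda>y. ennreal (g s y)) * m u) \<le> ennreal (\<kappa> * g t x) * m ?h"
      by (intro mult_left_mono) auto
    also have "\<dots> \<le> (\<integral>\<^sup>+\<omega>. ?h (chain a N x (t + t0) \<omega>) \<partial>M)" by (rule L2) simp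
    also have "\<dots> = (\<integral>\<^sup>+y. u y \<partial>Pker M N a (t + t0 + (s + t0)) x)"
      by (simp add: nn_integral_Pker nn_integral_chain_add[OF u, of x "t + t0"])
    finally show ?thesis .
  qed
  obtain n where n: "\<And>s. s \<ge> n \<Longrightarrow> g s y0 > 0"
    using g_ev[of y0] unfolding eventually_sequentially by blast
  \<comment> \<open>The continuous function \<open>g s\<close> is positive at the centre
    \<open>y0\<close> of \<open>G\<close>, hence on an open set of positive Lebesgue
    measure.\<close>
  have mg: "\<exists>\<beta>>0. ennreal \<beta> \<le> m (\<lambda>y. ennreal (g s y))" if "s \<ge> n" for s
  proof -
    let ?H = "ball y0 r \<inter> {y. g s y > 0}"
    have "open ?H" using open_Collect_less[OF continuous_on_const g_cont[of s]] by auto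
    moreover have "y0 \<in> ?H" using n[OF that] r by simp
    ultimately have "\<not> negligible ?H" by (metis empty_iff open_not_negligible)
    then have nn: "?H \<notin> null_sets lborel" by (metis negligible_iff_null_sets null_sets_completionI)
    have [measurable]: "?H \<in> sets borel" using \<open>open ?H\<close> by simp
    have "m (\<lambda>y. ennreal (g s y)) \<noteq> 0"
    proof
      assume "m (\<lambda>y. ennreal (g s y)) = 0"
      then have "AE y in lborel. ennreal (g s y) * indicator G y = 0"
        unfolding m_def by (subst (asm) nn_integral_0_iff_AE) auto
      then have "AE y in lborel. y \<notin> ?H" by eventually_elim (auto simp: G_def)
      then show False using nn by (subst (asm) AE_iff_null_sets[symmetric]) auto
    qed
    then have "0 < m (\<lambda>y. ennreal (g s y))" by (simp add: zero_less_iff_neq_zero)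
    then obtain q where "0 < q" "q < m (\<lambda>y. ennreal (g s y))" using dense by blast
    then show ?thesis
      by (cases q) (auto simp: ennreal_less_zero_iff intro!: exI[of _ "enn2real q"])
  qed
  have op: "open {x. g t x > 0}" for t using open_Collect_less[OF continuous_on_const g_cont[of t]] .
  have "D \<subseteq> (\<Union>t. {x. g t x > 0})"
  proof
    fix x
    obtain t where "g t x > 0" using g_ev[of x] unfolding eventually_sequentially by blast
    then show "x \<in> (\<Union>t. {x. g t x > 0})" by blast
  qed
  then obtain F where F: "finite F" "D \<subseteq> (\<Union>t\<in>F. {x. g t x > 0})"
    using compactE_image[OF D, of UNIV "\<lambda>t. {x. g t x > 0}"] op by (metis (no_types, lifting))
  \<comment> \<open>Adding 0 keeps the index set nonempty, so that \<open>Max\<close>,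
    \<open>Min\<close> and the division by its cardinality make sense even when \<open>D\<close> is
    empty.\<close>
  define F' where "F' = insert 0 F"
  have F': "finite F'" "F' \<noteq> {}" "D \<subseteq> (\<Union>t\<in>F'. {x. g t x > 0})" using F by (auto simp: F'_def)
  define G1 where "G1 x = (\<Sum>t\<in>F'. g t x)" for x
  have G1: "continuous_on D G1" unfolding G1_def
    by (intro continuous_intros continuous_on_subset[OF g_cont]) auto
  have G1pos: "G1 x > 0" if xD: "x \<in> D" for x
  proof -
    obtain t where "t \<in> F'" "g t x > 0" using F'(3) xD by blast
    then show ?thesis unfolding G1_def using F'(1) g0 by (intro sum_pos2[of _ t]) auto
  qed
  obtain c where c: "c > 0" "\<And>x. x \<in> D \<Longrightarrow> G1 x \<ge> c"
  proof (cases "D = {}")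
    case True
    then show ?thesis by (intro that[of 1]) auto
  next
    case False
    from continuous_attains_inf[OF D False G1] G1pos that show ?thesis by blast
  qed
  \<comment> \<open>Pigeonhole: of the terms whose sum is at least \<open>c\<close>, one is at least
    \<open>c\<close> divided by their number.\<close>
  define c' where "c' = c / card F'"
  have c': "c' > 0" using c F' by (simp add: c'_def card_gt_0_iff)
  have ex: "\<exists>t\<in>F'. g t x \<ge> c'" if "x \<in> D" for x
  proof (rule ccontr)
    assume "\<not> (\<exists>t\<in>F'. g t x \<ge> c')"
    then have "G1 x < (\<Sum>t\<in>F'. c')" unfolding G1_def using F' by (intro sum_strict_mono) auto
    also have "\<dots> = c" using F' by (simp add: c'_def)
    finally show False using c(2)[OF that] by simp
  qed
  \<comment> \<open>Large enough that the waiting time \<open>T - t - 2 * t0\<close> is at least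
    \<open>n\<close> for every \<open>t\<close> in \<open>F'\<close>.\<close>
  define T where "T = Max F' + n + 2 * t0"
  have "\<forall>t\<in>F'. \<exists>\<beta>>0. ennreal \<beta> \<le> m (\<lambda>y. ennreal (g (T - t - 2 * t0) y))"
  proof
    fix t assume "t \<in> F'"
    then have "t \<le> Max F'" using F' by simp
    then show "\<exists>\<beta>>0. ennreal \<beta> \<le> m (\<lambda>y. ennreal (g (T - t - 2 * t0) y))"
      by (intro mg) (simp add: T_def)
  qed
  then obtain \<beta> where \<beta>: "\<And>t. t \<in> F' \<Longrightarrow> \<beta> t > 0 \<and> ennreal (\<beta> t) \<le> m (\<lambda>y. ennreal (g (T - t - 2 * t0) y))"
    by metis
  define b where "b = Min (\<beta> ` F')"
  have b: "b > 0" "\<And>t. t \<in> F' \<Longrightarrow> b \<le> \<beta> t" using F' \<beta> by (auto simp: b_def)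
  define vol where "vol = measure lborel G"
  have vol: "emeasure lborel G = ennreal vol" "vol > 0"
    unfolding vol_def G_def using emeasure_lborel_ball_finite[of y0 r] content_ball_pos[OF r, of y0]
    by (auto simp: emeasure_eq_ennreal_measure less_top)
  \<comment> \<open>\<open>\<kappa> * c'\<close> comes from the first passage,
    \<open>\<kappa> * b\<close> from the second, and \<open>vol\<close> turns Lebesgue measure on
    \<open>G\<close> into a probability measure.\<close>
  define \<alpha> where "\<alpha> = \<kappa> * c' * (\<kappa> * b) * vol"
  let ?\<nu> = "uniform_measure lborel G"
  have "prob_space ?\<nu>" using vol by (intro prob_space_uniform_measure) auto
  moreover have "ennreal \<alpha> * (\<integral>\<^sup>+y. u y \<partial>?\<nu>) \<le> (\<integral>\<^sup>+y. u y \<partial>Pker M N a T x)"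
    if "x \<in> D" and u [measurable]: "u \<in> borel_measurable borel" for x u
  proof -
    from ex[OF that(1)] obtain t where t: "t \<in> F'" "g t x \<ge> c'" by blast
    have "t \<le> Max F'" using F' t by simp
    then have T: "t + t0 + (T - t - 2 * t0 + t0) = T" by (simp add: T_def)
    have "(\<integral>\<^sup>+y. u y \<partial>?\<nu>) = m u / ennreal vol"
      by (subst nn_integral_uniform_measure) (auto simp: m_def vol mult.commute)
    moreover have "ennreal vol * (m u / ennreal vol) = m u"
      unfolding ennreal_times_divide mult.commute[of "ennreal vol"] using vol
      by (intro mult_divide_eq_ennreal) auto
    moreover have "ennreal \<alpha> = ennreal (\<kappa> * c') * (ennreal \<kappa> * ennreal b) * ennreal vol"
      unfolding \<alpha>_def using \<kappa> c' b vol by (simp add: ennreal_mult)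
    ultimately have "ennreal \<alpha> * (\<integral>\<^sup>+y. u y \<partial>?\<nu>) = ennreal (\<kappa> * c') * (ennreal \<kappa> * ennreal b * m u)"
      by (simp add: mult.assoc)
    also have "\<dots> \<le> ennreal (\<kappa> * g t x) * (ennreal \<kappa> * m (\<lambda>y. ennreal (g (T - t - 2 * t0) y)) * m u)"
    proof (intro mult_mono ennreal_leI)
      show "ennreal b \<le> m (\<lambda>y. ennreal (g (T - t - 2 * t0) y))"
        using \<beta>[OF t(1)] b(2)[OF t(1)] by (meson ennreal_leI order_trans)
    qed (use \<kappa> t c' in auto)
    also have "\<dots> \<le> (\<integral>\<^sup>+y. u y \<partial>Pker M N a T x)"
      using L3[OF u, of t x "T - t - 2 * t0"] unfolding T .
    finally show ?thesis .
  qed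
  moreover have "\<alpha> > 0" "T \<ge> 1" using \<kappa> c' b vol t0 by (auto simp: \<alpha>_def T_def)
  ultimately show ?thesis by (intro exI[of _ T] conjI exI[of _ \<alpha>] exI[of _ ?\<nu>]) auto
qed

section \<open>Iterated drift and integrals against an invariant measure\<close>

text \<open>Working with nonnegative integrals delivers integrability along with the bound. It is
  used for growth, with \<open>\<gamma> \<ge> 1\<close> and \<open>\<kappa> = 0\<close>, and for
  contraction, with \<open>\<gamma> = 1/2\<close>.\<close>

lemma chain_drift_iterate:
  fixes f :: "real^'l \<Rightarrow> real"
  assumes f: "f \<in> borel_measurable borel" "\<And>y. f y \<ge> 0" and "\<gamma> \<ge> 0" "\<kappa> \<ge> 0"
    and step: "\<And>y. integrable M (\<lambda>\<omega>. f (chain a N y 1 \<omega>))" "\<And>y. (LINT \<omega>|M. f (chain a N y 1 \<omega>)) \<le> \<gamma> * f y + \<kappa>"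
  shows "integrable M (\<lambda>\<omega>. f (chain a N x t \<omega>))"
    and "(LINT \<omega>|M. f (chain a N x t \<omega>)) \<le> \<gamma> ^ t * f x + \<kappa> * (\<Sum>i<t. \<gamma> ^ i)"
proof -
  note [measurable] = f(1)
  have "(\<integral>\<^sup>+\<omega>. ennreal (f (chain a N x t \<omega>)) \<partial>M) \<le> ennreal (\<gamma> ^ t * f x + \<kappa> * (\<Sum>i<t. \<gamma> ^ i))"
  proof (induction t)
    case 0
    show ?case by (simp add: emeasure_space_1)
  next
    case (Suc t)
    have s: "(\<integral>\<^sup>+\<omega>. ennreal (f (chain a N y 1 \<omega>)) \<partial>M) \<le> ennreal \<gamma> * ennreal (f y) + ennreal \<kappa>" for y
    proof -
      have "(\<integral>\<^sup>+\<omega>. ennreal (f (chain a N y 1 \<omega>)) \<partial>M) = ennreal (LINT \<omega>|M. f (chain a N y 1 \<omega>))"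
        using step(1) f(2) by (intro nn_integral_eq_integral) auto
      also have "\<dots> \<le> ennreal (\<gamma> * f y + \<kappa>)" by (intro ennreal_leI step)
      finally show ?thesis using assms by (simp add: ennreal_mult)
    qed
    have "(\<integral>\<^sup>+\<omega>. ennreal (f (chain a N x (t + 1) \<omega>)) \<partial>M) =
        (\<integral>\<^sup>+\<omega>. (\<integral>\<^sup>+\<omega>'. ennreal (f (chain a N (chain a N x t \<omega>) 1 \<omega>')) \<partial>M) \<partial>M)"
      by (rule nn_integral_chain_add) simp
    also have "\<dots> \<le> (\<integral>\<^sup>+\<omega>. ennreal \<gamma> * ennreal (f (chain a N x t \<omega>)) + ennreal \<kappa> \<partial>M)"
      by (intro nn_integral_mono s)
    also have "\<dots> = ennreal \<gamma> * (\<integral>\<^sup>+\<omega>. ennreal (f (chain a N x t \<omega>)) \<partial>M) + ennreal \<kappa>"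
      by (simp add: nn_integral_add nn_integral_cmult emeasure_space_1)
    also have "\<dots> \<le> ennreal \<gamma> * ennreal (\<gamma> ^ t * f x + \<kappa> * (\<Sum>i<t. \<gamma> ^ i)) + ennreal \<kappa>"
      by (intro add_mono mult_left_mono Suc) auto
    also have "\<dots> = ennreal (\<gamma> * (\<gamma> ^ t * f x + \<kappa> * (\<Sum>i<t. \<gamma> ^ i)) + \<kappa>)"
      using assms by (simp add: ennreal_mult sum_nonneg)
    also have "\<gamma> * (\<gamma> ^ t * f x + \<kappa> * (\<Sum>i<t. \<gamma> ^ i)) + \<kappa> = \<gamma> ^ Suc t * f x + \<kappa> * (\<Sum>i<Suc t. \<gamma> ^ i)"
      by (subst sum.lessThan_Suc_shift) (simp add: algebra_simps sum_distrib_left)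
    finally show ?case by (simp del: chain.simps)
  qed
  note bd = this
  have pos: "0 \<le> \<gamma> ^ t * f x + \<kappa> * (\<Sum>i<t. \<gamma> ^ i)" using assms by (simp add: sum_nonneg)
  show i: "integrable M (\<lambda>\<omega>. f (chain a N x t \<omega>))"
    using bd f(2) by (intro integrableI_nonneg) (auto intro: le_less_trans)
  have "ennreal (LINT \<omega>|M. f (chain a N x t \<omega>)) = (\<integral>\<^sup>+\<omega>. ennreal (f (chain a N x t \<omega>)) \<partial>M)"
    using i f(2) by (intro nn_integral_eq_integral[symmetric]) auto
  with bd show "(LINT \<omega>|M. f (chain a N x t \<omega>)) \<le> \<gamma> ^ t * f x + \<kappa> * (\<Sum>i<t. \<gamma> ^ i)"
    using pos by (metis ennreal_le_iff)
qed

text \<open>Invariance is assumed on sets and for one step. Read as an identity of laws, that of the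
  chain started from \<pi> after one step and \<pi> itself, it extends to nonnegative functions, and
  by the Markov property to all times.\<close>

lemma nn_integral_invariant:
  assumes \<pi>: "invariant_prob M N a \<pi>" and f: "f \<in> borel_measurable borel"
  shows "(\<integral>\<^sup>+x. (\<integral>\<^sup>+\<omega>. f (chain a N x t \<omega>) \<partial>M) \<partial>\<pi>) = (\<integral>\<^sup>+x. f x \<partial>\<pi>)"
proof -
  interpret \<pi>: prob_space \<pi> using \<pi> by (simp add: invariant_prob_def)
  have [measurable_cong, simp]: "sets \<pi> = sets borel" using \<pi> by (simp add: invariant_prob_def)
  have inv: "distr (\<pi> \<Otimes>\<^sub>M M) borel (\<lambda>(x, \<omega>). chain a N x 1 \<omega>) = \<pi>"
  proof (rule measure_eqI)
    fix A :: "(real^'l) set" assume "A \<in> sets (distr (\<pi> \<Otimes>\<^sub>M M) borel (\<lambda>(x, \<omega>). chain a N x 1 \<omega>))"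
    then have A [measurable]: "A \<in> sets borel" by simp
    have "emeasure (distr (\<pi> \<Otimes>\<^sub>M M) borel (\<lambda>(x, \<omega>). chain a N x 1 \<omega>)) A =
        (\<integral>\<^sup>+y. indicator A y \<partial>distr (\<pi> \<Otimes>\<^sub>M M) borel (\<lambda>(x, \<omega>). chain a N x 1 \<omega>))"
      by simp
    also have "\<dots> = (\<integral>\<^sup>+z. indicator A (chain a N (fst z) 1 (snd z)) \<partial>(\<pi> \<Otimes>\<^sub>M M))"
      by (subst nn_integral_distr) (auto simp: case_prod_beta' simp del: chain.simps)
    also have "\<dots> = (\<integral>\<^sup>+x. (\<integral>\<^sup>+\<omega>. indicator A (chain a N x 1 \<omega>) \<partial>M) \<partial>\<pi>)"
      by (subst nn_integral_fst[symmetric]) (auto simp del: chain.simps)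
    also have "\<dots> = (\<integral>\<^sup>+x. emeasure (Pker M N a 1 x) A \<partial>\<pi>)"
      by (intro nn_integral_cong) (simp add: nn_integral_Pker[symmetric] del: chain.simps)
    also have "\<dots> = emeasure \<pi> A" using \<pi> A by (simp add: invariant_prob_def del: chain.simps)
    finally show "emeasure (distr (\<pi> \<Otimes>\<^sub>M M) borel (\<lambda>(x, \<omega>). chain a N x 1 \<omega>)) A = emeasure \<pi> A" .
  qed simp
  have one: "(\<integral>\<^sup>+x. (\<integral>\<^sup>+\<omega>. f (chain a N x 1 \<omega>) \<partial>M) \<partial>\<pi>) = (\<integral>\<^sup>+x. f x \<partial>\<pi>)"
    if [measurable]: "f \<in> borel_measurable borel" for f
  proof -
    have "(\<integral>\<^sup>+x. f x \<partial>\<pi>) = (\<integral>\<^sup>+x. f x \<partial>distr (\<pi> \<Otimes>\<^sub>M M) borel (\<lambda>(x, \<omega>). chain a N x 1 \<omega>))"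
      by (simp only: inv)
    also have "\<dots> = (\<integral>\<^sup>+z. f (chain a N (fst z) 1 (snd z)) \<partial>(\<pi> \<Otimes>\<^sub>M M))"
      by (subst nn_integral_distr) (auto simp: case_prod_beta' simp del: chain.simps)
    also have "\<dots> = (\<integral>\<^sup>+x. (\<integral>\<^sup>+\<omega>. f (chain a N x 1 \<omega>) \<partial>M) \<partial>\<pi>)"
      by (subst nn_integral_fst[symmetric]) (auto simp del: chain.simps)
    finally show ?thesis by simp
  qed
  show ?thesis
  proof (induction t)
    case 0
    show ?case by (simp add: emeasure_space_1)
  next
    case (Suc t)
    note [measurable] = f
    let ?g = "\<lambda>y. \<integral>\<^sup>+\<omega>. f (chain a N y t \<omega>) \<partial>M"
    have "(\<integral>\<^sup>+x. (\<integral>\<^sup>+\<omega>. f (chain a N x (1 + t) \<omega>) \<partial>M) \<partial>\<pi>) = (\<integral>\<^sup>+x. (\<integral>\<^sup>+\<omega>. ?g (chain a N x 1 \<omega>) \<partial>M) \<partial>\<pi>)"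
      by (intro nn_integral_cong nn_integral_chain_add) simp
    also have "\<dots> = (\<integral>\<^sup>+x. ?g x \<partial>\<pi>)" by (rule one) simp
    finally show ?case using Suc by (simp del: chain.simps)
  qed
qed

lemma integral_invariant:
  fixes f :: "real^'l \<Rightarrow> real"
  assumes \<pi>: "invariant_prob M N a \<pi>" and f: "f \<in> borel_measurable borel" and int: "integrable \<pi> f"
  shows "(LINT x|\<pi>. LINT \<omega>|M. f (chain a N x t \<omega>)) = (LINT x|\<pi>. f x)"
    and "integrable \<pi> (\<lambda>x. LINT \<omega>|M. f (chain a N x t \<omega>))"
proof -
  interpret \<pi>: prob_space \<pi> using \<pi> by (simp add: invariant_prob_def)
  have [measurable_cong, simp]: "sets \<pi> = sets borel" using \<pi> by (simp add: invariant_prob_def)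
  interpret P: pair_prob_space \<pi> M ..
  let ?D = "distr (\<pi> \<Otimes>\<^sub>M M) borel (\<lambda>(x, \<omega>). chain a N x t \<omega>)"
  note [measurable] = f
  have inv: "?D = \<pi>"
  proof (rule measure_eqI)
    fix A :: "(real^'l) set" assume "A \<in> sets ?D"
    then have A [measurable]: "A \<in> sets borel" by simp
    have "emeasure ?D A = (\<integral>\<^sup>+y. indicator A y \<partial>?D)" by simp
    also have "\<dots> = (\<integral>\<^sup>+z. indicator A (chain a N (fst z) t (snd z)) \<partial>(\<pi> \<Otimes>\<^sub>M M))"
      by (subst nn_integral_distr) (auto simp: case_prod_beta')
    also have "\<dots> = (\<integral>\<^sup>+x. (\<integral>\<^sup>+\<omega>. indicator A (chain a N x t \<omega>) \<partial>M) \<partial>\<pi>)"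
      by (subst nn_integral_fst[symmetric]) auto
    also have "\<dots> = (\<integral>\<^sup>+x. indicator A x \<partial>\<pi>)" by (rule nn_integral_invariant[OF \<pi>]) simp
    finally show "emeasure ?D A = emeasure \<pi> A" by simp
  qed simp
  have "integrable ?D f" using int by (simp only: inv)
  then have i: "integrable (\<pi> \<Otimes>\<^sub>M M) (\<lambda>z. f (chain a N (fst z) t (snd z)))"
    by (subst (asm) integrable_distr_eq) (auto simp: case_prod_beta')
  have "(LINT x|\<pi>. f x) = (LINT x|?D. f x)" by (simp only: inv)
  also have "\<dots> = (LINT z|(\<pi> \<Otimes>\<^sub>M M). f (chain a N (fst z) t (snd z)))"
    by (subst integral_distr) (auto simp: case_prod_beta')
  also have "\<dots> = (LINT x|\<pi>. LINT \<omega>|M. f (chain a N x t \<omega>))"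
    using P.integral_fst'[OF i] by simp
  finally show "(LINT x|\<pi>. LINT \<omega>|M. f (chain a N x t \<omega>)) = (LINT x|\<pi>. f x)" by simp
  show "integrable \<pi> (\<lambda>x. LINT \<omega>|M. f (chain a N x t \<omega>))"
    using P.integrable_fst'[OF i] by simp
qed

text \<open>The drift inequality cannot simply be integrated, since both sides might be infinite.
  For the truncation of \<open>f\<close> at level \<open>n\<close>, invariance gives a bound at
  every time \<open>t\<close>; letting \<open>t\<close> grow removes the term with
  \<open>\<gamma> ^ t\<close>, and only then is the truncation lifted by monotone
  convergence.\<close>

lemma integrable_invariant_of_drift:
  fixes f :: "real^'l \<Rightarrow> real"
  assumes \<pi>: "invariant_prob M N a \<pi>"
    and f: "f \<in> borel_measurable borel" "\<And>y. f y \<ge> 0" and "0 \<le> \<gamma>" "\<gamma> < 1" "\<kappa> \<ge> 0"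
    and int: "\<And>x t. integrable M (\<lambda>\<omega>. f (chain a N x t \<omega>))"
    and drift: "\<And>x t. (LINT \<omega>|M. f (chain a N x t \<omega>)) \<le> \<gamma> ^ t * f x + \<kappa>"
  shows "integrable \<pi> f"
proof -
  interpret \<pi>: prob_space \<pi> using \<pi> by (simp add: invariant_prob_def)
  have [measurable_cong, simp]: "sets \<pi> = sets borel" using \<pi> by (simp add: invariant_prob_def)
  note [measurable] = f(1)
  have tr: "(\<integral>\<^sup>+x. ennreal (min (real n) (f x)) \<partial>\<pi>) \<le> ennreal \<kappa>" for n
  proof -
    let ?s = "\<lambda>t x. ennreal (min (real n) (\<gamma> ^ t * f x + \<kappa>))"
    have le: "(\<integral>\<^sup>+x. ennreal (min (real n) (f x)) \<partial>\<pi>) \<le> (\<integral>\<^sup>+x. ?s t x \<partial>\<pi>)" for t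
    proof -
      have "(\<integral>\<^sup>+x. ennreal (min (real n) (f x)) \<partial>\<pi>) =
          (\<integral>\<^sup>+x. (\<integral>\<^sup>+\<omega>. ennreal (min (real n) (f (chain a N x t \<omega>))) \<partial>M) \<partial>\<pi>)"
        by (rule nn_integral_invariant[OF \<pi>, symmetric]) simp
      also have "\<dots> \<le> (\<integral>\<^sup>+x. ?s t x \<partial>\<pi>)"
      proof (rule nn_integral_mono)
        fix x
        have i: "integrable M (\<lambda>\<omega>. min (real n) (f (chain a N x t \<omega>)))" using int by simp
        have "(LINT \<omega>|M. min (real n) (f (chain a N x t \<omega>))) \<le> (LINT \<omega>|M. f (chain a N x t \<omega>))"
          by (rule integral_mono[OF i int]) simp
        moreover have "(LINT \<omega>|M. min (real n) (f (chain a N x t \<omega>))) \<le> (LINT \<omega>|M. real n)"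
          by (rule integral_mono[OF i]) simp_all
        ultimately have "(LINT \<omega>|M. min (real n) (f (chain a N x t \<omega>))) \<le> min (real n) (\<gamma> ^ t * f x + \<kappa>)"
          using drift[of x t] by (simp add: prob_space)
        moreover have "(\<integral>\<^sup>+\<omega>. ennreal (min (real n) (f (chain a N x t \<omega>))) \<partial>M) =
            ennreal (LINT \<omega>|M. min (real n) (f (chain a N x t \<omega>)))"
          using i f(2) by (intro nn_integral_eq_integral) auto
        ultimately show "(\<integral>\<^sup>+\<omega>. ennreal (min (real n) (f (chain a N x t \<omega>))) \<partial>M) \<le> ?s t x"
          by (simp add: ennreal_leI)
      qed
      finally show ?thesis .
    qed
    \<comment> \<open>The constant \<open>n\<close> dominates, so the limit in \<open>t\<close>
      passes under the integral although \<open>f\<close> is not yet known to be integrable.\<close>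
    have "(\<lambda>t. \<integral>\<^sup>+x. ?s t x \<partial>\<pi>) \<longlonglongrightarrow> (\<integral>\<^sup>+x. ennreal (min (real n) \<kappa>) \<partial>\<pi>)"
    proof (rule nn_integral_dominated_convergence[where w = "\<lambda>_. ennreal (real n)"])
      show "AE x in \<pi>. (\<lambda>t. ?s t x) \<longlonglongrightarrow> ennreal (min (real n) \<kappa>)"
      proof (rule AE_I2)
        fix x
        have "(\<lambda>t. min (real n) (\<gamma> ^ t * f x + \<kappa>)) \<longlonglongrightarrow> min (real n) (0 * f x + \<kappa>)"
          using assms by (intro tendsto_intros LIMSEQ_realpow_zero) auto
        then show "(\<lambda>t. ?s t x) \<longlonglongrightarrow> ennreal (min (real n) \<kappa>)" by (simp add: tendsto_ennrealI)
      qed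
    qed (auto simp: ennreal_leI \<pi>.emeasure_space_1 ennreal_less_top)
    then have "(\<integral>\<^sup>+x. ennreal (min (real n) (f x)) \<partial>\<pi>) \<le> (\<integral>\<^sup>+x. ennreal (min (real n) \<kappa>) \<partial>\<pi>)"
      by (rule LIMSEQ_le_const) (use le in blast)
    also have "\<dots> \<le> ennreal \<kappa>" by (simp add: \<pi>.emeasure_space_1 ennreal_leI)
    finally show ?thesis .
  qed
  have "(\<integral>\<^sup>+x. ennreal (f x) \<partial>\<pi>) = (\<integral>\<^sup>+x. (SUP n. ennreal (min (real n) (f x))) \<partial>\<pi>)"
  proof (rule nn_integral_cong)
    fix x
    have "(\<lambda>n. ennreal (min (real n) (f x))) \<longlonglongrightarrow> ennreal (f x)"
    proof (rule tendsto_eventually)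
      show "\<forall>\<^sub>F n in sequentially. ennreal (min (real n) (f x)) = ennreal (f x)"
        using eventually_ge_at_top[of "nat \<lceil>f x\<rceil>"]
        by eventually_elim (metis ceiling_le_iff min.absorb2 nat_le_iff of_int_of_nat_eq)
    qed
    moreover have "incseq (\<lambda>n. ennreal (min (real n) (f x)))"
      by (auto simp: incseq_def intro!: ennreal_leI)
    ultimately show "ennreal (f x) = (SUP n. ennreal (min (real n) (f x)))"
      using LIMSEQ_SUP LIMSEQ_unique by blast
  qed
  also have "\<dots> = (SUP n. \<integral>\<^sup>+x. ennreal (min (real n) (f x)) \<partial>\<pi>)"
    by (rule nn_integral_monotone_convergence_SUP) (auto simp: incseq_def le_fun_def intro!: ennreal_leI)
  also have "\<dots> \<le> ennreal \<kappa>" by (rule SUP_least) (rule tr)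
  finally show ?thesis using f(2) by (intro integrableI_nonneg) (auto intro: le_less_trans)
qed

end

section \<open>Drift and ergodicity\<close>

locale dv3_chain = noise_chain M N a
  for M :: "'w measure" and N :: "nat \<Rightarrow> 'w \<Rightarrow> real^'m::finite" and a :: "real^'l::finite \<Rightarrow> real^'m \<Rightarrow> real^'l" +
  fixes V :: "real^'l \<Rightarrow> real"
  assumes A1: "A1 a" and A2: "A2 M N a" and A3: "A3 M N a" and A4: "A4 M N a V"
begin

definition wt :: "real \<Rightarrow> real^'l \<Rightarrow> real" where "wt \<eta> x = exp (\<eta> * V x)"

lemma V_regularity: "V x > 0" "continuous_on UNIV V" "cont_differentiable V" "compact {x. V x \<le> r}"
proof -
  show V0: "V x > 0" for x using A4 unfolding A4_def by blast
  show "continuous_on UNIV V" "cont_differentiable V"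
    using A4 unfolding A4_def by (auto intro: cont_differentiable_continuous)
  show "compact {x. V x \<le> r}"
  proof (cases "r \<ge> 0")
    case False
    with V0 have "{x. V x \<le> r} = {}" by (smt (verit) Collect_empty_eq)
    then show ?thesis by simp
  qed (use A4 A4_def in blast)
qed

lemma wt_pos [simp]: "wt \<eta> x > 0" "wt \<eta> x \<ge> 0" "wt \<eta> x \<noteq> 0" "\<not> wt \<eta> x \<le> 0"
  by (auto simp: wt_def)

lemma wt_ge_1: "0 \<le> \<eta> \<Longrightarrow> 1 \<le> wt \<eta> x" using V_regularity(1)[of x] by (simp add: wt_def)

lemma wt_continuous: "continuous_on A (wt \<eta>)"
  unfolding wt_def by (intro continuous_intros continuous_on_subset[OF V_regularity(2)]) auto

lemma wt_measurable [measurable]: "wt \<eta> \<in> borel_measurable borel"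
  by (rule borel_measurable_continuous_onI[OF wt_continuous])

lemma compact_wt: "0 < \<eta> \<Longrightarrow> compact {x. wt \<eta> x \<le> r}"
proof (cases "r > 0")
  case True
  assume "0 < \<eta>"
  then have "{x. wt \<eta> x \<le> r} = {x. V x \<le> ln r / \<eta>}"
    using True by (auto simp: wt_def pos_le_divide_eq mult.commute ln_ge_iff)
  then show ?thesis by (simp add: V_regularity)
next
  case False
  then have "{x. wt \<eta> x \<le> r} = {}" using wt_pos(1)[of \<eta>] by (smt (verit) Collect_empty_eq)
  then show ?thesis by simp
qed

text \<open>Jensen's inequality transfers DV3 to the powers of \<open>e\<^sup>V\<close>.\<close>

lemma wt_drift:
  obtains W C \<delta> b where "\<delta> > 0" "\<And>r. r \<ge> 0 \<Longrightarrow> compact {x. W x \<le> r}" "compact C"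
    "\<And>\<eta> x. 0 < \<eta> \<Longrightarrow> \<eta> \<le> 1 \<Longrightarrow> integrable M (\<lambda>\<omega>. wt \<eta> (chain a N x 1 \<omega>))"
    "\<And>\<eta> x. 0 < \<eta> \<Longrightarrow> \<eta> \<le> 1 \<Longrightarrow>
      (LINT \<omega>|M. wt \<eta> (chain a N x 1 \<omega>)) \<le> wt \<eta> x * exp (\<eta> * (- \<delta> * W x + b * indicator C x))"
    "\<And>x. W x \<ge> 1"
proof -
  obtain W C \<delta> b where W: "\<And>x. W x \<ge> 1" "\<And>r. r \<ge> 0 \<Longrightarrow> compact {x. W x \<le> r}" "compact C" "\<delta> > 0"
    and DV3: "DV3 M N a V W C \<delta> b"
    using A4 unfolding A4_def by blast
  have [measurable]: "(\<lambda>y. exp (V y)) \<in> borel_measurable borel" using wt_measurable[of 1] by (simp add: wt_def[abs_def])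
  have iv: "integrable M (\<lambda>\<omega>. exp (V (chain a N x 1 \<omega>)))" for x
    using DV3 unfolding DV3_def by (simp add: integrable_Pker_iff del: chain.simps)
  define m where "m x = (LINT \<omega>|M. exp (V (chain a N x 1 \<omega>)))" for x
  \<comment> \<open>Positivity of \<open>V\<close> keeps the mean at least 1, so that
    \<open>ln (m x)\<close> is a genuine logarithm and division by \<open>m x\<close> is
    harmless.\<close>
  have m1: "m x \<ge> 1" for x
  proof -
    have "(LINT \<omega>|M. 1) \<le> m x" unfolding m_def
      by (rule integral_mono[OF _ iv]) (use V_regularity(1) in \<open>auto simp: less_imp_le\<close>)
    then show ?thesis by (simp add: prob_space)
  qed
  have lnm: "ln (m x) \<le> V x + (- \<delta> * W x + b * indicator C x)" for x
    using DV3 unfolding DV3_def m_def by (simp add: Pop_eq algebra_simps del: chain.simps)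
  \<comment> \<open>Dividing \<open>exp V\<close> by its mean \<open>m x\<close> normalises it to
    mean one, so the expectation of the right side is exactly
    \<open>exp (\<eta> * ln (m x))\<close>.\<close>
  have pt: "wt \<eta> y \<le> exp (\<eta> * ln (m x)) * (\<eta> * (exp (V y) / m x) + (1 - \<eta>))"
    if "0 < \<eta>" "\<eta> \<le> 1" for \<eta> x y
  proof -
    have "wt \<eta> y = exp (\<eta> * ln (m x)) * exp (\<eta> * (V y - ln (m x)))"
      by (simp add: wt_def exp_add[symmetric] algebra_simps)
    also have "\<dots> \<le> exp (\<eta> * ln (m x)) * (\<eta> * exp (V y - ln (m x)) + (1 - \<eta>))"
      using that by (intro mult_left_mono exp_scale_le) auto
    finally show ?thesis using m1[of x] by (simp add: exp_diff)
  qed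
  have ir: "integrable M (\<lambda>\<omega>. exp (\<eta> * ln (m x)) * (\<eta> * (exp (V (chain a N x 1 \<omega>)) / m x) + (1 - \<eta>)))" for \<eta> x
    using iv[of x] by (simp del: chain.simps)
  have iw: "integrable M (\<lambda>\<omega>. wt \<eta> (chain a N x 1 \<omega>))" if "0 < \<eta>" "\<eta> \<le> 1" for \<eta> x
    by (rule Bochner_Integration.integrable_bound[OF ir[of \<eta> x]])
       (use pt[OF that, of _ x] in \<open>auto simp del: chain.simps intro!: AE_I2 intro: order_trans[OF _ abs_ge_self]\<close>)
  have "(LINT \<omega>|M. wt \<eta> (chain a N x 1 \<omega>)) \<le> wt \<eta> x * exp (\<eta> * (- \<delta> * W x + b * indicator C x))"
    if \<eta>: "0 < \<eta>" "\<eta> \<le> 1" for \<eta> x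
  proof -
    have "(LINT \<omega>|M. wt \<eta> (chain a N x 1 \<omega>)) \<le>
        (LINT \<omega>|M. exp (\<eta> * ln (m x)) * (\<eta> * (exp (V (chain a N x 1 \<omega>)) / m x) + (1 - \<eta>)))"
      by (rule integral_mono[OF iw[OF \<eta>] ir pt[OF \<eta>]])
    also have "\<dots> = exp (\<eta> * ln (m x)) * (\<eta> * (m x / m x) + (1 - \<eta>))"
      using iv[of x] by (simp add: m_def prob_space del: chain.simps)
    also have "\<dots> = exp (\<eta> * ln (m x))" using m1[of x] by simp
    also have "\<dots> \<le> exp (\<eta> * (V x + (- \<delta> * W x + b * indicator C x)))"
      using lnm[of x] \<eta> by simp
    also have "\<dots> = wt \<eta> x * exp (\<eta> * (- \<delta> * W x + b * indicator C x))"
      by (simp add: wt_def exp_add[symmetric] algebra_simps)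
    finally show ?thesis .
  qed
  with W iw show ?thesis by (intro that[of \<delta> W C b]) auto
qed

text \<open>This is where the compact sublevel sets of \<open>W\<close> enter: off \<open>C\<close>
  and beyond level \<open>r\<close>, the drift factor \<open>exp (- \<eta> * \<delta> * W x)\<close>
  falls below any prescribed \<epsilon>.\<close>

lemma wt_contracts_outside_compact:
  assumes "0 < \<eta>" "\<eta> \<le> 1" "\<epsilon> > 0"
  obtains D where "compact D" "\<And>x. x \<notin> D \<Longrightarrow> (LINT \<omega>|M. wt \<eta> (chain a N x 1 \<omega>)) \<le> \<epsilon> * wt \<eta> x"
proof -
  obtain W C \<delta> b where W: "\<delta> > 0" "\<And>r. r \<ge> 0 \<Longrightarrow> compact {x. W x \<le> r}" "compact C"
    and d: "\<And>x. (LINT \<omega>|M. wt \<eta> (chain a N x 1 \<omega>)) \<le> wt \<eta> x * exp (\<eta> * (- \<delta> * W x + b * indicator C x))"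
    using wt_drift assms by metis
  \<comment> \<open>The level at which \<open>exp (- \<eta> * \<delta> * r) = \<epsilon>\<close>;
    the maximum with 0 keeps \<open>r\<close> in the range where the sublevel sets are known to be
    compact.\<close>
  define r where "r = max 0 (- ln \<epsilon> / (\<eta> * \<delta>))"
  have "(LINT \<omega>|M. wt \<eta> (chain a N x 1 \<omega>)) \<le> \<epsilon> * wt \<eta> x" if "x \<notin> C \<union> {x. W x \<le> r}" for x
  proof -
    have "- ln \<epsilon> / (\<eta> * \<delta>) \<le> W x" using that by (auto simp: r_def)
    then have "- ln \<epsilon> \<le> W x * (\<eta> * \<delta>)" using assms W
      by (subst (asm) pos_divide_le_eq) auto
    then have "\<eta> * (- \<delta> * W x + b * indicator C x) \<le> ln \<epsilon>" using that by (simp add: algebra_simps)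
    then have "exp (\<eta> * (- \<delta> * W x + b * indicator C x)) \<le> \<epsilon>" using assms(3) by (metis exp_le_cancel_iff exp_ln)
    then have "wt \<eta> x * exp (\<eta> * (- \<delta> * W x + b * indicator C x)) \<le> wt \<eta> x * \<epsilon>" by (intro mult_left_mono) auto
    with d[of x] have "(LINT \<omega>|M. wt \<eta> (chain a N x 1 \<omega>)) \<le> wt \<eta> x * \<epsilon>" by (rule order_trans)
    then show ?thesis by (simp only: mult.commute)
  qed
  moreover have "compact (C \<union> {x. W x \<le> r})" using W by (intro compact_Un) (auto simp: r_def)
  ultimately show ?thesis using that by blast
qed

text \<open>The drift inequality loses at most a factor \<open>exp (max 0 b)\<close> per step. This
  \<open>B\<close> does not depend on \<eta>, so one constant serves the weights for \<eta> and for
  1 simultaneously.\<close>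

lemma wt_growth:
  obtains B where "B \<ge> 1" "\<And>\<eta> x t. 0 < \<eta> \<Longrightarrow> \<eta> \<le> 1 \<Longrightarrow> integrable M (\<lambda>\<omega>. wt \<eta> (chain a N x t \<omega>))"
    "\<And>\<eta> x t. 0 < \<eta> \<Longrightarrow> \<eta> \<le> 1 \<Longrightarrow> (LINT \<omega>|M. wt \<eta> (chain a N x t \<omega>)) \<le> B ^ t * wt \<eta> x"
proof -
  obtain W C \<delta> b where W: "\<delta> > 0" "\<And>x. W x \<ge> (1::real)"
    and i: "\<And>\<eta> x. 0 < \<eta> \<Longrightarrow> \<eta> \<le> 1 \<Longrightarrow> integrable M (\<lambda>\<omega>. wt \<eta> (chain a N x 1 \<omega>))"
    and d: "\<And>\<eta> x. 0 < \<eta> \<Longrightarrow> \<eta> \<le> 1 \<Longrightarrow> (LINT \<omega>|M. wt \<eta> (chain a N x 1 \<omega>)) \<le>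
      wt \<eta> x * exp (\<eta> * (- \<delta> * W x + b * indicator C x))"
    using wt_drift by metis
  define B where "B = exp (max 0 b)"
  have B: "B \<ge> 1" by (simp add: B_def)
  have s: "(LINT \<omega>|M. wt \<eta> (chain a N x 1 \<omega>)) \<le> B * wt \<eta> x + 0" if \<eta>: "0 < \<eta>" "\<eta> \<le> 1" for \<eta> x
  proof -
    have "0 \<le> \<delta> * W x" using W(1) W(2)[of x] by (intro mult_nonneg_nonneg) auto
    then have "- \<delta> * W x + b * indicator C x \<le> max 0 b" by (auto simp: indicator_def)
    then have "\<eta> * (- \<delta> * W x + b * indicator C x) \<le> \<eta> * max 0 b" using \<eta> by (intro mult_left_mono) auto
    also have "\<dots> \<le> 1 * max 0 b" using \<eta> by (intro mult_right_mono) auto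
    finally have "exp (\<eta> * (- \<delta> * W x + b * indicator C x)) \<le> B" by (simp add: B_def)
    then have "wt \<eta> x * exp (\<eta> * (- \<delta> * W x + b * indicator C x)) \<le> wt \<eta> x * B" by (intro mult_left_mono) auto
    with d[OF \<eta>, of x] have "(LINT \<omega>|M. wt \<eta> (chain a N x 1 \<omega>)) \<le> wt \<eta> x * B" by (rule order_trans)
    then show ?thesis by (simp only: mult.commute add_0_right)
  qed
  show ?thesis
  proof (rule that[OF B])
    fix \<eta> :: real and x t assume \<eta>: "0 < \<eta>" "\<eta> \<le> 1"
    show "integrable M (\<lambda>\<omega>. wt \<eta> (chain a N x t \<omega>))"
      by (rule chain_drift_iterate(1)[where \<gamma> = B and \<kappa> = 0]) (use B i[OF \<eta>] s[OF \<eta>] in \<open>auto simp del: chain.simps\<close>)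
    have "(LINT \<omega>|M. wt \<eta> (chain a N x t \<omega>)) \<le> B ^ t * wt \<eta> x + 0 * (\<Sum>i<t. B ^ i)"
      by (rule chain_drift_iterate(2)) (use B i[OF \<eta>] s[OF \<eta>] in \<open>auto simp del: chain.simps\<close>)
    then show "(LINT \<omega>|M. wt \<eta> (chain a N x t \<omega>)) \<le> B ^ t * wt \<eta> x" by simp
  qed
qed

lemma integrable_wt [simp]: "0 < \<eta> \<Longrightarrow> \<eta> \<le> 1 \<Longrightarrow> integrable M (\<lambda>\<omega>. wt \<eta> (chain a N x t \<omega>))"
  using wt_growth by metis

text \<open>Off the compact set the mean weight halves in one step; on it the weight is at most
  \<open>m\<close>, so one step leads to at most \<open>B * m\<close> on average. The geometric
  series with ratio 1/2 doubles this constant.\<close>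

lemma wt_foster:
  assumes \<eta>: "0 < \<eta>" "\<eta> \<le> 1"
  obtains \<kappa> where "\<kappa> > 0" "\<And>x t. (LINT \<omega>|M. wt \<eta> (chain a N x t \<omega>)) \<le> (1/2) ^ t * wt \<eta> x + \<kappa>"
proof -
  obtain D where D: "compact D" and out: "\<And>x. x \<notin> D \<Longrightarrow> (LINT \<omega>|M. wt \<eta> (chain a N x 1 \<omega>)) \<le> 1/2 * wt \<eta> x"
    using wt_contracts_outside_compact[OF \<eta>, of "1/2"] by auto
  obtain B where B: "B \<ge> 1" and gr: "\<And>x t. (LINT \<omega>|M. wt \<eta> (chain a N x t \<omega>)) \<le> B ^ t * wt \<eta> x"
    using wt_growth \<eta> by metis
  have "bounded (wt \<eta> ` D)" using D by (intro compact_imp_bounded compact_continuous_image wt_continuous)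
  then obtain m where m: "m > 0" "\<And>x. x \<in> D \<Longrightarrow> wt \<eta> x \<le> m"
    unfolding bounded_pos by (auto simp: abs_le_iff)
  define \<kappa> where "\<kappa> = B * m"
  have \<kappa>: "\<kappa> > 0" using B m by (simp add: \<kappa>_def)
  have s: "(LINT \<omega>|M. wt \<eta> (chain a N x 1 \<omega>)) \<le> (1/2) * wt \<eta> x + \<kappa>" for x
  proof (cases "x \<in> D")
    case True
    have "(LINT \<omega>|M. wt \<eta> (chain a N x 1 \<omega>)) \<le> B * wt \<eta> x" using gr[of x 1] by (simp del: chain.simps)
    also have "\<dots> \<le> \<kappa>" unfolding \<kappa>_def using B m(2)[OF True] by (intro mult_left_mono) auto
    finally show ?thesis using wt_pos(2)[of \<eta> x] by linarith
  next
    case False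
    with out[OF False] \<kappa> show ?thesis by linarith
  qed
  have "(LINT \<omega>|M. wt \<eta> (chain a N x t \<omega>)) \<le> (1/2) ^ t * wt \<eta> x + 2 * \<kappa>" for x t
  proof -
    have "(LINT \<omega>|M. wt \<eta> (chain a N x t \<omega>)) \<le> (1/2) ^ t * wt \<eta> x + \<kappa> * (\<Sum>i<t. (1/2) ^ i)"
      by (rule chain_drift_iterate(2)) (use \<kappa> s \<eta> in \<open>auto simp del: chain.simps\<close>)
    moreover have "(\<Sum>i<t. (1/2::real) ^ i) \<le> 2"
      unfolding sum_gp_strict by simp
    then have "\<kappa> * (\<Sum>i<t. (1/2) ^ i) \<le> \<kappa> * 2" using \<kappa> by (intro mult_left_mono) auto
    ultimately show ?thesis by linarith
  qed
  with \<kappa> show ?thesis by (intro that[of "2 * \<kappa>"]) auto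
qed

lemma integrable_dominated_chain:
  assumes "0 < \<eta>" "\<eta> \<le> 1" and [measurable]: "f \<in> borel_measurable borel" and "\<And>x. \<bar>f x\<bar> \<le> L * wt \<eta> x"
  shows "integrable M (\<lambda>\<omega>. f (chain a N x t \<omega>))"
proof (rule Bochner_Integration.integrable_bound)
  show "integrable M (\<lambda>\<omega>. L * wt \<eta> (chain a N x t \<omega>))" using assms by simp
  show "AE \<omega> in M. norm (f (chain a N x t \<omega>)) \<le> norm (L * wt \<eta> (chain a N x t \<omega>))"
    using assms(4) by (auto intro: order_trans[OF _ abs_ge_self])
qed simp

lemma integrable_wt_invariant:
  assumes "0 < \<eta>" "\<eta> \<le> 1" "invariant_prob M N a \<pi>"
  shows "integrable \<pi> (wt \<eta>)"
proof -
  obtain \<kappa> where "\<kappa> > 0" "\<And>x t. (LINT \<omega>|M. wt \<eta> (chain a N x t \<omega>)) \<le> (1/2) ^ t * wt \<eta> x + \<kappa>"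
    using wt_foster assms by metis
  then show ?thesis using assms
    by (intro integrable_invariant_of_drift[where \<gamma> = "1/2" and \<kappa> = \<kappa>]) auto
qed

lemma integrable_dominated_invariant:
  assumes "0 < \<eta>" "\<eta> \<le> 1" "invariant_prob M N a \<pi>"
    and f: "f \<in> borel_measurable borel" and L: "\<And>x. \<bar>f x\<bar> \<le> L * wt \<eta> x"
  shows "integrable \<pi> f"
proof (rule Bochner_Integration.integrable_bound)
  show "integrable \<pi> (\<lambda>x. L * wt \<eta> x)" using integrable_wt_invariant assms(1-3) by simp
  have [measurable_cong]: "sets \<pi> = sets borel" using assms(3) by (simp add: invariant_prob_def)
  show "f \<in> borel_measurable \<pi>" using f by measurable
  show "AE x in \<pi>. norm (f x) \<le> norm (L * wt \<eta> x)"
    using L by (intro AE_I2) (metis abs_ge_self order_trans real_norm_def)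
qed

text \<open>The Harris contraction acts in blocks of the minorization time \<open>T\<close>, and
  within a block the growth bound is used. Averaging the oscillation of an iterate over its second
  argument with respect to \<pi> then turns it into the distance from the mean.\<close>

lemma summable_ergodicity:
  assumes \<eta>: "0 < \<eta>" "\<eta> \<le> 1" and \<pi>: "invariant_prob M N a \<pi>"
  obtains u :: "nat \<Rightarrow> real" where "summable u" "\<And>t. u t \<ge> 0"
    "\<And>f L x t. f \<in> borel_measurable borel \<Longrightarrow> (\<And>x. \<bar>f x\<bar> \<le> L * wt \<eta> x) \<Longrightarrow>
      \<bar>(LINT \<omega>|M. f (chain a N x t \<omega>)) - (LINT y|\<pi>. f y)\<bar> \<le> L * u t * wt \<eta> x"
proof -
  interpret \<pi>: prob_space \<pi> using \<pi> by (simp add: invariant_prob_def)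
  have [measurable_cong, simp]: "sets \<pi> = sets borel" using \<pi> by (simp add: invariant_prob_def)
  obtain \<kappa> where \<kappa>: "\<kappa> > 0" and fo: "\<And>x t. (LINT \<omega>|M. wt \<eta> (chain a N x t \<omega>)) \<le> (1/2) ^ t * wt \<eta> x + \<kappa>"
    using wt_foster \<eta> by metis
  obtain B where B: "B \<ge> 1" and gr: "\<And>x t. (LINT \<omega>|M. wt \<eta> (chain a N x t \<omega>)) \<le> B ^ t * wt \<eta> x"
    using wt_growth \<eta> by metis
  \<comment> \<open>The level that \<open>harris_contraction\<close> needs at
    \<open>\<gamma> = 1/2\<close>, where it asks for \<open>2 * \<kappa> < R / 2\<close>.\<close>
  define R where "R = 4 * \<kappa> + 1"
  obtain T \<alpha> \<nu> where T: "T \<ge> 1" and \<alpha>: "\<alpha> > 0" and \<nu>: "prob_space \<nu>" "sets \<nu> = sets borel" and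
    mi: "\<And>x u. wt \<eta> x \<le> R \<Longrightarrow> u \<in> borel_measurable borel \<Longrightarrow>
      ennreal \<alpha> * (\<integral>\<^sup>+y. u y \<partial>\<nu>) \<le> (\<integral>\<^sup>+y. u y \<partial>Pker M N a T x)"
    using minorization_on_compact[OF A2 A3 compact_wt[OF \<eta>(1)], of R] by blast
  have dr: "integrable (Pker M N a T x) (wt \<eta>)" "(LINT y|Pker M N a T x. wt \<eta> y) \<le> 1/2 * wt \<eta> x + \<kappa>" for x
  proof -
    show "integrable (Pker M N a T x) (wt \<eta>)" using \<eta> by (simp add: integrable_Pker_iff)
    have "(1/2::real) ^ T \<le> 1/2" using T power_decreasing[of 1 T "1/2::real"] by simp
    then have "(1/2) ^ T * wt \<eta> x \<le> 1/2 * wt \<eta> x" by (intro mult_right_mono) auto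
    with fo[of x T] have "(LINT \<omega>|M. wt \<eta> (chain a N x T \<omega>)) \<le> 1/2 * wt \<eta> x + \<kappa>" by linarith
    then show "(LINT y|Pker M N a T x. wt \<eta> y) \<le> 1/2 * wt \<eta> x + \<kappa>"
      by (simp flip: Pop_def add: Pop_eq)
  qed
  have "\<exists>\<beta>>0. \<exists>q>0. q < 1 \<and> (\<forall>f\<in>borel_measurable borel. \<forall>L. (\<forall>x y. \<bar>f x - f y\<bar> \<le> L * (2 + \<beta> * wt \<eta> x + \<beta> * wt \<eta> y)) \<longrightarrow>
     (\<forall>x y. \<bar>(LINT z|Pker M N a T x. f z) - (LINT z|Pker M N a T y. f z)\<bar> \<le> q * L * (2 + \<beta> * wt \<eta> x + \<beta> * wt \<eta> y)))"
    by (rule harris_contraction[where \<gamma> = "1/2" and \<kappa> = \<kappa> and R = R and \<alpha> = \<alpha> and \<nu> = \<nu>])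
       (use dr \<alpha> \<nu> mi \<kappa> in \<open>auto simp: prob_space_Pker R_def\<close>)
  then obtain \<beta> q where \<beta>: "\<beta> > 0" and q: "q > 0" "q < 1" and
    con: "\<And>f L x y. f \<in> borel_measurable borel \<Longrightarrow> (\<And>x y. \<bar>f x - f y\<bar> \<le> L * (2 + \<beta> * wt \<eta> x + \<beta> * wt \<eta> y)) \<Longrightarrow>
     \<bar>Pop M N a T f x - Pop M N a T f y\<bar> \<le> q * L * (2 + \<beta> * wt \<eta> x + \<beta> * wt \<eta> y)"
    unfolding Pop_def by metis
  \<comment> \<open>For \<open>t < T\<close> this is the crude growth bound, the division by \<beta>
    converting \<open>wt \<eta>\<close> into the terms \<open>\<beta> * wt \<eta>\<close> of the
    seminorm; each full block of \<open>T\<close> steps contributes a factor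
    \<open>q\<close>.\<close>
  define c where "c t = B ^ T / \<beta> * q ^ (t div T)" for t
  have c0: "c t \<ge> 0" for t using B \<beta> q by (simp add: c_def)
  have iw\<pi>: "integrable \<pi> (wt \<eta>)" using integrable_wt_invariant \<eta> \<pi> by blast
  \<comment> \<open>The bracket absorbs the \<pi>-integral over \<open>y\<close> of
    \<open>2 + \<beta> * wt \<eta> x + \<beta> * wt \<eta> y\<close> into a multiple of
    \<open>wt \<eta> x\<close>, using \<open>wt \<eta> x \<ge> 1\<close>.\<close>
  define u where "u t = c t * (2 + \<beta> + \<beta> * (LINT y|\<pi>. wt \<eta> y))" for t
  have I0: "0 \<le> (LINT y|\<pi>. wt \<eta> y)" by (rule integral_nonneg_AE) simp
  have u0: "u t \<ge> 0" for t unfolding u_def using c0 \<beta> I0 by simp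
  show ?thesis
  proof (rule that)
    show "u t \<ge> 0" for t by (rule u0)
    show "summable u"
      by (rule summable_of_delayed_contraction[where q = q and T = T and e = "\<lambda>_. 0"])
         (use u0 q T in \<open>auto simp: u_def c_def div_add_self2 mult_ac\<close>)
    fix f :: "real^'l \<Rightarrow> real" and L x t
    assume f [measurable]: "f \<in> borel_measurable borel" and L: "\<And>x. \<bar>f x\<bar> \<le> L * wt \<eta> x"
    have "L * wt \<eta> x \<ge> 0" using L[of x] by linarith
    then have L0: "L \<ge> 0" using wt_pos(1)[of \<eta> x] by (simp add: zero_le_mult_iff)
    have fi: "integrable M (\<lambda>\<omega>. f (chain a N x t \<omega>))" for x t
      by (rule integrable_dominated_chain[OF \<eta> f L])
    have osc: "\<bar>Pop M N a t f x - Pop M N a t f y\<bar> \<le> L * c t * (2 + \<beta> * wt \<eta> x + \<beta> * wt \<eta> y)" for t x y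
    proof (induction t arbitrary: x y rule: less_induct)
      case (less t)
      show ?case
      proof (cases "t < T")
        case True
        have "\<bar>Pop M N a t f x\<bar> \<le> L * B ^ T * wt \<eta> x" for x
        proof -
          have "\<bar>Pop M N a t f x\<bar> \<le> (LINT \<omega>|M. L * wt \<eta> (chain a N x t \<omega>))"
            unfolding Pop_eq[OF f]
            by (rule integral_abs_bound[THEN order_trans], rule integral_mono) (use fi \<eta> L in auto)
          also have "\<dots> \<le> L * (B ^ t * wt \<eta> x)" using gr[of x t] L0 \<eta> by (simp add: mult_left_mono)
          also have "\<dots> \<le> L * (B ^ T * wt \<eta> x)"
            using B True L0 by (intro mult_left_mono mult_right_mono power_increasing) auto
          finally show ?thesis by (simp add: mult.assoc)
        qed
        then have "\<bar>Pop M N a t f x - Pop M N a t f y\<bar> \<le> L * B ^ T * wt \<eta> x + L * B ^ T * wt \<eta> y"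
          by (smt (verit, best))
        also have "\<dots> = L * c t * (\<beta> * wt \<eta> x + \<beta> * wt \<eta> y)"
          using True \<beta> by (simp add: c_def field_simps)
        also have "\<dots> \<le> L * c t * (2 + \<beta> * wt \<eta> x + \<beta> * wt \<eta> y)"
          using L0 c0 by (intro mult_left_mono) auto
        finally show ?thesis .
      next
        case False
        then have t: "T + (t - T) = t" by simp
        have "t - T < t" using T False by linarith
        have eq: "Pop M N a t f x = Pop M N a T (Pop M N a (t - T) f) x" for x
          using Pop_add(1)[OF f, of T "t - T" x] fi by (simp add: integrable_Pker_iff t)
        have "q * (L * c (t - T)) = L * c t"
          using False T by (simp add: c_def le_div_geq del: mult_cancel_left)
        moreover have "\<bar>Pop M N a T (Pop M N a (t - T) f) x - Pop M N a T (Pop M N a (t - T) f) y\<bar> \<le>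
            q * (L * c (t - T)) * (2 + \<beta> * wt \<eta> x + \<beta> * wt \<eta> y)"
          by (rule con) (use less[OF \<open>t - T < t\<close>] in auto)
        ultimately show ?thesis unfolding eq by (simp only:)
      qed
    qed
    have fi\<pi>: "integrable \<pi> f"
      by (rule integrable_dominated_invariant[OF \<eta> \<pi> f L])
    note inv = integral_invariant[OF \<pi> f fi\<pi>, of t, folded Pop_eq[OF f]]
    \<comment> \<open>By invariance the \<pi>-mean of \<open>f\<close> is also the \<pi>-mean of its
      iterate.\<close>
    have "Pop M N a t f x - (LINT y|\<pi>. f y) = (LINT y|\<pi>. Pop M N a t f x - Pop M N a t f y)"
      using inv by (simp add: \<pi>.prob_space)
    also have "\<bar>\<dots>\<bar> \<le> (LINT y|\<pi>. L * c t * (2 + \<beta> * wt \<eta> x + \<beta> * wt \<eta> y))"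
      by (rule integral_abs_bound[THEN order_trans], rule integral_mono) (use inv(2) iw\<pi> osc in auto)
    also have "\<dots> = L * c t * (2 + \<beta> * wt \<eta> x + \<beta> * (LINT y|\<pi>. wt \<eta> y))"
      using iw\<pi> by (simp add: \<pi>.prob_space)
    also have "\<dots> \<le> L * c t * ((2 + \<beta> + \<beta> * (LINT y|\<pi>. wt \<eta> y)) * wt \<eta> x)"
    proof (rule mult_left_mono)
      have "1 \<le> wt \<eta> x" using \<eta> by (simp add: wt_ge_1)
      then have "(2 + \<beta> * (LINT y|\<pi>. wt \<eta> y)) * 1 \<le> (2 + \<beta> * (LINT y|\<pi>. wt \<eta> y)) * wt \<eta> x"
        using \<beta> I0 by (intro mult_left_mono) auto
      then show "2 + \<beta> * wt \<eta> x + \<beta> * (LINT y|\<pi>. wt \<eta> y) \<le> (2 + \<beta> + \<beta> * (LINT y|\<pi>. wt \<eta> y)) * wt \<eta> x"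
        by (simp add: algebra_simps)
    qed (use L0 c0 in simp)
    finally show "\<bar>(LINT \<omega>|M. f (chain a N x t \<omega>)) - (LINT y|\<pi>. f y)\<bar> \<le> L * u t * wt \<eta> x"
      by (simp add: Pop_eq u_def mult.assoc)
  qed
qed

section \<open>Sensitivity and gradients\<close>

text \<open>The dominating function moves with \<open>x\<close>, so dominated convergence does not
  apply directly. A cutoff in \<open>V\<close> near \<open>R\<close> leaves a bounded integrand. The
  discarded part is at most \<open>L * exp (- (1 - \<eta>) * R)\<close> times an expectation of
  \<open>wt 1\<close>, which is uniformly small for \<open>x\<close> in a ball, so the expectation
  is a locally uniform limit of continuous functions.\<close>

lemma continuous_expectation_dominated:
  fixes G :: "real^'l \<Rightarrow> 'w \<Rightarrow> real"
  assumes \<eta>: "0 < \<eta>" "\<eta> < 1" and meas [measurable]: "\<And>x. G x \<in> borel_measurable M"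
    and cont: "\<And>\<omega>. continuous_on UNIV (\<lambda>x. G x \<omega>)"
    and bd: "\<And>x \<omega>. \<bar>G x \<omega>\<bar> \<le> L * wt \<eta> (chain a N x t \<omega>)"
  shows "continuous_on UNIV (\<lambda>x. LINT \<omega>|M. G x \<omega>)" and "integrable M (G x)"
proof -
  obtain \<omega>0 where "\<omega>0 \<in> space M" using not_empty by blast
  have "L * wt \<eta> (chain a N 0 t \<omega>0) \<ge> 0" using bd[of 0 \<omega>0] by linarith
  then have L0: "L \<ge> 0" using wt_pos(1)[of \<eta>] by (simp add: zero_le_mult_iff)
  have iw: "integrable M (\<lambda>\<omega>. L * wt \<eta> (chain a N x t \<omega>))" for x using \<eta> by simp
  show int: "integrable M (G x)" for x
    by (rule Bochner_Integration.integrable_bound[OF iw[of x]])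
       (use bd in \<open>auto intro: order_trans[OF _ abs_ge_self]\<close>)
  obtain B where B: "B \<ge> 1" and gr: "\<And>x t. (LINT \<omega>|M. wt 1 (chain a N x t \<omega>)) \<le> B ^ t * wt 1 x"
    using wt_growth zero_less_one order_refl by metis
  define \<psi> where "\<psi> R s = max 0 (min 1 (R + 1 - s))" for R s :: real
  have \<psi>: "0 \<le> \<psi> R s" "\<psi> R s \<le> 1" "s \<le> R \<Longrightarrow> \<psi> R s = 1" "s \<ge> R + 1 \<Longrightarrow> \<psi> R s = 0" for R s
    by (auto simp: \<psi>_def)
  have [measurable]: "V \<in> borel_measurable borel" using V_regularity(2) by (rule borel_measurable_continuous_onI)
  define H where "H R x \<omega> = G x \<omega> * \<psi> R (V (chain a N x t \<omega>))" for R x \<omega>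
  have Hm [measurable]: "H R x \<in> borel_measurable M" for R x unfolding H_def \<psi>_def by measurable
  \<comment> \<open>Where the cutoff is nonzero, \<open>V < R + 1\<close>, so the bound no longer
    depends on \<open>x\<close>.\<close>
  have Hb: "\<bar>H R x \<omega>\<bar> \<le> L * exp (\<eta> * (R + 1))" for R x \<omega>
  proof (cases "V (chain a N x t \<omega>) \<ge> R + 1")
    case True
    then show ?thesis using L0 by (simp add: H_def \<psi>)
  next
    case False
    have "\<bar>H R x \<omega>\<bar> \<le> (L * wt \<eta> (chain a N x t \<omega>)) * 1"
      unfolding H_def abs_mult using bd[of x \<omega>] \<psi>[of R "V (chain a N x t \<omega>)"] by (intro mult_mono) auto
    also have "\<dots> \<le> L * exp (\<eta> * (R + 1))"
      using False L0 \<eta> by (auto simp: wt_def intro!: mult_left_mono)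
    finally show ?thesis .
  qed
  have Hi: "integrable M (H R x)" for R x by (rule integrable_const_bound[of _ "L * exp (\<eta> * (R + 1))"]) (use Hb in auto)
  have Hc: "continuous_on UNIV (\<lambda>x. LINT \<omega>|M. H R x \<omega>)" for R
  proof -
    have "continuous_on UNIV (\<lambda>x. H R x \<omega>)" for \<omega>
      unfolding H_def \<psi>_def
      by (intro continuous_intros cont continuous_on_compose2[OF V_regularity(2)] chain_continuous) auto
    then show ?thesis
      unfolding continuous_on_sequentially using Hb
      by (auto intro!: integral_dominated_convergence[where w = "\<lambda>_. L * exp (\<eta> * (R + 1))"] simp: comp_def)
  qed
  have diff: "\<bar>(LINT \<omega>|M. H R x \<omega>) - (LINT \<omega>|M. G x \<omega>)\<bar> \<le> L * exp (- (1 - \<eta>) * R) * (B ^ t * wt 1 x)" for R x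
  proof -
    have pt: "\<bar>H R x \<omega> - G x \<omega>\<bar> \<le> L * exp (- (1 - \<eta>) * R) * wt 1 (chain a N x t \<omega>)" for \<omega>
    proof (cases "V (chain a N x t \<omega>) \<le> R")
      case True
      then show ?thesis using L0 by (simp add: H_def \<psi>)
    next
      case False
      have "\<bar>H R x \<omega> - G x \<omega>\<bar> = \<bar>G x \<omega>\<bar> * (1 - \<psi> R (V (chain a N x t \<omega>)))"
      proof -
        have "H R x \<omega> - G x \<omega> = - (G x \<omega> * (1 - \<psi> R (V (chain a N x t \<omega>))))"
          by (simp add: H_def algebra_simps)
        then show ?thesis by (simp add: abs_mult \<psi>)
      qed
      also have "\<dots> \<le> (L * wt \<eta> (chain a N x t \<omega>)) * 1"
        using bd[of x \<omega>] \<psi>[of R "V (chain a N x t \<omega>)"] by (intro mult_mono) auto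
      also have "wt \<eta> (chain a N x t \<omega>) \<le> exp (- (1 - \<eta>) * R) * wt 1 (chain a N x t \<omega>)"
      proof -
        have "(1 - \<eta>) * R \<le> (1 - \<eta>) * V (chain a N x t \<omega>)" using False \<eta> by (intro mult_left_mono) auto
        then show ?thesis by (simp add: wt_def exp_add[symmetric] algebra_simps)
      qed
      finally show ?thesis using L0 by (simp add: mult_left_mono mult.assoc)
    qed
    have "\<bar>(LINT \<omega>|M. H R x \<omega>) - (LINT \<omega>|M. G x \<omega>)\<bar> = \<bar>LINT \<omega>|M. H R x \<omega> - G x \<omega>\<bar>"
      using Hi int by simp
    also have "\<dots> \<le> (LINT \<omega>|M. L * exp (- (1 - \<eta>) * R) * wt 1 (chain a N x t \<omega>))"
      by (rule integral_abs_bound[THEN order_trans], rule integral_mono) (use Hi int pt in auto)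
    also have "\<dots> \<le> L * exp (- (1 - \<eta>) * R) * (B ^ t * wt 1 x)"
      using gr[of x t] L0 by (simp add: mult_left_mono)
    finally show ?thesis .
  qed
  have "continuous (at x) (\<lambda>x. LINT \<omega>|M. G x \<omega>)" for x
  proof -
    have "bounded (wt 1 ` cball x 1)"
      by (intro compact_imp_bounded compact_continuous_image wt_continuous compact_cball)
    then obtain m where m: "m > 0" "\<And>y. y \<in> cball x 1 \<Longrightarrow> wt 1 y \<le> m"
      unfolding bounded_pos by (auto simp: abs_le_iff)
    have "uniform_limit (cball x 1) (\<lambda>n y. LINT \<omega>|M. H (real n) y \<omega>) (\<lambda>y. LINT \<omega>|M. G y \<omega>) sequentially"
    proof (rule uniform_limitI)
      fix e :: real assume "e > 0"
      have "(\<lambda>n. L * exp (- (1 - \<eta>) * real n) * (B ^ t * m)) \<longlonglongrightarrow> L * 0 * (B ^ t * m)"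
      proof (intro tendsto_intros)
        have "(\<lambda>n. exp (- (1 - \<eta>)) ^ n) \<longlonglongrightarrow> 0" using \<eta> by (intro LIMSEQ_realpow_zero) auto
        then show "(\<lambda>n. exp (- (1 - \<eta>) * real n)) \<longlonglongrightarrow> 0"
          by (simp only: exp_of_nat2_mult)
      qed
      then have "\<forall>\<^sub>F n in sequentially. L * exp (- (1 - \<eta>) * real n) * (B ^ t * m) < e"
        using \<open>e > 0\<close> by (intro order_tendstoD(2)[where y = "L * 0 * (B ^ t * m)"]) auto
      then show "\<forall>\<^sub>F n in sequentially. \<forall>y\<in>cball x 1. dist (LINT \<omega>|M. H (real n) y \<omega>) (LINT \<omega>|M. G y \<omega>) < e"
      proof eventually_elim
        case (elim n)
        show ?case
        proof
          fix y assume "y \<in> cball x 1"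
          then have "L * exp (- (1 - \<eta>) * real n) * (B ^ t * wt 1 y) \<le> L * exp (- (1 - \<eta>) * real n) * (B ^ t * m)"
            using L0 B m by (intro mult_left_mono) auto
          with diff[of "real n" y] elim show "dist (LINT \<omega>|M. H (real n) y \<omega>) (LINT \<omega>|M. G y \<omega>) < e"
            unfolding dist_real_def by linarith
        qed
      qed
    qed
    then have "continuous_on (cball x 1) (\<lambda>y. LINT \<omega>|M. G y \<omega>)"
      by (rule uniform_limit_theorem[rotated])
         (auto intro!: always_eventually continuous_on_subset[OF Hc])
    then show ?thesis by (rule continuous_on_interior) simp
  qed
  then show "continuous_on UNIV (\<lambda>x. LINT \<omega>|M. G x \<omega>)" by (simp add: continuous_at_imp_continuous_on)
qed

text \<open>A1 bounds the entries of the Jacobian uniformly in the noise, so the Lipschitz constant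
  is deterministic.\<close>

lemma a_lipschitz:
  obtains K where "K \<ge> 1" "\<And>x y n. norm (a x n - a y n) \<le> K * norm (x - y)"
proof -
  have cd: "cont_differentiable (\<lambda>x. a x n)" for n using A1 by (simp add: A1_def)
  from A1 obtain K0 where K0: "K0 > 0" "\<And>x n. norm (grad_x a x n) \<le> K0"
    unfolding A1_def bounded_pos by auto
  define K where "K = max 1 (real CARD('l) * (real CARD('l) * K0))"
  have "norm (a x n - a y n) \<le> K * norm (x - y)" for x y n
  proof -
    obtain D where D: "\<And>x. ((\<lambda>x. a x n) has_derivative blinfun_apply (D x)) (at x)"
      using cd[of n] unfolding cont_differentiable_def by blast
    have e: "\<bar>D z (axis i 1) $ j\<bar> \<le> K0" for z i j
    proof -
      have "((\<lambda>x. a x n $ j) has_derivative (\<lambda>v. D z v $ j)) (at z)"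
        using D[of z] by (rule bounded_linear.has_derivative[OF bounded_linear_vec_nth])
      then have "D z (axis i 1) $ j = grad_x a z n $ i $ j"
        using has_partial_of_derivative(2) by (fastforce simp: grad_x_def)
      also have "\<bar>\<dots>\<bar> \<le> K0"
        using component_le_norm_cart[of "grad_x a z n $ i" j] Finite_Cartesian_Product.norm_nth_le[of "grad_x a z n" i] K0(2)[of z n]
        by linarith
      finally show ?thesis .
    qed
    have "norm (D z v) \<le> K * norm v" for z v
    proof -
      have "norm (D z v) \<le> real CARD('l) * (real CARD('l) * K0) * norm v"
        by (rule linear_norm_le_of_entries[where D = "blinfun_apply (D z)", OF _ e])
           (use K0 in \<open>auto intro: bounded_linear.linear blinfun.bounded_linear_right\<close>)
      also have "\<dots> \<le> K * norm v" unfolding K_def by (intro mult_right_mono) auto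
      finally show ?thesis .
    qed
    then have "onorm (blinfun_apply (D z)) \<le> K" for z by (intro onorm_le) auto
    then show ?thesis
      by (intro differentiable_bound[OF convex_UNIV, where f' = "\<lambda>x. blinfun_apply (D x)"])
         (auto intro: has_derivative_at_withinI D)
  qed
  then show ?thesis by (intro that[of K]) (auto simp: K_def)
qed

lemma chain_lipschitz:
  obtains K where "K \<ge> 1" "\<And>x y t \<omega>. norm (chain a N x t \<omega> - chain a N y t \<omega>) \<le> K ^ t * norm (x - y)"
proof -
  obtain K where K: "K \<ge> 1" "\<And>x y n. norm (a x n - a y n) \<le> K * norm (x - y)" by (rule a_lipschitz) blast
  have "norm (chain a N x t \<omega> - chain a N y t \<omega>) \<le> K ^ t * norm (x - y)" for x y t \<omega>
  proof (induction t)
    case (Suc t)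
    have "norm (chain a N x (Suc t) \<omega> - chain a N y (Suc t) \<omega>) \<le> K * norm (chain a N x t \<omega> - chain a N y t \<omega>)"
      using K(2) by simp
    also have "\<dots> \<le> K * (K ^ t * norm (x - y))" using Suc K by (intro mult_left_mono) auto
    finally show ?case by (simp add: mult.assoc)
  qed simp
  with K(1) show ?thesis by (rule that)
qed

lemma chain_cont_differentiable: "cont_differentiable (\<lambda>x. chain a N x t \<omega>)"
proof (induction t)
  case 0
  show ?case by (simp add: cont_differentiable_id)
next
  case (Suc t)
  have "cont_differentiable (\<lambda>x. a x (N (Suc t) \<omega>))" using A1 by (simp add: A1_def)
  from cont_differentiable_compose[OF this Suc] show ?case by simp
qed

lemma Linf_wt_iff: "f \<in> Linf (wt \<eta>) \<longleftrightarrow> f \<in> borel_measurable borel \<and> (\<exists>L\<ge>0. \<forall>x. \<bar>f x\<bar> \<le> L * wt \<eta> x)"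
proof -
  have "(\<bar>f x\<bar> / wt \<eta> x \<le> L) \<longleftrightarrow> \<bar>f x\<bar> \<le> L * wt \<eta> x" for x L by (simp add: pos_divide_le_eq)
  moreover have "L \<ge> 0" if "\<forall>x. \<bar>f x\<bar> \<le> L * wt \<eta> x" for L
    using that[rule_format, of 0] wt_pos(1)[of \<eta> 0] by (smt (verit) mult_nonpos_nonneg abs_ge_zero mult_neg_pos)
  ultimately show ?thesis unfolding Linf_def bdd_above_def by auto
qed

lemma Linf1_wtD:
  assumes "f \<in> Linf1 (wt \<eta>)"
  shows "f \<in> borel_measurable borel" "continuous_on UNIV f" "has_partial i f x" "continuous_on UNIV (partial i f)"
    and "\<exists>L\<ge>0. \<forall>x. \<bar>f x\<bar> \<le> L * wt \<eta> x" "\<exists>A\<ge>0. \<forall>x. norm (grad f x) \<le> A * wt \<eta> x"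
proof -
  show "f \<in> borel_measurable borel" "continuous_on UNIV f" "has_partial i f x" "continuous_on UNIV (partial i f)"
    "\<exists>L\<ge>0. \<forall>x. \<bar>f x\<bar> \<le> L * wt \<eta> x"
    using assms unfolding Linf1_def Linf0_def Linf_wt_iff by auto
  have "\<forall>i. \<exists>L\<ge>0. \<forall>x. \<bar>partial i f x\<bar> \<le> L * wt \<eta> x"
    using assms unfolding Linf1_def Linf0_def Linf_wt_iff by auto
  then obtain L where L: "\<And>i. L i \<ge> 0" "\<And>i x. \<bar>partial i f x\<bar> \<le> L i * wt \<eta> x" by metis
  have "norm (grad f x) \<le> (\<Sum>i\<in>UNIV. L i) * wt \<eta> x" for x
  proof -
    have "norm (grad f x) \<le> (\<Sum>i\<in>UNIV. \<bar>grad f x $ i\<bar>)" by (rule norm_le_l1_cart)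
    also have "\<dots> \<le> (\<Sum>i\<in>UNIV. L i * wt \<eta> x)" by (intro sum_mono) (simp add: grad_def L)
    finally show ?thesis by (simp add: sum_distrib_right)
  qed
  then show "\<exists>A\<ge>0. \<forall>x. norm (grad f x) \<le> A * wt \<eta> x" using L(1) by (intro exI[of _ "\<Sum>i\<in>UNIV. L i"]) (auto intro: sum_nonneg)
qed

lemma Linf1_wtI:
  assumes "continuous_on UNIV f" "\<And>i x. has_partial i f x" "\<And>i. continuous_on UNIV (partial i f)"
    and L: "\<And>x. \<bar>f x\<bar> \<le> L * wt \<eta> x" and A: "\<And>x. norm (grad f x) \<le> A * wt \<eta> x"
  shows "f \<in> Linf1 (wt \<eta>)"
proof -
  have b: "\<exists>L\<ge>0. \<forall>x. \<bar>g x\<bar> \<le> L * wt \<eta> x" if "\<And>x. \<bar>g x\<bar> \<le> L * wt \<eta> x" for g :: "real^'l \<Rightarrow> real" and L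
  proof (intro exI[of _ "max L 0"] conjI allI)
    fix x
    have "L * wt \<eta> x \<le> max L 0 * wt \<eta> x" by (intro mult_right_mono) auto
    with that[of x] show "\<bar>g x\<bar> \<le> max L 0 * wt \<eta> x" by linarith
  qed simp
  have "\<bar>partial i f x\<bar> \<le> A * wt \<eta> x" for i x
    using component_le_norm_cart[of "grad f x" i] A[of x] by (simp add: grad_def)
  from b[OF L] b[OF this] show ?thesis using assms unfolding Linf1_def Linf0_def Linf_wt_iff
    by (auto simp: borel_measurable_continuous_onI)
qed

text \<open>The transposed sensitivity matrix applied to the gradient is the chain rule for
  \<open>f\<close> composed with the flow map of a fixed noise realisation; coordinate
  \<open>j\<close> is the derivative in direction \<open>j\<close>.\<close>

lemma chain_directional_derivative:
  assumes hp: "\<And>i x. has_partial i f x" and cp: "\<And>i. continuous_on UNIV (partial i f)"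
  shows "((\<lambda>s. f (chain a N (x + s *\<^sub>R axis j 1) t \<omega>)) has_real_derivative
      (transpose (sens a N (x + s *\<^sub>R axis j 1) t \<omega>) *v grad f (chain a N (x + s *\<^sub>R axis j 1) t \<omega>)) $ j) (at s)"
    and "continuous_on UNIV (\<lambda>x. (transpose (sens a N x t \<omega>) *v grad f (chain a N x t \<omega>)) $ j)"
proof -
  obtain D where D: "\<And>x. ((\<lambda>x. chain a N x t \<omega>) has_derivative blinfun_apply (D x)) (at x)" "continuous_on UNIV D"
    using chain_cont_differentiable[of t \<omega>] unfolding cont_differentiable_def by blast
  have s: "sens a N x t \<omega> $ i $ j = D x (axis j 1) $ i" for x i j
    using has_partial_of_derivative(2)[OF bounded_linear.has_derivative[OF bounded_linear_vec_nth D(1)]]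
    by (simp add: sens_def)
  have eq: "(transpose (sens a N x t \<omega>) *v g) $ j = g \<bullet> D x (axis j 1)" for x j g
    by (simp add: matrix_vector_mult_def transpose_def inner_vec_def s mult.commute)
  have "((\<lambda>x. f (chain a N x t \<omega>)) has_derivative (\<lambda>v. grad f (chain a N x t \<omega>) \<bullet> D x v)) (at x)" for x
    using has_derivative_compose[OF D(1) has_derivative_of_partials[OF hp cp]] .
  note hd = has_partial_of_derivative[OF this]
  show "((\<lambda>s. f (chain a N (x + s *\<^sub>R axis j 1) t \<omega>)) has_real_derivative
      (transpose (sens a N (x + s *\<^sub>R axis j 1) t \<omega>) *v grad f (chain a N (x + s *\<^sub>R axis j 1) t \<omega>)) $ j) (at s)"
    using partial_DERIV[OF hd(1)] unfolding hd(2) eq .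
  have "continuous_on UNIV (\<lambda>x. grad f (chain a N x t \<omega>))"
    unfolding grad_def by (intro continuous_on_vec_lambda continuous_on_compose2[OF cp] chain_continuous) auto
  then show "continuous_on UNIV (\<lambda>x. (transpose (sens a N x t \<omega>) *v grad f (chain a N x t \<omega>)) $ j)"
    unfolding eq using D(2) by (intro continuous_intros)
qed

text \<open>Column \<open>j\<close> of the sensitivity matrix is a limit of difference quotients of
  the path, each bounded by the Lipschitz constant \<open>K ^ t\<close> of the flow map. Hence the
  bound is deterministic, though exponential in \<open>t\<close>.\<close>

lemma sens_bound:
  obtains K where "K \<ge> 1" "\<And>x t \<omega> g j. \<bar>(transpose (sens a N x t \<omega>) *v g) $ j\<bar> \<le> K ^ t * norm g"
proof -
  obtain K where K: "K \<ge> 1" and lip: "\<And>x y t \<omega>. norm (chain a N x t \<omega> - chain a N y t \<omega>) \<le> K ^ t * norm (x - y)"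
    by (rule chain_lipschitz) blast
  have "\<bar>(transpose (sens a N x t \<omega>) *v g) $ j\<bar> \<le> K ^ t * norm g" for x t \<omega> g j
  proof -
    let ?S = "\<chi> i. sens a N x t \<omega> $ i $ j"
    let ?q = "\<lambda>s::real. (1 / s) *\<^sub>R (chain a N (x + s *\<^sub>R axis j 1) t \<omega> - chain a N x t \<omega>)"
    have "(?q \<longlongrightarrow> ?S) (at 0)"
    proof (rule vec_tendstoI)
      fix i
      have "has_partial j (\<lambda>x. chain a N x t \<omega> $ i) x"
        by (rule cont_differentiable_partials(1)[OF cont_differentiable_component[OF chain_cont_differentiable]])
      from partial_DERIV0[OF this] show "((\<lambda>s. ?q s $ i) \<longlongrightarrow> ?S $ i) (at 0)"
        by (simp add: DERIV_def sens_def)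
    qed
    then have "((\<lambda>s. norm (?q s)) \<longlongrightarrow> norm ?S) (at 0)" by (rule tendsto_norm)
    moreover have "\<forall>\<^sub>F s in at 0. norm (?q s) \<le> K ^ t"
    proof (rule eventually_mono[OF eventually_at_ball'[of 1 0 UNIV]])
      fix s :: real assume "s \<in> ball 0 1 \<and> s \<noteq> 0 \<and> s \<in> UNIV"
      then show "norm (?q s) \<le> K ^ t"
        using lip[of "x + s *\<^sub>R axis j 1" t \<omega> x] by (simp add: divide_le_eq norm_axis_1)
    qed simp
    ultimately have "norm ?S \<le> K ^ t" by (rule tendsto_upperbound) simp
    moreover have "(transpose (sens a N x t \<omega>) *v g) $ j = ?S \<bullet> g"
      by (simp add: matrix_vector_mult_def transpose_def inner_vec_def)
    ultimately show ?thesis using Cauchy_Schwarz_ineq2[of ?S g] mult_right_mono[of "norm ?S" "K ^ t" "norm g"] by simp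
  qed
  with K show ?thesis by (rule that)
qed

text \<open>The entries are partial derivatives; along the steps \<open>1 / (n + 1)\<close> they are
  limits of measurable difference quotients.\<close>

lemma sens_measurable [measurable (raw)]:
  assumes [measurable]: "f \<in> borel_measurable A" "g \<in> A \<rightarrow>\<^sub>M M"
  shows "(\<lambda>z. sens a N (f z) t (g z) $ i $ j) \<in> borel_measurable A"
proof (rule borel_measurable_LIMSEQ_real)
  let ?q = "\<lambda>n z. (chain a N (f z + (1 / real (Suc n)) *\<^sub>R axis j 1) t (g z) $ i - chain a N (f z) t (g z) $ i) / (1 / real (Suc n))"
  have [measurable]: "(\<lambda>x::real^'l. x $ i) \<in> borel_measurable borel" by simp
  show "?q n \<in> borel_measurable A" for n by simp
  fix z
  let ?F = "\<lambda>x. chain a N x t (g z) $ i"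
  have "has_partial j ?F (f z)"
    by (rule cont_differentiable_partials(1)[OF cont_differentiable_component[OF chain_cont_differentiable]])
  from partial_DERIV0[OF this]
  have "((\<lambda>h. (?F (f z + h *\<^sub>R axis j 1) - ?F (f z)) / h) \<longlongrightarrow> partial j ?F (f z)) (at 0)"
    by (simp add: DERIV_def)
  then have "(\<lambda>n. (?F (f z + (1 / real (Suc n)) *\<^sub>R axis j 1) - ?F (f z)) / (1 / real (Suc n))) \<longlonglongrightarrow> partial j ?F (f z)"
    by (rule filterlim_compose)
       (auto simp: filterlim_at intro!: lim_1_over_n[THEN LIMSEQ_Suc, simplified] always_eventually)
  then show "(\<lambda>n. ?q n z) \<longlonglongrightarrow> sens a N (f z) t (g z) $ i $ j" by (simp add: sens_def)
qed

text \<open>The increment of \<open>P\<^sup>t f\<close> along a coordinate line is, by Fubini, the integral of the expected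
  pathwise derivative; that integrand is continuous, so the fundamental theorem of calculus applies.\<close>

lemma gradient_Pop:
  assumes \<eta>: "0 < \<eta>" "\<eta> < 1" and f: "f \<in> Linf1 (wt \<eta>)"
  shows "integrable M (\<lambda>\<omega>. (transpose (sens a N x t \<omega>) *v grad f (chain a N x t \<omega>)) $ j)"
    and "has_partial j (Pop M N a t f) x"
    and "partial j (Pop M N a t f) x = (LINT \<omega>|M. (transpose (sens a N x t \<omega>) *v grad f (chain a N x t \<omega>)) $ j)"
    and "continuous_on UNIV (partial j (Pop M N a t f))"
proof -
  note fD = Linf1_wtD[OF f]
  note [measurable] = fD(1)
  obtain A where A: "A \<ge> 0" "\<And>x. norm (grad f x) \<le> A * wt \<eta> x" using fD(6) by blast
  obtain L where L: "L \<ge> 0" "\<And>x. \<bar>f x\<bar> \<le> L * wt \<eta> x" using fD(5) by blast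
  obtain K where K: "K \<ge> 1" and sb: "\<And>x t \<omega> g j. \<bar>(transpose (sens a N x t \<omega>) *v g) $ j\<bar> \<le> K ^ t * norm g"
    by (rule sens_bound) blast
  define G where "G x \<omega> = (transpose (sens a N x t \<omega>) *v grad f (chain a N x t \<omega>)) $ j" for x \<omega>
  have [measurable]: "partial i f \<in> borel_measurable borel" for i
    by (rule borel_measurable_continuous_onI[OF fD(4)])
  have Gm [measurable (raw)]: "(\<lambda>z. G (g1 z) (g2 z)) \<in> borel_measurable A"
    if [measurable]: "g1 \<in> borel_measurable A" "g2 \<in> A \<rightarrow>\<^sub>M M" for A :: "(real \<times> 'w) measure" and g1 g2
    unfolding G_def matrix_vector_mult_def transpose_def grad_def by simp
  have Gm1: "G x \<in> borel_measurable M" for x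
    unfolding G_def[abs_def] matrix_vector_mult_def transpose_def grad_def by simp
  have Gb: "\<bar>G x \<omega>\<bar> \<le> K ^ t * A * wt \<eta> (chain a N x t \<omega>)" for x \<omega>
  proof -
    have "\<bar>G x \<omega>\<bar> \<le> K ^ t * norm (grad f (chain a N x t \<omega>))" unfolding G_def by (rule sb)
    also have "\<dots> \<le> K ^ t * (A * wt \<eta> (chain a N x t \<omega>))" using K A by (intro mult_left_mono) auto
    finally show ?thesis by (simp add: mult.assoc)
  qed
  have Gc: "continuous_on UNIV (\<lambda>x. G x \<omega>)" for \<omega>
    unfolding G_def by (rule chain_directional_derivative(2)) (use fD in auto)
  note G = continuous_expectation_dominated[OF \<eta> Gm1 Gc Gb]
  show "integrable M (\<lambda>\<omega>. (transpose (sens a N x t \<omega>) *v grad f (chain a N x t \<omega>)) $ j)"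
    using G(2)[of x] by (simp add: G_def[abs_def])
  define g where "g x = (LINT \<omega>|M. G x \<omega>)" for x
  have gc: "continuous_on UNIV g" unfolding g_def by (rule G(1))
  have fi: "integrable M (\<lambda>\<omega>. f (chain a N x t \<omega>))" for x
    by (rule integrable_dominated_chain[OF \<eta>(1) less_imp_le[OF \<eta>(2)] fD(1) L(2)])
  obtain B where B: "B \<ge> 1" and gr: "\<And>x t. (LINT \<omega>|M. wt \<eta> (chain a N x t \<omega>)) \<le> B ^ t * wt \<eta> x"
    using wt_growth \<eta> less_imp_le by metis
  have D: "((\<lambda>s. Pop M N a t f (x + s *\<^sub>R axis j 1)) has_real_derivative g x) (at 0)" for x
  proof -
    let ?x = "\<lambda>s. x + s *\<^sub>R axis j 1"
    let ?g = "\<lambda>s. g (?x s)"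
    have gxc: "continuous_on S ?g" for S
      by (rule continuous_on_compose2[OF gc]) (auto intro!: continuous_intros)
    \<comment> \<open>An antiderivative of the candidate derivative: it suffices that the iterate of
      \<open>f\<close> along the line differs from \<open>F\<close> by a constant.\<close>
    obtain F where F: "\<And>s. s \<in> {-1..1} \<Longrightarrow> (F has_vector_derivative ?g s) (at s within {-1..1})"
      using antiderivative_continuous[OF gxc[of "{-1..1}"]] by metis
    \<comment> \<open>Increments start at the left end -1, so that the intervals
      \<open>{-1..s}\<close> reach parameters on both sides of 0.\<close>
    have inc: "Pop M N a t f (?x s) - Pop M N a t f (?x (-1)) = F s - F (-1)" if s: "s \<in> {-1..1}" for s
    proof -
      interpret pair_sigma_finite lborel M ..
      let ?h = "\<lambda>u \<omega>. indicator {-1..s} u *\<^sub>R G (?x u) \<omega>"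
      have hm [measurable]: "case_prod ?h \<in> borel_measurable (lborel \<Otimes>\<^sub>M M)"
        unfolding case_prod_beta' by measurable
      \<comment> \<open>A bound for the weight on the segment makes the double integral absolutely
        convergent.\<close>
      have "bounded ((\<lambda>u. wt \<eta> (?x u)) ` {-1..s})"
        by (intro compact_imp_bounded compact_continuous_image continuous_on_compose2[OF wt_continuous[of UNIV]])
           (auto intro!: continuous_intros)
      then obtain m where m: "m > 0" "\<And>u. u \<in> {-1..s} \<Longrightarrow> wt \<eta> (?x u) \<le> m"
        unfolding bounded_pos by (auto simp: abs_le_iff)
      have "integrable (lborel \<Otimes>\<^sub>M M) (case_prod ?h)"
      proof (rule Fubini_integrable)
        show "integrable lborel (\<lambda>u. LINT \<omega>|M. norm (case_prod ?h (u, \<omega>)))"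
        proof (rule Bochner_Integration.integrable_bound)
          show "integrable lborel (\<lambda>u. indicator {-1..s} u *\<^sub>R (K ^ t * A * (B ^ t * m)))"
            by (intro integrable_scaleR_left integrable_real_indicator) (auto simp: emeasure_lborel_Icc_eq)
          show "AE u in lborel. norm (LINT \<omega>|M. norm (case_prod ?h (u, \<omega>))) \<le>
              norm (indicator {-1..s} u *\<^sub>R (K ^ t * A * (B ^ t * m)))"
          proof (rule AE_I2)
            fix u
            show "norm (LINT \<omega>|M. norm (case_prod ?h (u, \<omega>))) \<le> norm (indicator {-1..s} u *\<^sub>R (K ^ t * A * (B ^ t * m)))"
            proof (cases "u \<in> {-1..s}")
              case True
              have "(LINT \<omega>|M. \<bar>G (?x u) \<omega>\<bar>) \<le> (LINT \<omega>|M. K ^ t * A * wt \<eta> (chain a N (?x u) t \<omega>))"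
                by (rule integral_mono) (use G(2) \<eta> Gb in auto)
              also have "\<dots> \<le> K ^ t * A * (B ^ t * wt \<eta> (?x u))"
                using gr[of "?x u" t] K A by (simp add: mult_left_mono)
              also have "\<dots> \<le> K ^ t * A * (B ^ t * m)"
                using m(2)[OF True] K A B by (intro mult_left_mono) auto
              finally have "(LINT \<omega>|M. \<bar>G (?x u) \<omega>\<bar>) \<le> K ^ t * A * (B ^ t * m)" .
              moreover have "(LINT \<omega>|M. \<bar>G (?x u) \<omega>\<bar>) \<ge> 0" by (rule integral_nonneg_AE) simp
              ultimately show ?thesis using True by simp
            qed simp
          qed
        qed measurable
        show "AE u in lborel. integrable M (\<lambda>\<omega>. case_prod ?h (u, \<omega>))" using G(2) by simp
      qed (rule hm)
      from Fubini_integral[OF this]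
      have fub: "(LINT \<omega>|M. LINT u|lborel. ?h u \<omega>) = (LINT u|lborel. LINT \<omega>|M. ?h u \<omega>)" .
      \<comment> \<open>For a fixed noise realisation, integrating the pathwise derivative recovers
        the increment between the two end parameters.\<close>
      have l: "(LINT u|lborel. ?h u \<omega>) = f (chain a N (?x s) t \<omega>) - f (chain a N (?x (-1)) t \<omega>)" for \<omega>
      proof -
        have "(LINT u|lborel. G (?x u) \<omega> * indicator {-1..s} u) = f (chain a N (?x s) t \<omega>) - f (chain a N (?x (-1)) t \<omega>)"
        proof (rule integral_FTC_Icc_real)
          show "DERIV (\<lambda>u. f (chain a N (?x u) t \<omega>)) u :> G (?x u) \<omega>" for u
            unfolding G_def by (rule chain_directional_derivative(1)) (use fD in auto)
          have "continuous_on UNIV (\<lambda>u. G (?x u) \<omega>)"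
            by (rule continuous_on_compose2[OF Gc]) (auto intro!: continuous_intros)
          then show "isCont (\<lambda>u. G (?x u) \<omega>) u" for u by (simp add: continuous_on_eq_continuous_at)
        qed (use s in auto)
        then show ?thesis by (simp add: mult.commute)
      qed
      have "(LINT u|lborel. indicator {-1..s} u *\<^sub>R ?g u) = F s - F (-1)"
      proof (rule integral_FTC_Icc)
        show "(F has_vector_derivative ?g u) (at u within {-1..s})" if "-1 \<le> u" "u \<le> s" for u
          by (rule has_vector_derivative_within_subset[OF F]) (use s that in auto)
      qed (use s gxc in auto)
      moreover have "(LINT \<omega>|M. ?h u \<omega>) = indicator {-1..s} u *\<^sub>R ?g u" for u by (simp add: g_def)
      moreover have "(LINT \<omega>|M. LINT u|lborel. ?h u \<omega>) = Pop M N a t f (?x s) - Pop M N a t f (?x (-1))"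
        unfolding l using fi by (simp add: Pop_eq)
      ultimately show ?thesis using fub by (simp only:)
    qed
    have "(F has_real_derivative ?g 0) (at 0 within {-1..1})"
      using F[of 0] by (simp add: has_real_derivative_iff_has_vector_derivative)
    moreover have "at (0::real) within {-1..1} = at 0" by (rule at_within_Icc_at) auto
    ultimately have "(F has_real_derivative ?g 0) (at 0)" by (simp only:)
    then have "((\<lambda>s. F s + (Pop M N a t f (?x (-1)) - F (-1))) has_real_derivative ?g 0) (at 0)"
      by (auto intro!: derivative_eq_intros)
    then have "((\<lambda>s. Pop M N a t f (?x s)) has_real_derivative ?g 0) (at 0)"
    proof (rule has_field_derivative_transform_within_open[of _ _ _ "{-1<..<1}"])
      fix s :: real assume "s \<in> {-1<..<1}"
      then show "F s + (Pop M N a t f (?x (-1)) - F (-1)) = Pop M N a t f (?x s)"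
        using inc[of s] by simp
    qed auto
    then show ?thesis by simp
  qed
  show "has_partial j (Pop M N a t f) x" using has_partialI(1)[OF D] .
  have p: "partial j (Pop M N a t f) x = g x" for x using has_partialI(2)[OF D] .
  then show "partial j (Pop M N a t f) x = (LINT \<omega>|M. (transpose (sens a N x t \<omega>) *v grad f (chain a N x t \<omega>)) $ j)"
    by (simp add: g_def G_def)
  have "partial j (Pop M N a t f) = g" by (rule ext) (rule p)
  then show "continuous_on UNIV (partial j (Pop M N a t f))" by (simp only: gc)
qed

section \<open>Smoothing and the Lasota-Yorke inequality\<close>

text \<open>The cutoff is taken in \<open>V\<close> and not in the norm, so that
  \<open>1 - \<xi>\<close> lives on \<open>V > R\<close>, where \<open>wt \<eta>\<close> is small
  against \<open>wt 1\<close>. Its gradient vanishes off a compact sublevel set and is therefore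
  bounded, by a constant depending on \<open>R\<close>.\<close>

lemma V_cutoff:
  obtains \<xi> C where "\<And>x. 0 \<le> \<xi> x" "\<And>x. \<xi> x \<le> 1" "\<And>x. V x \<le> R \<Longrightarrow> \<xi> x = 1" "\<And>x. V x \<ge> R + 1 \<Longrightarrow> \<xi> x = 0"
    "\<And>i x. has_partial i \<xi> x" "\<And>i. continuous_on UNIV (partial i \<xi>)" "continuous_on UNIV \<xi>"
    "C \<ge> 0" "\<And>x. norm (grad \<xi> x) \<le> C"
proof -
  obtain d where d: "continuous_on UNIV d" "\<And>u. u \<ge> 1 \<Longrightarrow> d u = 0" "\<And>u. (bump has_real_derivative d u) (at u)"
    using bump_properties(5) by blast
  define \<xi> where "\<xi> x = bump (V x - R)" for x
  have db: "((\<lambda>v. bump (v - R)) has_real_derivative d (v - R)) (at v)" for v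
  proof -
    have "((\<lambda>v. v - R) has_real_derivative 1) (at v)" by (auto intro!: derivative_eq_intros)
    from DERIV_chain2[where f = bump, OF d(3) this] show ?thesis by simp
  qed
  have hV: "has_partial i V x" "continuous_on UNIV (partial i V)" for i x
    using cont_differentiable_partials[OF V_regularity(3)] by auto
  have p: "has_partial i \<xi> x" "partial i \<xi> x = d (V x - R) * partial i V x" for i x
    using partial_compose[OF hV(1) db] by (auto simp: \<xi>_def[abs_def])
  have pe: "partial i \<xi> = (\<lambda>x. d (V x - R) * partial i V x)" for i using p(2) by blast
  have pc: "continuous_on UNIV (partial i \<xi>)" for i
    unfolding pe by (intro continuous_intros hV(2) continuous_on_compose2[OF d(1)] V_regularity(2)) auto
  have "continuous_on UNIV bump" using d(3) by (meson DERIV_isCont continuous_at_imp_continuous_on)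
  then have \<xi>c: "continuous_on UNIV \<xi>"
    unfolding \<xi>_def[abs_def] by (rule continuous_on_compose2) (auto intro!: continuous_intros V_regularity(2))
  have gc: "continuous_on {x. V x \<le> R + 1} (grad \<xi>)"
    unfolding grad_def[abs_def] by (intro continuous_on_vec_lambda continuous_on_subset[OF pc]) auto
  have "bounded (grad \<xi> ` {x. V x \<le> R + 1})"
    by (intro compact_imp_bounded compact_continuous_image gc V_regularity(4))
  then obtain C where C: "C > 0" "\<And>x. V x \<le> R + 1 \<Longrightarrow> norm (grad \<xi> x) \<le> C"
    unfolding bounded_pos by auto
  have "norm (grad \<xi> x) \<le> C" for x
  proof (cases "V x \<le> R + 1")
    case False
    then have "grad \<xi> x = 0" by (simp add: grad_def p(2) d(2) vec_eq_iff)
    then show ?thesis using C by simp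
  qed (use C in auto)
  with p pc \<xi>c C show ?thesis
    by (intro that[of \<xi> C]) (auto simp: \<xi>_def bump_properties)
qed

text \<open>The bound \<open>b\<close> on the gradient is kept general because
  \<open>lasota_yorke\<close> applies it to a combination of \<open>wt 1\<close> and
  \<open>wt \<eta>\<close>.\<close>

lemma partial_Pop_le:
  assumes \<eta>: "0 < \<eta>" "\<eta> < 1" and f: "f \<in> Linf1 (wt \<eta>)"
    and K: "\<And>x t \<omega> g j. \<bar>(transpose (sens a N x t \<omega>) *v g) $ j\<bar> \<le> K ^ t * norm g" and K1: "K \<ge> 1"
    and int: "integrable M (\<lambda>\<omega>. b (chain a N x t \<omega>))" and b: "\<And>y. norm (grad f y) \<le> b y"
  shows "\<bar>partial j (Pop M N a t f) x\<bar> \<le> K ^ t * (LINT \<omega>|M. b (chain a N x t \<omega>))"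
proof -
  note g = gradient_Pop[OF \<eta> f]
  have "\<bar>partial j (Pop M N a t f) x\<bar> \<le> (LINT \<omega>|M. K ^ t * b (chain a N x t \<omega>))"
    unfolding g(3)
  proof (rule integral_abs_bound[THEN order_trans], rule integral_mono)
    fix \<omega>
    show "\<bar>(transpose (sens a N x t \<omega>) *v grad f (chain a N x t \<omega>)) $ j\<bar> \<le> K ^ t * b (chain a N x t \<omega>)"
      by (rule order_trans[OF K]) (use b K1 in \<open>auto intro!: mult_left_mono\<close>)
  qed (use g(1) int in auto)
  then show ?thesis by simp
qed

text \<open>When the iterate is written as the integral of \<open>p (x, y) * f y\<close> over
  \<open>y\<close>, the variable \<open>x\<close> occurs only in the density, so no derivative of
  \<open>f\<close> enters the bound. With \<open>x\<close> near \<open>D\<close> and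
  \<open>f\<close> vanishing off \<open>S\<close>, only values of \<open>p\<close> on a compact set
  matter, and there \<open>p\<close> is Lipschitz.\<close>

lemma partial_Pop_smoothing:
  assumes \<eta>: "0 < \<eta>" "\<eta> < 1" and D: "compact D" and S: "compact S"
    and p: "cont_differentiable p" "\<And>z. p z \<ge> 0"
    and dens: "\<And>x. Pker M N a t0 x = density lborel (\<lambda>y. ennreal (p (x, y)))"
  obtains C where "C \<ge> 0"
    "\<And>f L x j. f \<in> Linf1 (wt \<eta>) \<Longrightarrow> (\<And>y. \<bar>f y\<bar> \<le> L * wt \<eta> y) \<Longrightarrow> (\<And>y. y \<notin> S \<Longrightarrow> f y = 0) \<Longrightarrow> x \<in> D \<Longrightarrow>
      \<bar>partial j (Pop M N a t0 f) x\<bar> \<le> C * L"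
proof -
  obtain \<rho>1 where \<rho>1: "\<rho>1 > 0" "\<And>x. x \<in> D \<Longrightarrow> norm x \<le> \<rho>1" using compact_imp_bounded[OF D] unfolding bounded_pos by auto
  obtain \<rho>2 where \<rho>2: "\<rho>2 > 0" "\<And>x. x \<in> S \<Longrightarrow> norm x \<le> \<rho>2" using compact_imp_bounded[OF S] unfolding bounded_pos by auto
  \<comment> \<open>A ball containing \<open>S\<close>; its product with the ball of radius
    \<open>\<rho>1 + 1\<close> is convex, which yields a Lipschitz constant for \<open>p\<close>.
    The additional 1 leaves room for increments \<open>s\<close> with
    \<open>\<bar>s\<bar> < 1\<close>.\<close>
  define Q where "Q = cball (0::real^'l) \<rho>2"
  have "compact (cball (0::real^'l) (\<rho>1 + 1) \<times> Q)" "convex (cball (0::real^'l) (\<rho>1 + 1) \<times> Q)"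
    unfolding Q_def by (auto intro!: compact_Times convex_Times)
  then obtain Lp where Lp: "Lp \<ge> 0" and lip: "\<And>z z'. z \<in> cball 0 (\<rho>1 + 1) \<times> Q \<Longrightarrow> z' \<in> cball 0 (\<rho>1 + 1) \<times> Q \<Longrightarrow>
      \<bar>p z - p z'\<bar> \<le> Lp * norm (z - z')"
    using cont_differentiable_bounded_derivative[OF p(1)] by blast
  have "bounded (wt \<eta> ` Q)"
    unfolding Q_def by (intro compact_imp_bounded compact_continuous_image wt_continuous compact_cball)
  then obtain m where m: "m > 0" "\<And>x. x \<in> Q \<Longrightarrow> wt \<eta> x \<le> m"
    unfolding bounded_pos by (auto simp: abs_le_iff)
  define C where "C = Lp * m * measure lborel Q"
  have Qm [measurable]: "Q \<in> sets borel" by (simp add: Q_def)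
  have Qf: "emeasure lborel Q < \<infinity>" unfolding Q_def using emeasure_lborel_cball_finite[of "0::real^'l" \<rho>2] by simp
  have pm [measurable]: "(\<lambda>y. p (x, y)) \<in> borel_measurable borel" for x
    by (rule borel_measurable_continuous_onI)
       (auto intro!: continuous_on_compose2[OF cont_differentiable_continuous[OF p(1)]] continuous_intros)
  show ?thesis
  proof (rule that)
    show "C \<ge> 0" unfolding C_def using Lp m by simp
    fix f L x j
    assume f: "f \<in> Linf1 (wt \<eta>)" and L: "\<And>y. \<bar>f y\<bar> \<le> L * wt \<eta> y" and supp: "\<And>y. y \<notin> S \<Longrightarrow> f y = 0" and x: "x \<in> D"
    note [measurable] = Linf1_wtD(1)[OF f]
    have "L * wt \<eta> 0 \<ge> 0" using L[of 0] by linarith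
    then have L0: "L \<ge> 0" by (simp add: zero_le_mult_iff)
    have fi: "integrable M (\<lambda>\<omega>. f (chain a N x t \<omega>))" for x t
      by (rule integrable_dominated_chain[OF \<eta>(1) less_imp_le[OF \<eta>(2)] Linf1_wtD(1)[OF f] L])
    have Pf: "integrable lborel (\<lambda>y. p (x, y) * f y)" "Pop M N a t0 f x = (LINT y|lborel. p (x, y) * f y)" for x
    proof -
      have "integrable (density lborel (\<lambda>y. ennreal (p (x, y)))) f"
        using fi[of x t0] by (simp add: integrable_Pker_iff flip: dens)
      then show "integrable lborel (\<lambda>y. p (x, y) * f y)"
        using p(2) by (subst (asm) integrable_density) auto
      show "Pop M N a t0 f x = (LINT y|lborel. p (x, y) * f y)"
        unfolding Pop_def dens using p(2) by (subst integral_density) auto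
    qed
    show "\<bar>partial j (Pop M N a t0 f) x\<bar> \<le> C * L"
    proof (rule DERIV_abs_le[OF partial_DERIV0[OF gradient_Pop(2)[OF \<eta> f]]])
      fix s :: real assume s: "\<bar>s\<bar> < 1"
      let ?x = "x + s *\<^sub>R axis j 1"
      have "norm ?x \<le> norm x + norm (s *\<^sub>R axis j (1::real))" by (rule norm_triangle_ineq)
      then have xs: "?x \<in> cball 0 (\<rho>1 + 1)" "x \<in> cball 0 (\<rho>1 + 1)"
        using \<rho>1(2)[OF x] s by (auto simp: norm_axis_1)
      have pt: "\<bar>p (?x, y) * f y - p (x, y) * f y\<bar> \<le> indicator Q y *\<^sub>R (Lp * \<bar>s\<bar> * (L * m))" for y
      proof (cases "y \<in> Q")
        case True
        have "\<bar>p (?x, y) - p (x, y)\<bar> \<le> Lp * \<bar>s\<bar>"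
          using lip[of "(?x, y)" "(x, y)"] xs True by (simp add: norm_axis_1)
        moreover have "\<bar>f y\<bar> \<le> L * m"
          using L[of y] m(2)[OF True] L0 by (meson mult_left_mono order_trans)
        ultimately have "\<bar>p (?x, y) - p (x, y)\<bar> * \<bar>f y\<bar> \<le> (Lp * \<bar>s\<bar>) * (L * m)"
          using Lp by (intro mult_mono) auto
        then show ?thesis using True by (simp add: abs_mult[symmetric] left_diff_distrib)
      next
        case False
        then have "y \<notin> S" using \<rho>2(2) by (auto simp: Q_def)
        then show ?thesis using supp False by simp
      qed
      have "\<bar>Pop M N a t0 f ?x - Pop M N a t0 f x\<bar> = \<bar>LINT y|lborel. p (?x, y) * f y - p (x, y) * f y\<bar>"
        using Pf by simp
      also have "\<dots> \<le> (LINT y|lborel. indicator Q y *\<^sub>R (Lp * \<bar>s\<bar> * (L * m)))"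
        by (rule integral_abs_bound[THEN order_trans], rule integral_mono)
           (use Pf(1) pt Qf in \<open>auto intro!: integrable_scaleR_left integrable_real_indicator simp del: real_scaleR_def\<close>)
      also have "\<dots> = C * L * \<bar>s\<bar>" using Qf by (simp add: C_def)
      finally show "\<bar>Pop M N a t0 f ?x - Pop M N a t0 f (x + 0 *\<^sub>R axis j 1)\<bar> \<le> C * L * \<bar>s\<bar>" by simp
    qed
  qed
qed

text \<open>A Lasota--Yorke inequality. Outside a compact set the gain comes from the drift; on it, from a cutoff in
  \<open>V\<close>: the compactly supported part of \<open>f\<close> is smoothed by the transition density, and the part at
  infinity is small because \<open>e\<^sup>\<eta>\<^sup>V\<close> is negligible against \<open>e\<^sup>V\<close> for \<open>\<eta> < 1\<close>.\<close>

lemma lasota_yorke: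
  assumes \<eta>: "0 < \<eta>" "\<eta> < 1"
  obtains t0 B where "t0 \<ge> 1" "B \<ge> 0"
    "\<And>f A L x. f \<in> Linf1 (wt \<eta>) \<Longrightarrow> (\<And>y. \<bar>f y\<bar> \<le> L * wt \<eta> y) \<Longrightarrow> (\<And>y. norm (grad f y) \<le> A * wt \<eta> y) \<Longrightarrow>
      norm (grad (Pop M N a t0 f) x) \<le> (A / 2 + B * L) * wt \<eta> x"
proof -
  have \<eta>': "\<eta> \<le> 1" using \<eta> by simp
  obtain t0 p where t0: "t0 \<ge> 1" and p: "cont_differentiable p" "\<And>z. p z \<ge> 0"
    and dens: "\<And>x. Pker M N a t0 x = density lborel (\<lambda>y. ennreal (p (x, y)))"
    using transition_density[OF A2] by blast
  obtain K where K1: "K \<ge> 1" and sb: "\<And>x t \<omega> g j. \<bar>(transpose (sens a N x t \<omega>) *v g) $ j\<bar> \<le> K ^ t * norm g"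
    by (rule sens_bound) blast
  obtain B where B: "B \<ge> 1"
    and gr: "\<And>\<eta> x t. 0 < \<eta> \<Longrightarrow> \<eta> \<le> 1 \<Longrightarrow> (LINT \<omega>|M. wt \<eta> (chain a N x t \<omega>)) \<le> B ^ t * wt \<eta> x"
    using wt_growth by metis
  \<comment> \<open>Each partial derivative is estimated with \<epsilon>; summing over the
    coordinates yields the factor 1/2 for the norm of the gradient.\<close>
  define \<epsilon> where "\<epsilon> = 1 / (2 * real CARD('l))"
  have \<epsilon>: "\<epsilon> > 0" by (simp add: \<epsilon>_def)
  \<comment> \<open>The cost of \<open>t0\<close> steps: \<open>K ^ t0\<close> for the sensitivity
    and \<open>B ^ t0\<close> for the weight. The choices of \<open>D\<close> and then of
    \<open>R\<close> compensate it.\<close>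
  define c where "c = K ^ t0 * B ^ t0"
  have c: "c > 0" using K1 B by (simp add: c_def)
  obtain D where D: "compact D" and out: "\<And>x. x \<notin> D \<Longrightarrow> (LINT \<omega>|M. wt \<eta> (chain a N x 1 \<omega>)) \<le> (\<epsilon> / c) * wt \<eta> x"
    using wt_contracts_outside_compact[OF \<eta>(1) \<eta>', of "\<epsilon> / c"] \<epsilon> c by auto
  have "bounded (wt 1 ` D)" using D by (intro compact_imp_bounded compact_continuous_image wt_continuous)
  then obtain m where m: "m > 0" "\<And>x. x \<in> D \<Longrightarrow> wt 1 x \<le> m"
    unfolding bounded_pos by (auto simp: abs_le_iff)
  \<comment> \<open>\<open>R\<close> comes after \<open>D\<close>, since \<open>m\<close> bounds
    \<open>wt 1\<close> on \<open>D\<close>. The cutoff and smoothing constants below depend on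
    \<open>R\<close>, but they multiply only the function norm \<open>L\<close>.\<close>
  obtain R where R: "exp (- (1 - \<eta>) * R) * (c * m) \<le> \<epsilon>"
  proof
    have cm: "c * m > 0" using c m by simp
    have "- (1 - \<eta>) * (- ln (\<epsilon> / (c * m)) / (1 - \<eta>)) = ln (\<epsilon> / (c * m))"
      using \<eta> by (simp add: divide_simps) (simp add: algebra_simps)
    moreover have "exp (ln (\<epsilon> / (c * m))) * (c * m) = \<epsilon>" using cm c m \<epsilon> by (simp add: exp_ln)
    ultimately show "exp (- (1 - \<eta>) * (- ln (\<epsilon> / (c * m)) / (1 - \<eta>))) * (c * m) \<le> \<epsilon>"
      by (simp only: order_refl)
  qed
  obtain \<xi> Cx where \<xi>: "\<And>x. 0 \<le> \<xi> x" "\<And>x. \<xi> x \<le> 1" "\<And>x. V x \<le> R \<Longrightarrow> \<xi> x = 1" "\<And>x. V x \<ge> R + 1 \<Longrightarrow> \<xi> x = 0"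
    "\<And>i x. has_partial i \<xi> x" "\<And>i. continuous_on UNIV (partial i \<xi>)" "continuous_on UNIV \<xi>"
    "Cx \<ge> 0" "\<And>x. norm (grad \<xi> x) \<le> Cx"
    by (rule V_cutoff[of R]) blast
  obtain Cs where Cs: "Cs \<ge> 0" and sm: "\<And>f L x j. f \<in> Linf1 (wt \<eta>) \<Longrightarrow> (\<And>y. \<bar>f y\<bar> \<le> L * wt \<eta> y) \<Longrightarrow>
      (\<And>y. y \<notin> {y. V y \<le> R + 1} \<Longrightarrow> f y = 0) \<Longrightarrow> x \<in> D \<Longrightarrow> \<bar>partial j (Pop M N a t0 f) x\<bar> \<le> Cs * L"
    using partial_Pop_smoothing[OF \<eta> D V_regularity(4)[of "R + 1"] p dens] by metis
  have iw: "integrable M (\<lambda>\<omega>. wt \<eta> (chain a N x t \<omega>))" "integrable M (\<lambda>\<omega>. wt 1 (chain a N x t \<omega>))" for x t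
    using \<eta> by auto
  define B' where "B' = c * Cx + Cs"
  have main: "\<bar>partial j (Pop M N a t0 f) x\<bar> \<le> (\<epsilon> * A + B' * L) * wt \<eta> x"
    if f: "f \<in> Linf1 (wt \<eta>)" and L: "\<And>y. \<bar>f y\<bar> \<le> L * wt \<eta> y" and A: "\<And>y. norm (grad f y) \<le> A * wt \<eta> y" for f A L x j
  proof -
    note fD = Linf1_wtD[OF f]
    have "L * wt \<eta> 0 \<ge> 0" using L[of 0] by linarith
    then have L0: "L \<ge> 0" by (simp add: zero_le_mult_iff)
    have "A * wt \<eta> 0 \<ge> 0" using A[of 0] norm_ge_zero[of "grad f 0"] by linarith
    then have A0: "A \<ge> 0" by (simp add: zero_le_mult_iff)
    have w1: "1 \<le> wt \<eta> x" using \<eta> by (simp add: wt_ge_1)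
    have B0: "B' * L * wt \<eta> x \<ge> 0" using L0 c \<xi>(8) Cs by (simp add: B'_def)
    show ?thesis
    proof (cases "x \<in> D")
      case False
      \<comment> \<open>Off \<open>D\<close> the first step gains \<open>\<epsilon> / c\<close>; the
        remaining \<open>t0 - 1\<close> steps are estimated by growth.\<close>
      have "(LINT \<omega>|M. wt \<eta> (chain a N x t0 \<omega>)) = (LINT \<omega>|M. LINT \<omega>'|M. wt \<eta> (chain a N (chain a N x 1 \<omega>) (t0 - 1) \<omega>'))"
        using integral_chain_add(1)[of "wt \<eta>" x 1 "t0 - 1"] iw(1) t0 by (simp del: chain.simps)
      also have "\<dots> \<le> (LINT \<omega>|M. B ^ (t0 - 1) * wt \<eta> (chain a N x 1 \<omega>))"
        using integral_chain_add(2)[of "wt \<eta>" x 1 "t0 - 1"] iw(1) t0 \<eta> \<eta>' gr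
        by (intro integral_mono) (auto simp del: chain.simps)
      also have "\<dots> \<le> B ^ (t0 - 1) * ((\<epsilon> / c) * wt \<eta> x)"
        using mult_left_mono[OF out[OF False], of "B ^ (t0 - 1)"] B by (simp del: chain.simps)
      also have "\<dots> \<le> B ^ t0 * ((\<epsilon> / c) * wt \<eta> x)"
        using B \<epsilon> c by (intro mult_right_mono power_increasing) auto
      finally have e: "(LINT \<omega>|M. wt \<eta> (chain a N x t0 \<omega>)) \<le> B ^ t0 * ((\<epsilon> / c) * wt \<eta> x)" .
      have "\<bar>partial j (Pop M N a t0 f) x\<bar> \<le> K ^ t0 * (LINT \<omega>|M. A * wt \<eta> (chain a N x t0 \<omega>))"
        by (rule partial_Pop_le[OF \<eta> f sb K1 _ A]) (use iw in simp)
      also have "\<dots> \<le> K ^ t0 * (A * (B ^ t0 * ((\<epsilon> / c) * wt \<eta> x)))"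
        using mult_left_mono[OF mult_left_mono[OF e A0], of "K ^ t0"] K1 by simp
      also have "\<dots> = c * (\<epsilon> / c) * (A * wt \<eta> x)" by (simp add: c_def)
      also have "\<dots> = \<epsilon> * A * wt \<eta> x" using c by simp
      finally show ?thesis using B0 by (simp add: distrib_right)
    next
      case True
      define f1 where "f1 y = \<xi> y * f y" for y
      define f2 where "f2 y = (1 - \<xi> y) * f y" for y
      have h1: "has_partial i f1 y" "partial i f1 y = partial i \<xi> y * f y + partial i f y * \<xi> y" for i y
        unfolding f1_def[abs_def] using partial_mult[OF \<xi>(5) fD(3)] by auto
      have hc: "has_partial i (\<lambda>y. 1 - \<xi> y) y" "partial i (\<lambda>y. 1 - \<xi> y) y = - partial i \<xi> y" for i y
      proof -
        have "((\<lambda>u. 1 - u) has_real_derivative -1) (at v)" for v :: real by (auto intro!: derivative_eq_intros)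
        from partial_compose[OF \<xi>(5) this]
        show "has_partial i (\<lambda>y. 1 - \<xi> y) y" "partial i (\<lambda>y. 1 - \<xi> y) y = - partial i \<xi> y" by auto
      qed
      have h2: "has_partial i f2 y" "partial i f2 y = - partial i \<xi> y * f y + partial i f y * (1 - \<xi> y)" for i y
        unfolding f2_def[abs_def] using partial_mult[OF hc(1) fD(3)] by (auto simp: hc(2))
      have g1: "grad f1 y = f y *\<^sub>R grad \<xi> y + \<xi> y *\<^sub>R grad f y" for y
        by (simp add: vec_eq_iff grad_def h1(2) mult.commute)
      have g2: "grad f2 y = (1 - \<xi> y) *\<^sub>R grad f y - f y *\<^sub>R grad \<xi> y" for y
        by (simp add: vec_eq_iff grad_def h2(2) mult.commute)
      have fC: "norm (f y *\<^sub>R grad \<xi> y) \<le> Cx * L * wt \<eta> y" for y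
      proof -
        have "\<bar>f y\<bar> * norm (grad \<xi> y) \<le> (L * wt \<eta> y) * Cx"
          using L[of y] \<xi>(9)[of y] by (intro mult_mono) auto
        then show ?thesis by (simp add: mult_ac)
      qed
      have A1: "norm (\<xi> y *\<^sub>R grad f y) \<le> A * wt \<eta> y" "norm ((1 - \<xi> y) *\<^sub>R grad f y) \<le> A * wt \<eta> y" for y
        using A[of y] \<xi>(1)[of y] \<xi>(2)[of y]
          mult_left_le_one_le[of "norm (grad f y)" "\<xi> y"] mult_left_le_one_le[of "norm (grad f y)" "1 - \<xi> y"]
        by auto
      have L1: "\<bar>f1 y\<bar> \<le> L * wt \<eta> y" "\<bar>f2 y\<bar> \<le> L * wt \<eta> y" for y
        unfolding f1_def f2_def abs_mult using L[of y] \<xi>(1)[of y] \<xi>(2)[of y]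
          mult_left_le_one_le[of "\<bar>f y\<bar>" "\<xi> y"] mult_left_le_one_le[of "\<bar>f y\<bar>" "1 - \<xi> y"]
        by auto
      have G1: "norm (grad f1 y) \<le> (Cx * L + A) * wt \<eta> y" for y
        unfolding g1 distrib_right by (rule norm_triangle_mono[OF fC A1(1)])
      have G2': "norm (grad f2 y) \<le> (A + Cx * L) * wt \<eta> y" for y
        unfolding g2 distrib_right by (rule norm_triangle_le_diff[OF add_mono[OF A1(2) fC]])
      have pcs: "continuous_on UNIV (partial i f1)" "continuous_on UNIV (partial i f2)" for i
      proof -
        have "partial i f1 = (\<lambda>y. partial i \<xi> y * f y + partial i f y * \<xi> y)"
          "partial i f2 = (\<lambda>y. - partial i \<xi> y * f y + partial i f y * (1 - \<xi> y))"
          using h1(2) h2(2) by blast+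
        then show "continuous_on UNIV (partial i f1)" "continuous_on UNIV (partial i f2)"
          by (auto intro!: continuous_intros \<xi>(6,7) fD(2,4))
      qed
      have f1: "f1 \<in> Linf1 (wt \<eta>)"
        by (rule Linf1_wtI[OF _ h1(1) pcs(1) L1(1) G1])
           (auto simp: f1_def[abs_def] intro!: continuous_intros \<xi>(7) fD(2))
      have f2: "f2 \<in> Linf1 (wt \<eta>)"
        by (rule Linf1_wtI[OF _ h2(1) pcs(2) L1(2) G2'])
           (auto simp: f2_def[abs_def] intro!: continuous_intros \<xi>(7) fD(2))
      note [measurable] = Linf1_wtD(1)[OF f1] Linf1_wtD(1)[OF f2] fD(1)
      have "Pop M N a t0 f y = Pop M N a t0 f1 y + Pop M N a t0 f2 y" for y
      proof -
        have "integrable M (\<lambda>\<omega>. f1 (chain a N y t0 \<omega>))" "integrable M (\<lambda>\<omega>. f2 (chain a N y t0 \<omega>))"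
          using integrable_dominated_chain[OF \<eta>(1) \<eta>' _ L1(1)] integrable_dominated_chain[OF \<eta>(1) \<eta>' _ L1(2)] by auto
        then have "Pop M N a t0 f1 y + Pop M N a t0 f2 y = (LINT \<omega>|M. f1 (chain a N y t0 \<omega>) + f2 (chain a N y t0 \<omega>))"
          by (simp add: Pop_eq)
        also have "\<dots> = Pop M N a t0 f y" by (simp add: Pop_eq f1_def f2_def algebra_simps)
        finally show ?thesis by simp
      qed
      then have "Pop M N a t0 f = (\<lambda>y. Pop M N a t0 f1 y + Pop M N a t0 f2 y)" by blast
      then have split: "partial j (Pop M N a t0 f) x = partial j (Pop M N a t0 f1) x + partial j (Pop M N a t0 f2) x"
        using partial_add(2)[OF gradient_Pop(2)[OF \<eta> f1] gradient_Pop(2)[OF \<eta> f2]] by simp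
      \<comment> \<open>\<open>f1\<close> vanishes for \<open>V > R + 1\<close>, so the smoothing
        estimate applies and the gradient bound \<open>A\<close> does not appear.\<close>
      have "\<bar>partial j (Pop M N a t0 f1) x\<bar> \<le> Cs * L"
        by (rule sm[OF f1 L1(1) _ True]) (simp add: f1_def \<xi>(4))
      also have "\<dots> \<le> Cs * L * wt \<eta> x" using w1 Cs L0 mult_left_mono[of 1 "wt \<eta> x" "Cs * L"] by simp
      finally have p1: "\<bar>partial j (Pop M N a t0 f1) x\<bar> \<le> Cs * L * wt \<eta> x" .
      define r where "r = exp (- (1 - \<eta>) * R)"
      \<comment> \<open>Where \<open>V \<le> R\<close> the term with the gradient of
        \<open>f\<close> disappears; elsewhere passing from \<open>wt \<eta>\<close> to
        \<open>wt 1\<close> gains the factor \<open>r\<close>. The gradient of the cutoff is paid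
        for by \<open>L\<close>.\<close>
      have G2: "norm (grad f2 y) \<le> A * r * wt 1 y + Cx * L * wt \<eta> y" for y
      proof -
        have "norm ((1 - \<xi> y) *\<^sub>R grad f y) \<le> A * r * wt 1 y"
        proof (cases "V y \<le> R")
          case True
          then show ?thesis using A0 by (simp add: \<xi>(3) r_def)
        next
          case False
          have "(1 - \<eta>) * R \<le> (1 - \<eta>) * V y" using False \<eta> by (intro mult_left_mono) auto
          then have "wt \<eta> y \<le> r * wt 1 y" by (simp add: wt_def r_def exp_add[symmetric] algebra_simps)
          then have "A * wt \<eta> y \<le> A * (r * wt 1 y)" using A0 by (intro mult_left_mono)
          with A1(2)[of y] show ?thesis by (simp add: mult.assoc)
        qed
        then show ?thesis unfolding g2 by (intro norm_triangle_le_diff add_mono fC)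
      qed
      have "\<bar>partial j (Pop M N a t0 f2) x\<bar> \<le> K ^ t0 * (LINT \<omega>|M. A * r * wt 1 (chain a N x t0 \<omega>) + Cx * L * wt \<eta> (chain a N x t0 \<omega>))"
        by (rule partial_Pop_le[OF \<eta> f2 sb K1 _ G2]) (use iw in simp)
      also have "\<dots> \<le> K ^ t0 * (A * r * (B ^ t0 * wt 1 x) + Cx * L * (B ^ t0 * wt \<eta> x))"
      proof (rule mult_left_mono)
        have "A * r * (LINT \<omega>|M. wt 1 (chain a N x t0 \<omega>)) \<le> A * r * (B ^ t0 * wt 1 x)"
          using A0 gr by (intro mult_left_mono) (auto simp: r_def)
        moreover have "Cx * L * (LINT \<omega>|M. wt \<eta> (chain a N x t0 \<omega>)) \<le> Cx * L * (B ^ t0 * wt \<eta> x)"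
          using L0 \<xi>(8) \<eta> gr by (intro mult_left_mono) auto
        ultimately show "(LINT \<omega>|M. A * r * wt 1 (chain a N x t0 \<omega>) + Cx * L * wt \<eta> (chain a N x t0 \<omega>)) \<le>
            A * r * (B ^ t0 * wt 1 x) + Cx * L * (B ^ t0 * wt \<eta> x)"
          using iw by simp
      qed (use K1 in simp)
      also have "\<dots> = A * (r * (c * wt 1 x)) + c * Cx * L * wt \<eta> x" by (simp add: c_def algebra_simps)
      also have "\<dots> \<le> A * (\<epsilon> * wt \<eta> x) + c * Cx * L * wt \<eta> x"
      proof (intro add_right_mono mult_left_mono[OF _ A0])
        \<comment> \<open>On \<open>D\<close> the weight \<open>wt 1 x\<close> is at most
          \<open>m\<close>, which the choice of \<open>R\<close> absorbs;
          \<open>wt \<eta> x \<ge> 1\<close> then restores the weight.\<close>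
        have "r * (c * wt 1 x) \<le> r * (c * m)" using m(2)[OF True] c by (simp add: r_def)
        also have "\<dots> \<le> \<epsilon> * 1" using R by (simp add: r_def)
        also have "\<dots> \<le> \<epsilon> * wt \<eta> x" using w1 \<epsilon> by (intro mult_left_mono) auto
        finally show "r * (c * wt 1 x) \<le> \<epsilon> * wt \<eta> x" .
      qed
      finally have "\<bar>partial j (Pop M N a t0 f2) x\<bar> \<le> A * (\<epsilon> * wt \<eta> x) + c * Cx * L * wt \<eta> x" .
      with p1 show ?thesis unfolding split B'_def by (simp add: algebra_simps)
    qed
  qed
  show ?thesis
  proof (rule that[OF t0, of "real CARD('l) * B'"])
    show "real CARD('l) * B' \<ge> 0" using c \<xi>(8) Cs by (simp add: B'_def)
    fix f A L x
    assume *: "f \<in> Linf1 (wt \<eta>)" "\<And>y. \<bar>f y\<bar> \<le> L * wt \<eta> y" "\<And>y. norm (grad f y) \<le> A * wt \<eta> y"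
    have "norm (grad (Pop M N a t0 f) x) \<le> (\<Sum>j\<in>UNIV. \<bar>grad (Pop M N a t0 f) x $ j\<bar>)" by (rule norm_le_l1_cart)
    also have "\<dots> \<le> (\<Sum>j\<in>(UNIV::'l set). (\<epsilon> * A + B' * L) * wt \<eta> x)"
      by (intro sum_mono) (simp add: grad_def main[OF *])
    also have "\<dots> = (A / 2 + real CARD('l) * B' * L) * wt \<eta> x" by (simp add: \<epsilon>_def field_simps)
    finally show "norm (grad (Pop M N a t0 f) x) \<le> (A / 2 + real CARD('l) * B' * L) * wt \<eta> x" .
  qed
qed

text \<open>The constants grow exponentially in \<open>t\<close>, but only membership matters: it
  makes the Lasota-Yorke inequality applicable to every iterate and the weighted gradient norms
  finite.\<close>

lemma Pop_Linf1:
  assumes \<eta>: "0 < \<eta>" "\<eta> < 1" and f: "f \<in> Linf1 (wt \<eta>)"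
  shows "Pop M N a t f \<in> Linf1 (wt \<eta>)"
proof -
  have \<eta>': "\<eta> \<le> 1" using \<eta> by simp
  note fD = Linf1_wtD[OF f]
  note g = gradient_Pop[OF \<eta> f]
  obtain A where A: "A \<ge> 0" "\<And>x. norm (grad f x) \<le> A * wt \<eta> x" using fD(6) by blast
  obtain L where L: "L \<ge> 0" "\<And>x. \<bar>f x\<bar> \<le> L * wt \<eta> x" using fD(5) by blast
  obtain K where K1: "K \<ge> 1" and sb: "\<And>x t \<omega> g j. \<bar>(transpose (sens a N x t \<omega>) *v g) $ j\<bar> \<le> K ^ t * norm g"
    by (rule sens_bound) blast
  obtain B where B: "B \<ge> 1" and gr: "\<And>x t. (LINT \<omega>|M. wt \<eta> (chain a N x t \<omega>)) \<le> B ^ t * wt \<eta> x"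
    using wt_growth \<eta> \<eta>' by metis
  note [measurable] = fD(1)
  have fc: "continuous_on UNIV (\<lambda>x. f (chain a N x t \<omega>))" for \<omega>
    by (rule continuous_on_compose2[OF fD(2) chain_continuous]) simp
  have Pe: "Pop M N a t f = (\<lambda>x. LINT \<omega>|M. f (chain a N x t \<omega>))" by (rule ext) (rule Pop_eq[OF fD(1)])
  have "continuous_on UNIV (Pop M N a t f)"
    unfolding Pe by (rule continuous_expectation_dominated(1)[OF \<eta> _ fc L(2)]) simp
  moreover have "\<bar>Pop M N a t f x\<bar> \<le> L * B ^ t * wt \<eta> x" for x
  proof -
    have "\<bar>Pop M N a t f x\<bar> \<le> (LINT \<omega>|M. L * wt \<eta> (chain a N x t \<omega>))"
      unfolding Pe by (rule integral_abs_bound[THEN order_trans], rule integral_mono)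
        (use integrable_dominated_chain[OF \<eta>(1) \<eta>' fD(1) L(2)] \<eta> L in auto)
    also have "\<dots> \<le> L * (B ^ t * wt \<eta> x)" using gr[of x t] L by (simp add: mult_left_mono)
    finally show ?thesis by (simp add: mult.assoc)
  qed
  moreover have "norm (grad (Pop M N a t f) x) \<le> real CARD('l) * (K ^ t * (A * B ^ t)) * wt \<eta> x" for x
  proof -
    have p: "\<bar>partial j (Pop M N a t f) x\<bar> \<le> K ^ t * (A * (B ^ t * wt \<eta> x))" for j
    proof -
      have "\<bar>partial j (Pop M N a t f) x\<bar> \<le> K ^ t * (LINT \<omega>|M. A * wt \<eta> (chain a N x t \<omega>))"
        by (rule partial_Pop_le[OF \<eta> f sb K1 _ A(2)]) (use \<eta> in simp)
      also have "\<dots> \<le> K ^ t * (A * (B ^ t * wt \<eta> x))" using gr[of x t] A K1 by (simp add: mult_left_mono)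
      finally show ?thesis .
    qed
    have "norm (grad (Pop M N a t f) x) \<le> (\<Sum>j\<in>UNIV. \<bar>grad (Pop M N a t f) x $ j\<bar>)" by (rule norm_le_l1_cart)
    also have "\<dots> \<le> (\<Sum>j\<in>(UNIV::'l set). K ^ t * (A * (B ^ t * wt \<eta> x)))"
      by (intro sum_mono) (simp add: grad_def p)
    finally show ?thesis by (simp add: mult.assoc)
  qed
  ultimately show ?thesis by (intro Linf1_wtI g(2,4))
qed

text \<open>Subtracting \<open>k\<close> leaves the gradients unchanged and, by ergodicity, makes
  the function norms summable; so the inhomogeneity in the Lasota-Yorke recursion is
  summable.\<close>

lemma summable_gradient:
  assumes \<eta>: "0 < \<eta>" "\<eta> < 1" and \<pi>: "invariant_prob M N a \<pi>" and c: "c \<in> Linf1 (wt \<eta>)"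
  obtains v :: "nat \<Rightarrow> real" where "summable v" "\<And>t. v t \<ge> 0"
    "\<And>t x. norm (grad (Pop M N a t c) x) \<le> v t * wt \<eta> x"
proof -
  have \<eta>': "\<eta> \<le> 1" using \<eta> by simp
  obtain t0 B where t0: "t0 \<ge> 1" and B: "B \<ge> 0" and ly:
    "\<And>f A L x. f \<in> Linf1 (wt \<eta>) \<Longrightarrow> (\<And>y. \<bar>f y\<bar> \<le> L * wt \<eta> y) \<Longrightarrow> (\<And>y. norm (grad f y) \<le> A * wt \<eta> y) \<Longrightarrow>
      norm (grad (Pop M N a t0 f) x) \<le> (A / 2 + B * L) * wt \<eta> x"
    by (rule lasota_yorke[OF \<eta>]) blast
  obtain u :: "nat \<Rightarrow> real" where u: "summable u" "\<And>t. u t \<ge> 0" and erg: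
    "\<And>f L x t. f \<in> borel_measurable borel \<Longrightarrow> (\<And>x. \<bar>f x\<bar> \<le> L * wt \<eta> x) \<Longrightarrow>
      \<bar>(LINT \<omega>|M. f (chain a N x t \<omega>)) - (LINT y|\<pi>. f y)\<bar> \<le> L * u t * wt \<eta> x"
    by (rule summable_ergodicity[OF \<eta>(1) \<eta>' \<pi>]) blast
  note cD = Linf1_wtD[OF c]
  note [measurable] = cD(1)
  obtain L where L: "L \<ge> 0" "\<And>x. \<bar>c x\<bar> \<le> L * wt \<eta> x" using cD(5) by blast
  define k where "k = (LINT y|\<pi>. c y)"
  define f where "f t x = Pop M N a t c x - k" for t x
  have PL: "Pop M N a t c \<in> Linf1 (wt \<eta>)" for t by (rule Pop_Linf1[OF \<eta> c])
  have fb: "\<bar>f t x\<bar> \<le> L * u t * wt \<eta> x" for t x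
    unfolding f_def k_def Pop_eq[OF cD(1)] by (rule erg[OF cD(1) L(2)])
  have fp: "has_partial i (f t) x" "partial i (f t) x = partial i (Pop M N a t c) x" for i t x
    unfolding f_def[abs_def] using partial_diff_const[OF Linf1_wtD(3)[OF PL]] by auto
  then have fg: "grad (f t) = grad (Pop M N a t c)" for t by (simp add: grad_def fun_eq_iff)
  have fL: "f t \<in> Linf1 (wt \<eta>)" for t
  proof -
    obtain A where A: "\<And>x. norm (grad (f t) x) \<le> A * wt \<eta> x" using Linf1_wtD(6)[OF PL[of t]] unfolding fg by blast
    have "partial i (f t) = partial i (Pop M N a t c)" for i by (rule ext) (rule fp(2))
    then show ?thesis
      by (intro Linf1_wtI[OF _ fp(1) _ fb A])
         (auto simp: f_def[abs_def] intro!: continuous_intros Linf1_wtD(2,4)[OF PL])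
  qed
  define v where "v t = (SUP x. norm (grad (f t) x) / wt \<eta> x)" for t
  have bdd: "bdd_above (range (\<lambda>x. norm (grad (f t) x) / wt \<eta> x))" for t
  proof -
    obtain A where "\<And>x. norm (grad (f t) x) \<le> A * wt \<eta> x" using Linf1_wtD(6)[OF fL[of t]] by blast
    then show ?thesis by (intro bdd_aboveI2[where M = A]) (simp add: pos_divide_le_eq)
  qed
  have vb: "norm (grad (f t) x) \<le> v t * wt \<eta> x" for t x
    using cSUP_upper[OF UNIV_I bdd[of t], of x] by (simp add: v_def pos_divide_le_eq)
  have v0: "v t \<ge> 0" for t
    using cSUP_upper2[OF bdd[of t] UNIV_I, of 0 0] unfolding v_def by simp
  have rec: "v (t + t0) \<le> 1/2 * v t + B * L * u t" for t
    unfolding v_def[of "t + t0"]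
  proof (rule cSUP_least)
    fix x
    have ci: "integrable (Pker M N a s y) c" for s y
      using integrable_dominated_chain[OF \<eta>(1) \<eta>' cD(1) L(2)] by (simp add: integrable_Pker_iff)
    \<comment> \<open>The operators preserve constants, so centring commutes with iteration.\<close>
    have "f (t + t0) y = Pop M N a t0 (f t) y" for y
    proof -
      have "Pop M N a (t0 + t) c y = Pop M N a t0 (Pop M N a t c) y" "integrable (Pker M N a t0 y) (Pop M N a t c)"
        using Pop_add[OF cD(1) ci] by auto
      then show ?thesis by (simp add: f_def[abs_def] Pop_diff_const add.commute)
    qed
    then have "f (t + t0) = Pop M N a t0 (f t)" by blast
    then have "norm (grad (f (t + t0)) x) \<le> (v t / 2 + B * (L * u t)) * wt \<eta> x"
      using ly[OF fL fb vb] by simp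
    then show "norm (grad (f (t + t0)) x) / wt \<eta> x \<le> 1/2 * v t + B * L * u t"
      by (simp add: pos_divide_le_eq mult.assoc)
  qed simp
  have "summable v"
    by (rule summable_of_delayed_contraction[where q = "1/2" and T = t0 and e = "\<lambda>t. B * L * u t"])
       (use v0 u B L rec in \<open>auto intro: summable_mult\<close>)
  from that[OF this v0 vb[unfolded fg]] show ?thesis .
qed

section \<open>Continuity and termwise differentiation of weighted series\<close>

text \<open>The weight is bounded on bounded sets because their closures are compact; the
  Weierstrass test then gives locally uniform convergence from the summable majorant.\<close>

lemma weighted_suminf_bound:
  assumes F: "\<And>t x. \<bar>F t x\<bar> \<le> v t * wt \<eta> x" and v: "summable v"
  shows "summable (\<lambda>t. F t x)" "\<bar>\<Sum>t. F t x\<bar> \<le> (\<Sum>t. v t) * wt \<eta> x"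
    "bounded S \<Longrightarrow> uniform_limit S (\<lambda>n x. \<Sum>t<n. F t x) (\<lambda>x. \<Sum>t. F t x) sequentially"
proof -
  have vs: "summable (\<lambda>t. v t * wt \<eta> x)" for x using v by (rule summable_mult2)
  show "summable (\<lambda>t. F t x)" by (rule summable_comparison_test'[OF vs]) (use F in auto)
  have "\<bar>\<Sum>t. F t x\<bar> \<le> (\<Sum>t. v t * wt \<eta> x)"
    using norm_suminf_le[of "\<lambda>t. F t x", OF _ vs] F by simp
  then show "\<bar>\<Sum>t. F t x\<bar> \<le> (\<Sum>t. v t) * wt \<eta> x" using suminf_mult2[OF v] by simp
  assume "bounded S"
  then have "bounded (wt \<eta> ` closure S)"
    by (intro compact_imp_bounded compact_continuous_image wt_continuous) (simp add: compact_closure)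
  then obtain m where m: "\<And>x. x \<in> S \<Longrightarrow> wt \<eta> x \<le> m"
    unfolding bounded_pos using closure_subset by (fastforce simp: abs_le_iff)
  show "uniform_limit S (\<lambda>n x. \<Sum>t<n. F t x) (\<lambda>x. \<Sum>t. F t x) sequentially"
  proof (rule Weierstrass_m_test)
    fix t x assume "x \<in> S"
    have "v t * wt \<eta> x \<ge> 0" using F[of t x] by linarith
    then have "v t \<ge> 0" by (simp add: zero_le_mult_iff)
    then have "v t * wt \<eta> x \<le> v t * m" using m[OF \<open>x \<in> S\<close>] by (rule mult_left_mono[rotated])
    with F[of t x] show "norm (F t x) \<le> v t * m" by simp
  qed (rule summable_mult2[OF v])
qed

lemma continuous_suminf_weighted:
  assumes F: "\<And>t x. \<bar>F t x\<bar> \<le> v t * wt \<eta> x" and v: "summable v" and c: "\<And>t. continuous_on UNIV (F t)"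
  shows "continuous_on UNIV (\<lambda>x. \<Sum>t. F t x)"
proof -
  have "continuous (at x) (\<lambda>x. \<Sum>t. F t x)" for x
  proof -
    have "continuous_on (cball x 1) (\<lambda>x. \<Sum>t. F t x)"
      by (rule uniform_limit_theorem[OF _ weighted_suminf_bound(3)[OF F v bounded_cball]])
         (auto intro!: always_eventually continuous_on_sum continuous_on_subset[OF c])
    then show ?thesis by (rule continuous_on_interior) simp
  qed
  then show ?thesis by (simp add: continuous_at_imp_continuous_on)
qed

text \<open>A partial derivative needs uniform convergence only along a segment in direction
  \<open>i\<close>, which is a bounded set.\<close>

lemma partial_suminf_weighted:
  assumes F: "\<And>t x. \<bar>F t x\<bar> \<le> u t * wt \<eta> x" and u: "summable u"
    and p: "\<And>t x. has_partial i (F t) x" and dF: "\<And>t x. \<bar>partial i (F t) x\<bar> \<le> v t * wt \<eta> x" and v: "summable v"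
  shows "has_partial i (\<lambda>x. \<Sum>t. F t x) x" "partial i (\<lambda>x. \<Sum>t. F t x) x = (\<Sum>t. partial i (F t) x)"
proof -
  let ?S = "{-1..1::real}" and ?x = "\<lambda>s. x + s *\<^sub>R axis i 1"
  have "bounded (?x ` ?S)"
    by (intro compact_imp_bounded compact_continuous_image continuous_intros) auto
  from weighted_suminf_bound(3)[OF dF v this]
  have ul: "uniform_limit ?S (\<lambda>n s. \<Sum>t<n. partial i (F t) (?x s)) (\<lambda>s. \<Sum>t. partial i (F t) (?x s)) sequentially"
    by (rule uniform_limit_compose') auto
  have "((\<lambda>s. \<Sum>t. F t (?x s)) has_field_derivative (\<Sum>t. partial i (F t) (?x 0))) (at 0)"
    by (rule has_field_derivative_series'(2)[where S = ?S and ?x0.0 = 0])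
       (use ul weighted_suminf_bound(1)[OF F u] in
        \<open>auto intro!: has_field_derivative_at_within partial_DERIV p uniformly_convergentI\<close>)
  then have "((\<lambda>s. \<Sum>t. F t (?x s)) has_real_derivative (\<Sum>t. partial i (F t) x)) (at 0)" by simp
  from has_partialI[where f = "\<lambda>x. \<Sum>t. F t x", OF this]
  show "has_partial i (\<lambda>x. \<Sum>t. F t x) x" "partial i (\<lambda>x. \<Sum>t. F t x) x = (\<Sum>t. partial i (F t) x)" by auto
qed

text \<open>\<open>gradient_Pop\<close> works coordinatewise, whereas \<open>Qop\<close> is a
  vector-valued Bochner integral; expansion in the standard basis transfers integrability. Time 0 is
  separate because there \<open>Qop\<close> is defined without an expectation.\<close>

lemma Qop_grad_eq:
  assumes \<eta>: "0 < \<eta>" "\<eta> < 1" and f: "f \<in> Linf1 (wt \<eta>)"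
  shows "integrable M (\<lambda>\<omega>. transpose (sens a N x t \<omega>) *v grad f (chain a N x t \<omega>))"
    and "Qop M N a t (grad f) x = grad (Pop M N a t f) x"
proof -
  note g = gradient_Pop[OF \<eta> f]
  let ?G = "\<lambda>\<omega>. transpose (sens a N x t \<omega>) *v grad f (chain a N x t \<omega>)"
  have "?G = (\<lambda>\<omega>. \<Sum>j\<in>UNIV. (?G \<omega> $ j) *\<^sub>R axis j 1)"
    by (simp add: basis_expansion flip: scalar_mult_eq_scaleR)
  moreover have "integrable M (\<lambda>\<omega>. \<Sum>j\<in>UNIV. (?G \<omega> $ j) *\<^sub>R axis j (1::real))"
    by (intro Bochner_Integration.integrable_sum integrable_scaleR_left g(1))
  ultimately show i: "integrable M ?G" by (simp only:)
  show "Qop M N a t (grad f) x = grad (Pop M N a t f) x"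
  proof (cases "t = 0")
    case True
    have "Pop M N a 0 f = f" using Linf1_wtD(1)[OF f] by (auto simp: fun_eq_iff)
    with True show ?thesis by (simp add: Qop_def)
  next
    case False
    have "(LINT \<omega>|M. ?G \<omega>) $ j = (LINT \<omega>|M. ?G \<omega> $ j)" for j
      by (rule integral_bounded_linear[OF bounded_linear_vec_nth i, symmetric])
    then show ?thesis using False by (simp add: Qop_def vec_eq_iff grad_def g(3))
  qed
qed

end

section \<open>Poisson's equation, uniqueness, and regularity of the solution\<close>

theorem theorem2p3:
  fixes M :: "'w measure"
    and N :: "nat \<Rightarrow> 'w \<Rightarrow> real^'m::finite"
    and a :: "real^'l::finite \<Rightarrow> real^'m \<Rightarrow> real^'l"
    and V c h :: "real^'l \<Rightarrow> real"
    and w :: "real^'l \<Rightarrow> real"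
    and \<pi> :: "(real^'l) measure"
    and \<eta> cbar :: real
  assumes noise: "iid_noise M N"
    and a_cont: "continuous_on UNIV (\<lambda>(x, n). a x n)"
    and A1: "A1 a"
    and A2: "A2 M N a"
    and A3: "A3 M N a"
    and A4: "A4 M N a V"
    and \<pi>: "invariant_prob M N a \<pi>"
    and \<eta>: "0 < \<eta>" "\<eta> \<le> 1"
  defines "w \<equiv> (\<lambda>x. exp (V x) powr \<eta>)"
    and "cbar \<equiv> (LINT x|\<pi>. c x)"
    and "h \<equiv> (\<lambda>x. \<Sum>t. LINT \<omega>|M. (c (chain a N x t \<omega>) - cbar))"
  assumes c: "c \<in> Linf w"
  shows
    "integrable \<pi> c \<and>
     (\<forall>x t. integrable M (\<lambda>\<omega>. c (chain a N x t \<omega>))) \<and>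
     (\<forall>x. summable (\<lambda>t. LINT \<omega>|M. (c (chain a N x t \<omega>) - cbar))) \<and>
     h \<in> Linf w \<and>
     (\<forall>x. integrable (Pker M N a 1 x) h \<and> h x - Pop M N a 1 h x = c x - cbar) \<and>
     integrable \<pi> h \<and> (LINT x|\<pi>. h x) = 0 \<and>
     (\<forall>g\<in>Linf w. (\<forall>x. g x - Pop M N a 1 g x = c x - cbar) \<and> (LINT x|\<pi>. g x) = 0 \<longrightarrow> g = h) \<and>
     (\<eta> < 1 \<longrightarrow>
        (c \<in> Linf0 w \<longrightarrow> h \<in> Linf0 w) \<and>
        (c \<in> Linf1 w \<longrightarrow>
           h \<in> Linf1 w \<and>
           (\<forall>t i x. has_partial i (Pop M N a t c) x) \<and>
           (\<forall>x. (\<lambda>t. grad (Pop M N a t c) x) sums grad h x) \<and>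
           (\<forall>t x. integrable M (\<lambda>\<omega>. transpose (sens a N x t \<omega>) *v grad c (chain a N x t \<omega>))) \<and>
           (\<forall>x. (\<lambda>t. Qop M N a t (grad c) x) sums grad h x)))"
proof -
  interpret dv3_chain M N a V
    by (unfold_locales; fact)
  interpret \<pi>: prob_space \<pi> using \<pi> by (simp add: invariant_prob_def)
  have [measurable_cong, simp]: "sets \<pi> = sets borel" using \<pi> by (simp add: invariant_prob_def)
  have w: "w = wt \<eta>" by (simp add: w_def wt_def powr_def fun_eq_iff)
  have cm [measurable]: "c \<in> borel_measurable borel" using c unfolding w Linf_wt_iff by simp
  obtain L where L0: "L \<ge> 0" and L: "\<And>x. \<bar>c x\<bar> \<le> L * wt \<eta> x" using c unfolding w Linf_wt_iff by blast
  have iw\<pi>: "integrable \<pi> (wt \<eta>)" using integrable_wt_invariant \<eta> \<pi> by blast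
  have int\<pi>: "integrable \<pi> f" if "f \<in> Linf (wt \<eta>)" for f
    using that integrable_dominated_invariant[OF \<eta> \<pi>] unfolding Linf_wt_iff by blast
  have intM: "integrable M (\<lambda>\<omega>. f (chain a N x t \<omega>))" if "f \<in> Linf (wt \<eta>)" for f x t
    using that integrable_dominated_chain[OF \<eta>] unfolding Linf_wt_iff by blast
  have cw: "c \<in> Linf (wt \<eta>)" using c w by simp
  obtain u :: "nat \<Rightarrow> real" where u: "summable u" "\<And>t. u t \<ge> 0" and erg:
    "\<And>f L x t. f \<in> borel_measurable borel \<Longrightarrow> (\<And>x. \<bar>f x\<bar> \<le> L * wt \<eta> x) \<Longrightarrow>
      \<bar>(LINT \<omega>|M. f (chain a N x t \<omega>)) - (LINT y|\<pi>. f y)\<bar> \<le> L * u t * wt \<eta> x"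
    by (rule summable_ergodicity[OF \<eta> \<pi>]) blast
  \<comment> \<open>The terms of the series for \<open>h\<close>. Their bound by a summable multiple
    of \<open>wt \<eta>\<close> justifies the exchanges of the series with expectations
    below.\<close>
  define D where "D t x = Pop M N a t c x - cbar" for t x
  have D_eq: "(LINT \<omega>|M. (c (chain a N x t \<omega>) - cbar)) = D t x" for t x
    using intM[OF cw] by (simp add: D_def Pop_eq prob_space)
  have h: "h = (\<lambda>x. \<Sum>t. D t x)" by (simp add: h_def D_eq)
  have Dm [measurable]: "D t \<in> borel_measurable borel" for t
  proof -
    have "(\<lambda>x. Pop M N a t c x - cbar) \<in> borel_measurable borel" by measurable
    then show ?thesis by (simp add: D_def[abs_def])
  qed
  define u' where "u' t = L * u t" for t
  have u': "summable u'" unfolding u'_def using u by (intro summable_mult)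
  have Db: "\<bar>D t x\<bar> \<le> u' t * wt \<eta> x" for t x
    unfolding D_def cbar_def Pop_eq[OF cm] u'_def by (rule erg[OF cm L])
  have DL: "D t \<in> Linf (wt \<eta>)" for t
    unfolding Linf_wt_iff using Db[of t] L0 u(2)[of t] by (auto simp: u'_def intro!: exI[of _ "L * u t"])
  note Ds = weighted_suminf_bound[OF Db u']
  have U0: "(\<Sum>t. u' t) \<ge> 0" by (rule suminf_nonneg[OF u']) (simp add: u'_def L0 u)
  have hm: "h \<in> borel_measurable borel" unfolding h by measurable
  have hL: "h \<in> Linf (wt \<eta>)" unfolding Linf_wt_iff using hm Ds(2) U0 by (auto simp: h)
  \<comment> \<open>One step of the operator shifts the series by one, so \<open>h - Ph\<close>
    telescopes to \<open>D 0\<close>.\<close>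
  have D_Suc: "Pop M N a 1 (D t) x = D (Suc t) x" for t x
  proof -
    have i: "integrable (Pker M N a 1 x) (Pop M N a t c)" "Pop M N a (1 + t) c x = Pop M N a 1 (Pop M N a t c) x"
      using Pop_add[OF cm, of 1 t x] intM[OF cw] by (auto simp: integrable_Pker_iff simp del: chain.simps)
    then show ?thesis by (simp add: D_def[abs_def] Pop_diff_const)
  qed
  have norms: "summable (\<lambda>t. norm (D t x))" for x
    by (rule summable_comparison_test'[OF summable_mult2[OF u', of "wt \<eta> x"]]) (use Db in auto)
  have "h x - Pop M N a 1 h x = c x - cbar" for x
  proof -
    \<comment> \<open>Absolute convergence holds because the expected norms are at most
      \<open>u' t\<close> times the finite expectation of the weight.\<close>
    have "(LINT \<omega>|M. (\<Sum>t. D t (chain a N x 1 \<omega>))) = (\<Sum>t. (LINT \<omega>|M. D t (chain a N x 1 \<omega>)))"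
    proof (rule integral_suminf)
      show "summable (\<lambda>t. LINT \<omega>|M. norm (D t (chain a N x 1 \<omega>)))"
      proof (rule summable_comparison_test')
        show "summable (\<lambda>t. u' t * (LINT \<omega>|M. wt \<eta> (chain a N x 1 \<omega>)))" by (rule summable_mult2[OF u'])
        fix t
        have "(LINT \<omega>|M. norm (D t (chain a N x 1 \<omega>))) \<le> (LINT \<omega>|M. u' t * wt \<eta> (chain a N x 1 \<omega>))"
          using intM[OF DL] \<eta> Db by (intro integral_mono) (auto simp del: chain.simps)
        then show "norm (LINT \<omega>|M. norm (D t (chain a N x 1 \<omega>))) \<le> u' t * (LINT \<omega>|M. wt \<eta> (chain a N x 1 \<omega>))"
          by (simp add: abs_of_nonneg[OF integral_nonneg_AE] del: chain.simps)
      qed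
    qed (use intM[OF DL] norms in \<open>auto simp del: chain.simps\<close>)
    then have "Pop M N a 1 h x = (\<Sum>t. D (Suc t) x)"
      using hm by (simp add: Pop_eq h D_Suc[symmetric] del: chain.simps)
    moreover have "h x = D 0 x + (\<Sum>t. D (Suc t) x)"
      unfolding h using suminf_split_head[OF Ds(1)] by simp
    ultimately show ?thesis by (simp add: D_def)
  qed
  moreover have "integrable (Pker M N a 1 x) h" for x
    using intM[OF hL] hm by (simp add: integrable_Pker_iff del: chain.simps)
  moreover have "(LINT x|\<pi>. h x) = 0"
  proof -
    have "(LINT x|\<pi>. h x) = (\<Sum>t. (LINT x|\<pi>. D t x))" unfolding h
    proof (rule integral_suminf)
      show "summable (\<lambda>t. LINT x|\<pi>. norm (D t x))"
      proof (rule summable_comparison_test')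
        show "summable (\<lambda>t. u' t * (LINT x|\<pi>. wt \<eta> x))" by (rule summable_mult2[OF u'])
        fix t
        have "(LINT x|\<pi>. norm (D t x)) \<le> (LINT x|\<pi>. u' t * wt \<eta> x)"
          using int\<pi>[OF DL] iw\<pi> Db by (intro integral_mono) auto
        then show "norm (LINT x|\<pi>. norm (D t x)) \<le> u' t * (LINT x|\<pi>. wt \<eta> x)"
          by (simp add: abs_of_nonneg[OF integral_nonneg_AE])
      qed
    qed (use int\<pi>[OF DL] norms in auto)
    \<comment> \<open>By invariance every term of the series has \<pi>-mean zero.\<close>
    moreover have "(LINT x|\<pi>. D t x) = 0" for t
    proof -
      have "integrable \<pi> (Pop M N a t c)" "(LINT x|\<pi>. Pop M N a t c x) = cbar"
        using integral_invariant[OF \<pi> cm int\<pi>[OF cw], of t, folded Pop_eq[OF cm]] by (simp_all add: cbar_def)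
      then show ?thesis by (simp add: D_def \<pi>.prob_space)
    qed
    ultimately show ?thesis by simp
  qed
  note h0 = this
  moreover have "g = h" if g: "g \<in> Linf (wt \<eta>)" "\<And>x. g x - Pop M N a 1 g x = c x - cbar" "(LINT x|\<pi>. g x) = 0" for g
  proof (rule ext)
    fix x
    \<comment> \<open>Two solutions of mean zero differ by a function that the operator fixes and
      that has \<pi>-mean zero. It equals all its iterates, and these tend to zero by
      ergodicity.\<close>
    define d where "d y = g y - h y" for y
    have gm [measurable]: "g \<in> borel_measurable borel" using g(1) unfolding Linf_wt_iff by simp
    obtain Lg Lh where Lg: "\<And>y. \<bar>g y\<bar> \<le> Lg * wt \<eta> y" and Lh: "\<And>y. \<bar>h y\<bar> \<le> Lh * wt \<eta> y"
      using g(1) hL unfolding Linf_wt_iff by blast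
    have dm: "d \<in> borel_measurable borel" unfolding d_def using hm gm by measurable
    have db: "\<bar>d y\<bar> \<le> (Lg + Lh) * wt \<eta> y" for y
      using Lg[of y] Lh[of y] unfolding d_def distrib_right by linarith
    have di: "integrable M (\<lambda>\<omega>. d (chain a N y t \<omega>))" for y t
      by (rule integrable_dominated_chain[OF \<eta> dm db])
    have d1: "Pop M N a 1 d y = d y" for y
    proof -
      have "Pop M N a 1 d y = Pop M N a 1 g y - Pop M N a 1 h y"
        unfolding Pop_eq[OF dm] Pop_eq[OF gm] Pop_eq[OF hm] d_def using intM[OF g(1)] intM[OF hL]
        by (simp del: chain.simps)
      then show ?thesis using g(2)[of y] \<open>\<And>x. h x - Pop M N a 1 h x = c x - cbar\<close>[of y] by (simp add: d_def)
    qed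
    have dt: "Pop M N a t d y = d y" for t y
    proof (induction t)
      case (Suc t)
      have "Pop M N a (t + 1) d y = Pop M N a t (Pop M N a 1 d) y"
        using di by (intro Pop_add(1)[OF dm]) (simp add: integrable_Pker_iff dm del: chain.simps)
      also have "Pop M N a 1 d = d" using d1 by blast
      finally show ?case using Suc by simp
    qed (simp add: dm)
    have "(LINT y|\<pi>. d y) = 0" unfolding d_def using int\<pi>[OF g(1)] int\<pi>[OF hL] g(3) h0 by simp
    moreover have "\<bar>Pop M N a t d x - (LINT y|\<pi>. d y)\<bar> \<le> (Lg + Lh) * u t * wt \<eta> x" for t
      unfolding Pop_eq[OF dm] by (rule erg[OF dm db])
    ultimately have b: "\<bar>d x\<bar> \<le> (Lg + Lh) * u t * wt \<eta> x" for t by (simp add: dt)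
    have lim: "(\<lambda>t. (Lg + Lh) * u t * wt \<eta> x) \<longlonglongrightarrow> (Lg + Lh) * 0 * wt \<eta> x"
      by (intro tendsto_intros summable_LIMSEQ_zero u)
    have "\<bar>d x\<bar> \<le> (Lg + Lh) * 0 * wt \<eta> x"
      by (rule LIMSEQ_le_const[OF lim]) (intro exI[of _ 0] allI impI b)
    then show "g x = h x" by (simp add: d_def)
  qed
  moreover have "h \<in> Linf0 (wt \<eta>)" if \<eta>1: "\<eta> < 1" and c0: "c \<in> Linf0 (wt \<eta>)"
  proof -
    have cc: "continuous_on UNIV c" using c0 by (simp add: Linf0_def)
    have cx: "continuous_on UNIV (\<lambda>x. c (chain a N x t \<omega>))" for t \<omega>
      by (rule continuous_on_compose2[OF cc chain_continuous]) simp
    \<comment> \<open>Here \<eta> < 1 enters: continuity of each term rests on the gap between the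
      weights for \<eta> and for 1.\<close>
    have "continuous_on UNIV (\<lambda>x. LINT \<omega>|M. c (chain a N x t \<omega>))" for t
      by (rule continuous_expectation_dominated(1)[OF \<eta>(1) \<eta>1 _ cx L]) simp
    then have "continuous_on UNIV (D t)" for t
      unfolding D_def[abs_def] Pop_eq[OF cm] by (intro continuous_intros)
    from continuous_suminf_weighted[OF Db u' this] have "continuous_on UNIV h" unfolding h .
    then show ?thesis using hL by (simp add: Linf0_def)
  qed
  moreover have "h \<in> Linf1 (wt \<eta>) \<and> (\<forall>t i x. has_partial i (Pop M N a t c) x) \<and>
           (\<forall>x. (\<lambda>t. grad (Pop M N a t c) x) sums grad h x) \<and>
           (\<forall>t x. integrable M (\<lambda>\<omega>. transpose (sens a N x t \<omega>) *v grad c (chain a N x t \<omega>))) \<and>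
           (\<forall>x. (\<lambda>t. Qop M N a t (grad c) x) sums grad h x)"
    if \<eta>1: "\<eta> < 1" and c1: "c \<in> Linf1 (wt \<eta>)"
  proof -
    note gP = gradient_Pop[OF \<eta>(1) \<eta>1 c1]
    have "c \<in> Linf0 (wt \<eta>)" using c1 by (simp add: Linf1_def)
    with calculation \<eta>1 have "h \<in> Linf0 (wt \<eta>)" by blast
    then have hc: "continuous_on UNIV h" by (simp add: Linf0_def)
    obtain v :: "nat \<Rightarrow> real" where v: "summable v" "\<And>t. v t \<ge> 0" and vb: "\<And>t x. norm (grad (Pop M N a t c) x) \<le> v t * wt \<eta> x"
      by (rule summable_gradient[OF \<eta>(1) \<eta>1 \<pi> c1]) blast
    have Dp: "has_partial i (D t) x" "partial i (D t) x = partial i (Pop M N a t c) x" for i t x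
      unfolding D_def[abs_def] using partial_diff_const[OF gP(2)] by auto
    have Dp': "partial i (D t) = partial i (Pop M N a t c)" for i t by (rule ext) (rule Dp(2))
    have pb: "\<bar>partial i (D t) x\<bar> \<le> v t * wt \<eta> x" for i t x
      using component_le_norm_cart[of "grad (Pop M N a t c) x" i] vb[of t x] by (simp add: grad_def Dp(2))
    have hp: "has_partial i h x" "partial i h x = (\<Sum>t. partial i (D t) x)" for i x
      unfolding h using partial_suminf_weighted[OF Db u' Dp(1) pb v(1)] by auto
    have hpc: "continuous_on UNIV (partial i h)" for i
    proof -
      have "partial i h = (\<lambda>x. \<Sum>t. partial i (D t) x)" by (rule ext) (rule hp(2))
      moreover have "continuous_on UNIV (partial i (D t))" for t unfolding Dp' by (rule gP(4))
      from continuous_suminf_weighted[OF pb v(1) this] have "continuous_on UNIV (\<lambda>x. \<Sum>t. partial i (D t) x)" .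
      ultimately show ?thesis by (simp only:)
    qed
    have ps: "(\<lambda>t. partial i (Pop M N a t c) x) sums partial i h x" for i x
      using weighted_suminf_bound(1)[OF pb v(1), THEN summable_sums] by (simp add: hp(2) Dp')
    have gs: "(\<lambda>t. grad (Pop M N a t c) x) sums grad h x" for x
      unfolding sums_def
    proof (rule vec_tendstoI)
      fix i
      show "(\<lambda>n. (\<Sum>t<n. grad (Pop M N a t c) x) $ i) \<longlonglongrightarrow> grad h x $ i"
        using ps[of i x] by (simp add: sums_def grad_def)
    qed
    have "norm (grad h x) \<le> (\<Sum>t. v t) * wt \<eta> x" for x
    proof -
      have s: "summable (\<lambda>t. v t * wt \<eta> x)" by (rule summable_mult2[OF v(1)])
      have "norm (grad h x) = norm (\<Sum>t. grad (Pop M N a t c) x)" using gs[of x] by (simp add: sums_iff)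
      also have "\<dots> \<le> (\<Sum>t. v t * wt \<eta> x)" by (rule norm_suminf_le[OF vb s])
      finally show ?thesis using suminf_mult2[OF v(1)] by simp
    qed
    note hg = this
    have "\<bar>h x\<bar> \<le> (\<Sum>t. u' t) * wt \<eta> x" for x unfolding h by (rule Ds(2))
    from Linf1_wtI[OF hc hp(1) hpc this hg] have "h \<in> Linf1 (wt \<eta>)" .
    then show ?thesis using gP(2) gs Qop_grad_eq[OF \<eta>(1) \<eta>1 c1] by simp
  qed
  ultimately show ?thesis
    using int\<pi>[OF cw] intM[OF cw] Ds(1) hL int\<pi>[OF hL] unfolding w D_eq by blast
qed

end
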